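(* Let $\varphi\in Q$, $W\in A_{p(\varphi)}$ and $k\in\mathbb R^+$. Then there is a constant $C>0$ depending only on $k$, $W$ and $\varphi$ such that for every $f\in L_W^\varphi$ and every $n\in\mathbb N$, $$E_n(f)_{\varphi,W}\le C\,\Omega_k\left(f,\tfrac1n\right)_{\varphi,W}.$$
   Context: $\mathbb R^+=(0,\infty)$, $\mathbb N=\{1,2,\dots\}$, $\mathsf T=[0,2\pi]$; functions on $\mathsf T$ are regarded as $2\pi$-periodic functions on $\mathbb R$. Young functions: $\varphi:\mathbb R\to[0,\infty)$ is a Young function if it is even, continuous, increasing on $(0,\infty)$, $\varphi(0)=0$ and $\lim_{x\to\infty}\varphi(x)=\infty$. A function $\varphi$ on $[0,\infty)$ is quasiconvex if there are a convex Young function $\Phi$ and $C\ge1$ with $\Phi(x)\le\varphi(x)\le\Phi(Cx)$ for all $x\ge0$. A Young function satisfies $\Delta_2$ if for some $C>0$, $\varphi(2x)\le C\varphi(x)$ for all $x$. $Q$ is the class of Young functions $\varphi$ satisfying $\Delta_2$ such that $\varphi^\theta$ is quasiconvex for some $\theta\in(0,1)$. The index $p(\varphi)$ is defined by $\frac1{p(\varphi)}=\inf\{p>0:\varphi^p\text{ is quasiconvex}\}$. Weights: a weight is a measurable, a.e. positive, $2\pi$-periodic function $\omega$. For $1<p<\infty$, $\omega\in A_p$ if $\sup_J\left(\frac1{|J|}\int_J\omega\right)\left(\frac1{|J|}\int_J\omega^{1/(1-p)}\right)^{p-1}<\infty$, the supremum over all subintervals $J$. Orlicz space: $L_W^\varphi$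 is the space of measurable $f:\mathsf T\to\mathbb R$ with $\int_{\mathsf T}\varphi(C|f|)W\,dx<\infty$ for some $C>0$, with norm $\|f\|_{\varphi,W}=\sup\{\int_{\mathsf T}|fg|W\,dx:\int_{\mathsf T}\tilde\varphi(|g|)W\,dx\le1\}$, where $\tilde\varphi(y)=\sup_{x\ge0}\{xy-\varphi(x)\}$, $y\ge0$. Modulus of smoothness: $\mathcal A_hf(x)=\frac1h\int_{-h/2}^{h/2}f(x+t)\,dt$ for $h>0$; for $k\in\mathbb R^+$, $(I-\mathcal A_h)^kf=\sum_{j=0}^\infty(-1)^j\binom kj\mathcal A_h^jf$ (convergent in $\|\cdot\|_{\varphi,W}$), where $\binom kj=\frac{\Gamma(k+1)}{\Gamma(j+1)\Gamma(k-j+1)}$ ($1/\Gamma$ being $0$ at poles of $\Gamma$); $\Omega_k(f,\delta)_{\varphi,W}=\sup_{0<h\le\delta}\|(I-\mathcal A_h)^kf\|_{\varphi,W}$. Best approximation: $E_n(f)_{\varphi,W}=\inf\{\|f-T\|_{\varphi,W}:T\in\mathcal T_n\}$, $\mathcal T_n$ the real trigonometric polynomials of degree at most $n$. *)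

theory Defs
  imports "HOL-Analysis.Analysis"
begin

section \<open>Young functions\<close>

text \<open>``Increasing'' is read in the weak sense (nondecreasing).\<close>

definition young_fun :: "(real \<Rightarrow> real) \<Rightarrow> bool" where
  "young_fun \<phi> \<longleftrightarrow>
     (\<forall>x. 0 \<le> \<phi> x) \<and> (\<forall>x. \<phi> (- x) = \<phi> x) \<and> continuous_on UNIV \<phi> \<and>
     mono_on {0<..} \<phi> \<and> \<phi> 0 = 0 \<and> filterlim \<phi> at_top at_top"

definition quasiconvex :: "(real \<Rightarrow> real) \<Rightarrow> bool" where
  "quasiconvex \<phi> \<longleftrightarrow>
     (\<exists>\<Phi> C. young_fun \<Phi> \<and> convex_on UNIV \<Phi> \<and> 1 \<le> C \<and>
        (\<forall>x\<ge>0. \<Phi> x \<le> \<phi> x \<and> \<phi> x \<le> \<Phi> (C * x)))"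

definition Delta2 :: "(real \<Rightarrow> real) \<Rightarrow> bool" where
  "Delta2 \<phi> \<longleftrightarrow> (\<exists>C>0. \<forall>x. \<phi> (2 * x) \<le> C * \<phi> x)"

definition Q_class :: "(real \<Rightarrow> real) set" where
  "Q_class = {\<phi>. young_fun \<phi> \<and> Delta2 \<phi> \<and>
     (\<exists>\<theta>. 0 < \<theta> \<and> \<theta> < 1 \<and> quasiconvex (\<lambda>x. \<phi> x powr \<theta>))}"

text \<open>For \<open>\<phi>\<close> in the class \<open>Q\<close> the infimum is taken over a nonempty set and lies strictly
  between 0 and 1 (it is positive by the \<open>\<Delta>\<^sub>2\<close> condition), so the index is a real number
  greater than 1.\<close>

definition young_index :: "(real \<Rightarrow> real) \<Rightarrow> real" where
  "young_index \<phi> = 1 / Inf {p. 0 < p \<and> quasiconvex (\<lambda>x. \<phi> x powr p)}"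

section \<open>Weights\<close>

definition weight :: "(real \<Rightarrow> real) \<Rightarrow> bool" where
  "weight \<omega> \<longleftrightarrow> \<omega> \<in> borel_measurable lebesgue \<and> (AE x in lebesgue. 0 < \<omega> x) \<and>
     (\<forall>x. \<omega> (x + 2 * pi) = \<omega> x)"

text \<open>The intervals range over all bounded intervals of the real line, in accordance with
  the periodic extension. Both factors are integrals of a.e. positive functions, so finiteness
  of the supremum includes finiteness of each integral; this has to be stated separately
  because the integral of a non-integrable function is 0 here.\<close>

definition Muckenhoupt :: "real \<Rightarrow> (real \<Rightarrow> real) set" where
  "Muckenhoupt p = {\<omega>. weight \<omega> \<and> 1 < p \<and>
     (\<forall>a b. a < b \<longrightarrow> set_integrable lebesgue {a..b} \<omega> \<and>
        set_integrable lebesgue {a..b} (\<lambda>x. \<omega> x powr (1 / (1 - p)))) \<and>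
     bdd_above {(1 / (b - a) * (LINT x:{a..b}|lebesgue. \<omega> x)) *
        (1 / (b - a) * (LINT x:{a..b}|lebesgue. \<omega> x powr (1 / (1 - p)))) powr (p - 1) | a b. a < b}}"

section \<open>Weighted Orlicz spaces\<close>

abbreviation torus :: "real measure" where
  "torus \<equiv> lebesgue_on {0..2 * pi}"

text \<open>The truncation of negative values by \<^const>\<open>ennreal\<close> is harmless, as \<open>x = 0\<close>
  contributes the value 0 if \<open>\<phi> 0 = 0\<close>.\<close>

definition compl_fun :: "(real \<Rightarrow> real) \<Rightarrow> real \<Rightarrow> ennreal" where
  "compl_fun \<phi> y = (SUP x\<in>{0..}. ennreal (x * y - \<phi> x))"

definition orlicz_space :: "(real \<Rightarrow> real) \<Rightarrow> (real \<Rightarrow> real) \<Rightarrow> (real \<Rightarrow> real) set" where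
  "orlicz_space \<phi> W = {f. f \<in> borel_measurable lebesgue \<and> (\<forall>x. f (x + 2 * pi) = f x) \<and>
     (\<exists>C>0. (\<integral>\<^sup>+x. ennreal (\<phi> (C * \<bar>f x\<bar>) * W x) \<partial>torus) < \<infinity>)}"

definition orlicz_norm :: "(real \<Rightarrow> real) \<Rightarrow> (real \<Rightarrow> real) \<Rightarrow> (real \<Rightarrow> real) \<Rightarrow> ennreal" where
  "orlicz_norm \<phi> W f =
     (SUP g\<in>{g. g \<in> borel_measurable torus \<and>
                (\<integral>\<^sup>+x. compl_fun \<phi> \<bar>g x\<bar> * ennreal (W x) \<partial>torus) \<le> 1}.
        \<integral>\<^sup>+x. ennreal (\<bar>f x * g x\<bar> * W x) \<partial>torus)"

section \<open>Modulus of smoothness\<close>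

definition steklov :: "real \<Rightarrow> (real \<Rightarrow> real) \<Rightarrow> real \<Rightarrow> real" where
  "steklov h f x = 1 / h * (LINT t:{- h / 2..h / 2}|lebesgue. f (x + t))"

text \<open>For positive \<open>k\<close>, \<^const>\<open>gbinomial\<close> is given by the Gamma function; the convention that
  division by 0 yields 0 and that \<^const>\<open>Gamma\<close> is 0 at its poles accounts for the reciprocal
  Gamma function vanishing there.\<close>

lemma gbinomial_eq_Gamma_quotient:
  fixes k :: real
  assumes "0 < k"
  shows "k gchoose j = Gamma (k + 1) / (Gamma (real j + 1) * Gamma (k - real j + 1))"
proof -
  have "k + 1 \<notin> \<int>\<^sub>\<le>\<^sub>0"
    using assms by (auto elim!: nonpos_Ints_cases)
  then show ?thesis
    using gbinomial_Gamma[of k j] Gamma_fact[of j, where ?'a = real] by (simp add: add.commute)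
qed

definition frac_diff_partial ::
    "real \<Rightarrow> real \<Rightarrow> (real \<Rightarrow> real) \<Rightarrow> nat \<Rightarrow> real \<Rightarrow> real" where
  "frac_diff_partial k h f N x = (\<Sum>j<N. (-1) ^ j * (k gchoose j) * (steklov h ^^ j) f x)"

text \<open>The fractional difference is the sum of the series in the Orlicz norm. This determines
  it up to a null set, and \<^const>\<open>orlicz_norm\<close> does not distinguish between a.e. equal
  functions, so any representative may be chosen.\<close>

definition frac_diff ::
    "(real \<Rightarrow> real) \<Rightarrow> (real \<Rightarrow> real) \<Rightarrow> real \<Rightarrow> real \<Rightarrow> (real \<Rightarrow> real) \<Rightarrow> real \<Rightarrow> real" where
  "frac_diff \<phi> W k h f =
     (SOME F. F \<in> orlicz_space \<phi> W \<and>
        (\<lambda>N. orlicz_norm \<phi> W (\<lambda>x. frac_diff_partial k h f N x - F x)) \<longlonglongrightarrow> 0)"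

definition mod_smooth ::
    "(real \<Rightarrow> real) \<Rightarrow> (real \<Rightarrow> real) \<Rightarrow> real \<Rightarrow> (real \<Rightarrow> real) \<Rightarrow> real \<Rightarrow> ennreal" where
  "mod_smooth \<phi> W k f \<delta> = (SUP h\<in>{0<..\<delta>}. orlicz_norm \<phi> W (frac_diff \<phi> W k h f))"

section \<open>Best approximation\<close>

definition trig_polys :: "nat \<Rightarrow> (real \<Rightarrow> real) set" where
  "trig_polys n =
     {T. \<exists>a b. T = (\<lambda>x. \<Sum>j\<le>n. a j * cos (real j * x) + b j * sin (real j * x))}"

definition best_approx ::
    "(real \<Rightarrow> real) \<Rightarrow> (real \<Rightarrow> real) \<Rightarrow> nat \<Rightarrow> (real \<Rightarrow> real) \<Rightarrow> ennreal" where
  "best_approx \<phi> W n f = (INF T\<in>trig_polys n. orlicz_norm \<phi> W (\<lambda>x. f x - T x))"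

end

theory Submission
  imports Defs
begin

text \<open>
  Write \<open>A\<close> for the Steklov mean with step \<open>h = 1/n\<close>. Everything is reduced to one estimate: the means with
  arbitrary step \<open>u > 0\<close> are bounded on the weighted Orlicz space uniformly in \<open>u\<close>. For this, the
  \<open>A\<^sub>p\<close> condition is open in \<open>p\<close> (reverse Hoelder inequality, by a dyadic stopping argument), so there is \<open>q\<close>
  with \<open>W \<in> A\<^sub>q\<close> and \<open>\<phi>\<^bsup>1/q\<^esup>\<close> quasiconvex; the inequalities of Jensen and Hoelder and Tonelli's theorem then
  give a modular inequality. Operators dominated by mixtures of Steklov means inherit the bound, in
  particular all powers \<open>A\<^sup>j\<close>, uniformly in \<open>j\<close>.

  Let \<open>s\<close> be the symbol of \<open>A\<close>. Since \<open>1/(1-s) = 1 + s + s\<^sup>2/(1-s)\<close>, the operator \<open>L = I + A + K\<close>, where the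
  multiplier of \<open>K\<close> is \<open>s\<^sup>2/(1-s)\<close> at frequencies \<open>m \<ge> n\<close> and constant below, inverts \<open>I - A\<close> on high
  frequencies: \<open>f - L(I-A)f\<close> is a trigonometric polynomial of degree below \<open>n\<close>. Summation by parts
  bounds the kernel of \<open>K\<close> by \<open>C min(n, 1/(n t\<^sup>2))\<close>, a mixture of Steklov kernels, so \<open>L\<close> is bounded and
  \<open>E\<^sub>n(f) \<le> C \<parallel>(I-A)\<^sup>r f\<parallel>\<close> for every natural number \<open>r\<close>. Finally
  \<open>(I-A)\<^sup>r = (I-A)\<^bsup>r-k\<^esup> (I-A)\<^sup>k\<close> for \<open>r \<ge> k\<close>, and \<open>(I-A)\<^bsup>r-k\<^esup>\<close> is bounded because its binomial
  coefficients are absolutely summable.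
\<close>

section \<open>Muckenhoupt weights: reverse Hoelder inequality and openness\<close>

text \<open>Three obstacles shape the proof. The infimum defining the index need not be attained, so
  quasiconvexity of a power 1/q may hold only for q below the index; openness of A_p in p lets W
  follow. Next, iterating an operator bound c would give c^j for the j-th power of A, which binomial
  coefficients of polynomial decay cannot compensate; instead, a composition of two Steklov means is
  an average of Steklov means with total mass one, so for a fixed dual function the induction on j
  loses no constant. Finally, 1/(1-s) does not decay and s/(1-s) decays only like 1/m, whereas
  s^2/(1-s) decays like 1/m^2 and has an absolutely convergent cosine series. This is why two terms
  are split off; freezing the rest below n keeps it away from the singularity at frequency 0, where
  s = 1. Passing through an integer r turns the comparison with the fractional power into a Cauchy
  product of absolutely convergent series whose result is a finite sum.\<close>

lemma powr_mult_le_convex_combination: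
  fixes x y \<theta> :: real
  assumes "0 \<le> x" "0 \<le> y" "0 < \<theta>" "\<theta> < 1" "0 < a" "0 < b"
  shows "x powr \<theta> * y powr (1 - \<theta>) \<le> a powr \<theta> * b powr (1 - \<theta>) * (\<theta> * (x / a) + (1 - \<theta>) * (y / b))"
proof (cases "x = 0 \<or> y = 0")
  case True
  then show ?thesis using assms by (auto intro!: mult_nonneg_nonneg add_nonneg_nonneg)
next
  case False
  then have "(x / a) powr \<theta> * (y / b) powr (1 - \<theta>) \<le> \<theta> * (x / a) + (1 - \<theta>) * (y / b)"
    using assms by (intro Youngs_inequality_0) auto
  then have "a powr \<theta> * b powr (1 - \<theta>) * ((x / a) powr \<theta> * (y / b) powr (1 - \<theta>))
      \<le> a powr \<theta> * b powr (1 - \<theta>) * (\<theta> * (x / a) + (1 - \<theta>) * (y / b))"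
    by (intro mult_left_mono) auto
  moreover have "a powr \<theta> * b powr (1 - \<theta>) * ((x / a) powr \<theta> * (y / b) powr (1 - \<theta>))
     = x powr \<theta> * y powr (1 - \<theta>)"
    using assms by (simp add: powr_divide)
  ultimately show ?thesis by simp
qed

text \<open>The weighted arithmetic-geometric inequality, after dividing each factor by its
  integral. The form with exponents \<open>\<theta>\<close> and \<open>1 - \<theta>\<close> on
  integrable functions suits the later splitting of a weight against its dual. If one integral
  vanishes, the product is zero almost everywhere.\<close>

lemma Hoelder_powr:
  fixes X Y :: "'a \<Rightarrow> real"
  assumes X: "integrable M X" and Y: "integrable M Y"
    and nn: "\<And>x. 0 \<le> X x" "\<And>x. 0 \<le> Y x" and \<theta>: "0 < \<theta>" "\<theta> < 1"
  shows "integrable M (\<lambda>x. X x powr \<theta> * Y x powr (1 - \<theta>))" (is ?int)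
    and "(\<integral>x. X x powr \<theta> * Y x powr (1 - \<theta>) \<partial>M) \<le> (\<integral>x. X x \<partial>M) powr \<theta> * (\<integral>x. Y x \<partial>M) powr (1 - \<theta>)"
      (is ?le)
proof -
  have [measurable]: "X \<in> borel_measurable M" "Y \<in> borel_measurable M"
    using X Y by auto
  show i: ?int
  proof (rule Bochner_Integration.integrable_bound)
    show "integrable M (\<lambda>x. X x + Y x)" using X Y by auto
    show "AE x in M. norm (X x powr \<theta> * Y x powr (1 - \<theta>)) \<le> norm (X x + Y x)"
    proof (rule AE_I2)
      fix x
      have "X x powr \<theta> * Y x powr (1 - \<theta>) \<le> \<theta> * X x + (1 - \<theta>) * Y x"
        using powr_mult_le_convex_combination[of "X x" "Y x" \<theta> 1 1] nn[of x] \<theta> by simp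
      also have "\<dots> \<le> X x + Y x"
        using nn[of x] \<theta> by (intro add_mono mult_left_le_one_le) auto
      finally show "norm (X x powr \<theta> * Y x powr (1 - \<theta>)) \<le> norm (X x + Y x)"
        using nn[of x] by simp
    qed
  qed simp
  let ?a = "\<integral>x. X x \<partial>M" and ?b = "\<integral>x. Y x \<partial>M"
  have ab: "0 \<le> ?a" "0 \<le> ?b" using nn by auto
  show ?le
  proof (cases "?a = 0 \<or> ?b = 0")
    case True
    then have "AE x in M. X x = 0 \<or> Y x = 0"
    proof
      assume "?a = 0"
      then have "AE x in M. X x = 0" using X nn by (subst (asm) integral_nonneg_eq_0_iff_AE) auto
      then show ?thesis by eventually_elim auto
    next
      assume "?b = 0"
      then have "AE x in M. Y x = 0" using Y nn by (subst (asm) integral_nonneg_eq_0_iff_AE) auto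
      then show ?thesis by eventually_elim auto
    qed
    then have "AE x in M. X x powr \<theta> * Y x powr (1 - \<theta>) = 0" by eventually_elim auto
    then have "(\<integral>x. X x powr \<theta> * Y x powr (1 - \<theta>) \<partial>M) = 0"
      by (rule integral_eq_zero_AE)
    then show ?thesis by simp
  next
    case False
    then have pos: "0 < ?a" "0 < ?b" using ab by auto
    have "(\<integral>x. X x powr \<theta> * Y x powr (1 - \<theta>) \<partial>M)
       \<le> (\<integral>x. ?a powr \<theta> * ?b powr (1 - \<theta>) * (\<theta> * (X x / ?a) + (1 - \<theta>) * (Y x / ?b)) \<partial>M)"
      using X Y i by (intro integral_mono powr_mult_le_convex_combination nn \<theta> pos) auto
    also have "\<dots> = ?a powr \<theta> * ?b powr (1 - \<theta>) * (\<theta> * (?a / ?a) + (1 - \<theta>) * (?b / ?b))"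
      using X Y by simp
    also have "\<dots> = ?a powr \<theta> * ?b powr (1 - \<theta>)" using pos by simp
    finally show ?thesis .
  qed
qed

abbreviation lint :: "(real \<Rightarrow> real) \<Rightarrow> real set \<Rightarrow> real" where
  "lint f A \<equiv> (LINT x:A|lborel. f x)"

text \<open>Condition A_p for an everywhere positive Borel representative. Half-open intervals split
  at an interior point into disjoint intervals of the same kind, on which the dyadic arguments rely;
  for \<open>b \<le> a\<close> they are empty. Periodicity is kept apart.\<close>

definition Ap_weight :: "real \<Rightarrow> (real \<Rightarrow> real) \<Rightarrow> bool" where
  "Ap_weight p w \<longleftrightarrow> w \<in> borel_measurable borel \<and> (\<forall>x. 0 < w x) \<and> 1 < p \<and>
    (\<forall>a b. set_integrable lborel {a<..b} w \<and> set_integrable lborel {a<..b} (\<lambda>x. w x powr (1 / (1 - p)))) \<and>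
    (\<exists>C. \<forall>a b. a < b \<longrightarrow> (lint w {a<..b} / (b - a)) *
       (lint (\<lambda>x. w x powr (1 / (1 - p))) {a<..b} / (b - a)) powr (p - 1) \<le> C)"

lemma lint_pos:
  assumes "w \<in> borel_measurable borel" "\<And>x. 0 < w x" "set_integrable lborel {a<..b} w" "a < b"
  shows "0 < lint w {a<..b}"
proof -
  have "0 \<le> lint w {a<..b}"
    unfolding set_lebesgue_integral_def using assms(2) by (intro integral_nonneg_AE AE_I2) (auto simp: less_imp_le)
  moreover have "lint w {a<..b} \<noteq> 0"
  proof
    assume "lint w {a<..b} = 0"
    then have "AE x in lborel. indicator {a<..b} x * w x = 0"
      using assms unfolding set_lebesgue_integral_def set_integrable_def
      by (subst (asm) integral_nonneg_eq_0_iff_AE) (auto simp: less_imp_le)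
    then have "AE x in lborel. x \<notin> {a<..b}"
      by eventually_elim (use assms(2) in \<open>auto simp: indicator_def less_imp_neq[THEN not_sym] split: if_splits\<close>)
    then have "emeasure lborel {a<..b} = 0"
      by (subst (asm) AE_iff_measurable[of "{a<..b}"]) auto
    then show False using \<open>a < b\<close> by simp
  qed
  ultimately show ?thesis by simp
qed

lemma lint_mono_set:
  assumes "set_integrable lborel B w" "\<And>x. 0 \<le> w x" "A \<in> sets borel" "A \<subseteq> B"
  shows "lint w A \<le> lint w B"
proof -
  have "set_integrable lborel A w" using assms by (intro set_integrable_subset[OF assms(1)]) auto
  then show ?thesis using assms unfolding set_lebesgue_integral_def set_integrable_def
    by (intro integral_mono) (auto simp: indicator_def)
qed

lemma lint_split:
  fixes a b c :: real
  assumes "set_integrable lborel {a<..c} w" "a \<le> b" "b \<le> c"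
  shows "lint w {a<..c} = lint w {a<..b} + lint w {b<..c}"
proof -
  have eq: "{a<..c} = {a<..b} \<union> {b<..c}" using assms by auto
  have "set_integrable lborel {a<..b} w" "set_integrable lborel {b<..c} w"
    using assms by (auto intro!: set_integrable_subset[OF assms(1)])
  then show ?thesis unfolding eq by (intro set_integral_Un) auto
qed

lemma integrable_indicator_Ioc:
  fixes a b :: real
  shows "integrable lborel (indicat_real {a<..b})"
proof (rule integrable_real_indicator)
  show "emeasure lborel {a<..b} < \<infinity>" 
    by (rule emeasure_bounded_finite, rule bounded_subset[OF bounded_closed_interval[of a b]]) auto
qed auto

lemma set_integrable_mult_bounded:
  fixes w g :: "'a \<Rightarrow> real"
  assumes "set_integrable M A w" "g \<in> borel_measurable M" "A \<in> sets M" "\<And>x. x \<in> A \<Longrightarrow> \<bar>g x\<bar> \<le> B"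
  shows "set_integrable M A (\<lambda>x. w x * g x)"
  unfolding set_integrable_def
proof (rule Bochner_Integration.integrable_bound)
  show "integrable M (\<lambda>x. B * (indicator A x * w x))"
    using assms(1) unfolding set_integrable_def by (intro integrable_mult_right) auto
  show "AE x in M. norm (indicat_real A x *\<^sub>R (w x * g x)) \<le> norm (B * (indicat_real A x * w x))"
  proof (rule AE_I2)
    fix x
    show "norm (indicat_real A x *\<^sub>R (w x * g x)) \<le> norm (B * (indicat_real A x * w x))"
      using mult_left_mono[OF order_trans[OF assms(4)[of x] abs_ge_self], of "\<bar>w x\<bar>"]
      by (auto simp: indicator_def abs_mult mult_ac)
  qed
  have "(\<lambda>x. (indicat_real A x *\<^sub>R w x) * g x) \<in> borel_measurable M"
    using assms(1,2) unfolding set_integrable_def by (intro borel_measurable_times) auto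
  then show "(\<lambda>x. indicat_real A x *\<^sub>R (w x * g x)) \<in> borel_measurable M" by (simp add: mult_ac)
qed

section \<open>Reverse Hoelder inequality for A_infinity weights\<close>

text \<open>\<open>ainf\<close> is a quantitative A_infinity condition: a set of at most half the
  length of an interval carries at most the fraction \<open>\<beta>\<close> of its mass. It will
  make the contribution of the stopping set small enough to be absorbed.\<close>

locale A_infinity =
  fixes w :: "real \<Rightarrow> real" and \<beta> :: real
  assumes w_meas [measurable]: "w \<in> borel_measurable borel" and w_pos: "\<And>x. 0 < w x"
    and w_int: "\<And>a b. set_integrable lborel {a<..b} w"
    and ainf: "\<And>a b E. a < b \<Longrightarrow> E \<in> sets borel \<Longrightarrow> E \<subseteq> {a<..b} \<Longrightarrow>
       measure lborel E \<le> (b - a) / 2 \<Longrightarrow> lint w E \<le> \<beta> * lint w {a<..b}"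
    and \<beta>: "0 \<le> \<beta>" "\<beta> < 1"
begin

definition mean :: "real \<Rightarrow> real \<Rightarrow> real" where
  "mean a b = lint w {a<..b} / (b - a)"

lemma mean_pos: "a < b \<Longrightarrow> 0 < mean a b"
  unfolding mean_def using lint_pos[OF w_meas w_pos w_int] by auto

lemma lint_mean: "a < b \<Longrightarrow> lint w {a<..b} = mean a b * (b - a)"
  by (simp add: mean_def)

text \<open>The integral of the q-th power of the n-th dyadic conditional expectation of w. It is
  finite before anything is known about \<open>w x powr q\<close>, so estimates for it can be closed
  by induction on n.\<close>

fun dyadic_sum :: "real \<Rightarrow> nat \<Rightarrow> real \<Rightarrow> real \<Rightarrow> real" where
  "dyadic_sum q 0 a b = (b - a) * mean a b powr q"
| "dyadic_sum q (Suc n) a b = dyadic_sum q n a ((a + b) / 2) + dyadic_sum q n ((a + b) / 2) b"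

definition rh_bound :: "real \<Rightarrow> real \<Rightarrow> nat \<Rightarrow> bool" where
  "rh_bound \<epsilon> C n \<longleftrightarrow> (\<forall>a b. a < b \<longrightarrow> dyadic_sum (1 + \<epsilon>) n a b \<le> C * mean a b powr \<epsilon> * lint w {a<..b})"

text \<open>A half whose mean exceeds the level is selected whole. Its mean is at most
  \<open>2 * level\<close>, because the parent has twice the length and mean at most
  \<open>level\<close>; on it the bound \<open>T\<close> for depth n replaces any further
  subdivision.\<close>

lemma stopping_half:
  assumes ab: "a < b" "a \<le> c" "c < d" "d \<le> b" and l: "mean a b \<le> level" "2 * (d - c) = b - a"
    and \<epsilon>: "0 < \<epsilon>" and C: "0 \<le> C"
    and T: "rh_bound \<epsilon> C n"
    and S: "mean c d \<le> level \<Longrightarrow> \<exists>E \<in> sets borel. E \<subseteq> {c<..d} \<and> level * measure lborel E \<le> lint w E \<and>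
      dyadic_sum (1 + \<epsilon>) n c d \<le> level powr \<epsilon> * lint w {c<..d} + C * (2 * level) powr \<epsilon> * lint w E"
  shows "\<exists>E \<in> sets borel. E \<subseteq> {c<..d} \<and> level * measure lborel E \<le> lint w E \<and>
      dyadic_sum (1 + \<epsilon>) n c d \<le> level powr \<epsilon> * lint w {c<..d} + C * (2 * level) powr \<epsilon> * lint w E"
proof (cases "mean c d \<le> level")
  case True
  then show ?thesis by (rule S)
next
  case False
  have "lint w {c<..d} \<le> lint w {a<..b}"
    using ab w_pos by (intro lint_mono_set w_int) (auto simp: less_imp_le)
  also have "\<dots> \<le> level * (b - a)"
    using l ab by (simp add: lint_mean)
  finally have "mean c d \<le> 2 * level"
    using ab l(2) by (auto simp: mean_def divide_simps mult_ac)
  have pos: "0 < lint w {c<..d}" using lint_pos[OF w_meas w_pos w_int] ab by auto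
  have "dyadic_sum (1 + \<epsilon>) n c d \<le> C * mean c d powr \<epsilon> * lint w {c<..d}"
    using T ab unfolding rh_bound_def by auto
  also have "\<dots> \<le> C * (2 * level) powr \<epsilon> * lint w {c<..d}"
    using \<epsilon> C pos \<open>mean c d \<le> 2 * level\<close> mean_pos[OF \<open>c < d\<close>]
    by (intro mult_right_mono mult_left_mono powr_mono2) auto
  finally have *: "dyadic_sum (1 + \<epsilon>) n c d \<le> C * (2 * level) powr \<epsilon> * lint w {c<..d}" .
  show ?thesis
    using False pos ab * by (intro bexI[of _ "{c<..d}"]) (auto simp: lint_mean intro: add_increasing)
qed

text \<open>E is the union of the maximal dyadic subintervals, down to generation n, with mean above
  \<open>level\<close>. The pieces that are never selected have mean at most \<open>level\<close>
  and give the first term; the selected ones have mean at most \<open>2 * level\<close> and are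
  covered by the bounds for smaller depths.\<close>

lemma stopping:
  assumes \<epsilon>: "0 < \<epsilon>" and C: "0 \<le> C"
  shows "(\<And>m. m < n \<Longrightarrow> rh_bound \<epsilon> C m) \<Longrightarrow> a < b \<Longrightarrow> mean a b \<le> level \<Longrightarrow>
    \<exists>E \<in> sets borel. E \<subseteq> {a<..b} \<and> level * measure lborel E \<le> lint w E \<and>
      dyadic_sum (1 + \<epsilon>) n a b \<le> level powr \<epsilon> * lint w {a<..b} + C * (2 * level) powr \<epsilon> * lint w E"
proof (induction n arbitrary: a b)
  case 0
  have "dyadic_sum (1 + \<epsilon>) 0 a b = mean a b powr \<epsilon> * lint w {a<..b}"
    using 0 mean_pos[of a b] by (simp add: lint_mean powr_add)
  also have "\<dots> \<le> level powr \<epsilon> * lint w {a<..b}"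
    using 0 \<epsilon> mean_pos[of a b] lint_pos[OF w_meas w_pos w_int, of a b]
    by (intro mult_right_mono powr_mono2) auto
  finally show ?case by (intro bexI[of _ "{}"]) (auto simp: set_lebesgue_integral_def)
next
  case (Suc n)
  define m where "m = (a + b) / 2"
  have m: "a < m" "m < b" "2 * (m - a) = b - a" "2 * (b - m) = b - a" using Suc by (auto simp: m_def field_simps)
  have S: "\<exists>E \<in> sets borel. E \<subseteq> {c<..d} \<and> level * measure lborel E \<le> lint w E \<and>
      dyadic_sum (1 + \<epsilon>) n c d \<le> level powr \<epsilon> * lint w {c<..d} + C * (2 * level) powr \<epsilon> * lint w E"
    if "c < d" "mean c d \<le> level" for c d
    using that Suc by (intro Suc.IH) auto
  obtain E1 where E1: "E1 \<in> sets borel" "E1 \<subseteq> {a<..m}" "level * measure lborel E1 \<le> lint w E1"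
      "dyadic_sum (1 + \<epsilon>) n a m \<le> level powr \<epsilon> * lint w {a<..m} + C * (2 * level) powr \<epsilon> * lint w E1"
    using stopping_half[OF Suc.prems(2) order_refl m(1) less_imp_le[OF m(2)] Suc.prems(3) m(3) \<epsilon> C
      Suc.prems(1)[OF lessI] S[OF m(1)]] by blast
  obtain E2 where E2: "E2 \<in> sets borel" "E2 \<subseteq> {m<..b}" "level * measure lborel E2 \<le> lint w E2"
      "dyadic_sum (1 + \<epsilon>) n m b \<le> level powr \<epsilon> * lint w {m<..b} + C * (2 * level) powr \<epsilon> * lint w E2"
    using stopping_half[OF Suc.prems(2) less_imp_le[OF m(1)] m(2) order_refl Suc.prems(3) m(4) \<epsilon> C
      Suc.prems(1)[OF lessI] S[OF m(2)]] by blast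
  have dis: "E1 \<inter> E2 = {}" using E1 E2 m by fastforce
  have w12: "lint w (E1 \<union> E2) = lint w E1 + lint w E2"
    using E1 E2 dis by (intro set_integral_Un) (auto intro: set_integrable_subset[OF w_int])
  have "bounded {a<..m}" "bounded {m<..b}"
    by (rule bounded_subset[OF bounded_cbox[of a m]], force) (rule bounded_subset[OF bounded_cbox[of m b]], force)
  then have fin: "emeasure lborel E1 < \<infinity>" "emeasure lborel E2 < \<infinity>"
    using E1(2) E2(2) by (metis emeasure_bounded_finite bounded_subset infinity_ennreal_def)+
  have m12: "measure lborel (E1 \<union> E2) = measure lborel E1 + measure lborel E2"
    using E1 E2 dis fin by (intro measure_Un3[THEN trans]) (auto simp: fmeasurable_def)
  have "dyadic_sum (1 + \<epsilon>) (Suc n) a b \<le> level powr \<epsilon> * (lint w {a<..m} + lint w {m<..b}) + C * (2 * level) powr \<epsilon> * lint w (E1 \<union> E2)"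
    using E1(4) E2(4) unfolding w12 by (simp add: m_def[symmetric] algebra_simps)
  moreover have "lint w {a<..m} + lint w {m<..b} = lint w {a<..b}"
    using m by (intro lint_split[symmetric] w_int) auto
  ultimately have fin: "dyadic_sum (1 + \<epsilon>) (Suc n) a b \<le> level powr \<epsilon> * lint w {a<..b} + C * (2 * level) powr \<epsilon> * lint w (E1 \<union> E2)"
    by simp
  show ?case
  proof (intro bexI[of _ "E1 \<union> E2"] conjI)
    show "E1 \<union> E2 \<subseteq> {a<..b}" using E1(2) E2(2) m(1,2) by fastforce
    show "level * measure lborel (E1 \<union> E2) \<le> lint w (E1 \<union> E2)"
      unfolding w12 m12 distrib_left by (intro add_mono E1 E2)
  qed (use E1 E2 fin in auto)
qed

text \<open>Stop at twice the mean. Then the stopping set has at most half the length, so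
  \<open>ainf\<close> gives it at most the fraction \<open>\<beta>\<close> of the mass, and a bound
  C for smaller depths yields 2^\<epsilon> + C * 4^\<epsilon> * \<beta> for depth n. The constant in
  the statement is the fixed point of this recursion.\<close>

lemma rh_bound_all:
  assumes \<epsilon>: "0 < \<epsilon>" "4 powr \<epsilon> * \<beta> < 1"
  shows "rh_bound \<epsilon> (2 powr \<epsilon> / (1 - 4 powr \<epsilon> * \<beta>)) n"
proof (induction n rule: less_induct)
  case (less n)
  define C where "C = 2 powr \<epsilon> / (1 - 4 powr \<epsilon> * \<beta>)"
  have C: "0 \<le> C" using \<epsilon> by (simp add: C_def)
  have CC: "2 powr \<epsilon> + C * 4 powr \<epsilon> * \<beta> = C"
    using \<epsilon> unfolding C_def by (simp add: divide_simps) (simp add: algebra_simps)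
  have "dyadic_sum (1 + \<epsilon>) n a b \<le> C * mean a b powr \<epsilon> * lint w {a<..b}" if ab: "a < b" for a b
  proof -
    let ?l = "2 * mean a b"
    have pos: "0 < mean a b" "0 < lint w {a<..b}" using ab mean_pos lint_pos[OF w_meas w_pos w_int] by auto
    obtain E where E: "E \<in> sets borel" "E \<subseteq> {a<..b}" "?l * measure lborel E \<le> lint w E"
      "dyadic_sum (1 + \<epsilon>) n a b \<le> ?l powr \<epsilon> * lint w {a<..b} + C * (2 * ?l) powr \<epsilon> * lint w E"
      using stopping[of \<epsilon> C n a b ?l] less ab \<epsilon> C pos unfolding C_def by auto
    have "lint w E \<le> lint w {a<..b}" using E w_pos by (intro lint_mono_set w_int) (auto simp: less_imp_le)
    with E(3) have "2 * measure lborel E * mean a b \<le> (b - a) * mean a b"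
      using ab by (simp add: lint_mean mult_ac)
    then have "measure lborel E \<le> (b - a) / 2" using pos by simp
    then have "lint w E \<le> \<beta> * lint w {a<..b}" using E ab by (intro ainf) auto
    then have "C * (2 * ?l) powr \<epsilon> * lint w E \<le> C * (2 * ?l) powr \<epsilon> * (\<beta> * lint w {a<..b})"
      using C by (intro mult_left_mono) auto
    with E(4) have "dyadic_sum (1 + \<epsilon>) n a b \<le> (2 powr \<epsilon> + C * 4 powr \<epsilon> * \<beta>) * mean a b powr \<epsilon> * lint w {a<..b}"
      using pos by (simp add: powr_mult algebra_simps)
    then show ?thesis unfolding CC .
  qed
  then show ?case unfolding rh_bound_def C_def by blast
qed

text \<open>The integral of w^q is reached from the dyadic sums by duality, testing against g,
  rather than by differentiation of integrals. On an interval of generation n, g stays within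
  \<open>\<eta>\<close> of its minimum \<open>g c\<close>, and Young's inequality for the mean of w
  and \<open>g c\<close> produces one term of the dyadic sum.\<close>

lemma lint_mult_continuous_le_dyadic_sum:
  assumes q: "1 < q" and g: "continuous_on UNIV g" "\<And>x. 0 \<le> g x"
  shows "a < b \<Longrightarrow> (\<And>x y. x \<in> {a..b} \<Longrightarrow> y \<in> {a..b} \<Longrightarrow> \<bar>x - y\<bar> \<le> (b - a) / 2 ^ n \<Longrightarrow> \<bar>g x - g y\<bar> \<le> \<eta>) \<Longrightarrow>
    lint (\<lambda>x. w x * g x) {a<..b} \<le> \<eta> * lint w {a<..b} + dyadic_sum q n a b / q
      + lint (\<lambda>x. g x powr (q / (q - 1))) {a<..b} / (q / (q - 1))"
proof (induction n arbitrary: a b)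
  case 0
  have gm [measurable]: "g \<in> borel_measurable borel" using g(1) by (rule borel_measurable_continuous_onI)
  have cont: "continuous_on {a..b} g" using g continuous_on_subset by blast
  then obtain c where c: "c \<in> {a..b}" "\<And>x. x \<in> {a..b} \<Longrightarrow> g c \<le> g x"
    using continuous_attains_inf[of "{a..b}" g] 0 by auto
  obtain B where B: "\<And>x. x \<in> {a..b} \<Longrightarrow> g x \<le> B"
    using continuous_attains_sup[OF _ _ cont] 0 by fastforce
  let ?p = "q / (q - 1)"
  have up: "g x \<le> g c + \<eta>" if "x \<in> {a..b}" for x
    using 0(2)[of x c] that c(1) unfolding abs_le_iff by auto
  have gi: "set_integrable lborel {a<..b} (\<lambda>x. g x powr ?p)"
  proof (rule set_integrable_subset)
    show "set_integrable lborel {a..b} (\<lambda>x. g x powr ?p)"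
      using q by (intro borel_integrable_atLeastAtMost' continuous_on_powr' cont continuous_on_const) (use g(2) in auto)
  qed auto
  have i1: "set_integrable lborel {a<..b} (\<lambda>x. w x * g x)"
    using B g(2) by (intro set_integrable_mult_bounded[OF w_int, where B = B]) auto
  have "lint (\<lambda>x. w x * g x) {a<..b} \<le> lint (\<lambda>x. w x * (g c + \<eta>)) {a<..b}"
    using up w_pos[THEN less_imp_le] by (intro set_integral_mono i1 set_integrable_mult_left w_int mult_left_mono) auto
  also have "\<dots> = \<eta> * lint w {a<..b} + (b - a) * (mean a b * g c)"
    using 0(1) by (simp only: set_integral_mult_left lint_mean) (simp add: algebra_simps)
  also have "(b - a) * (mean a b * g c) \<le> (b - a) * (mean a b powr q / q + g c powr ?p / ?p)"
    using q mean_pos[OF 0(1)] 0(1) g(2)[of c]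
    by (intro mult_left_mono Youngs_inequality) (auto simp: field_simps)
  also have "\<dots> = dyadic_sum q 0 a b / q + lint (\<lambda>x. g c powr ?p) {a<..b} / ?p"
    using 0(1) by (simp add: set_integral_const algebra_simps)
  also have "lint (\<lambda>x. g c powr ?p) {a<..b} \<le> lint (\<lambda>x. g x powr ?p) {a<..b}"
    using q c g(2) by (intro set_integral_mono gi powr_mono2) (auto simp: set_integrable_def)
  finally show ?case using q by (auto simp: divide_right_mono)
next
  case (Suc n)
  define m where "m = (a + b) / 2"
  have m: "a < m" "m < b" using Suc by (auto simp: m_def)
  have gm [measurable]: "g \<in> borel_measurable borel" using g(1) by (rule borel_measurable_continuous_onI)
  have cont: "continuous_on {a..b} g" using g continuous_on_subset by blast
  obtain B where B: "\<And>x. x \<in> {a..b} \<Longrightarrow> g x \<le> B"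
    using continuous_attains_sup[OF _ _ cont] Suc.prems by fastforce
  let ?p = "q / (q - 1)"
  have gi: "set_integrable lborel {a<..b} (\<lambda>x. g x powr ?p)"
  proof (rule set_integrable_subset)
    show "set_integrable lborel {a..b} (\<lambda>x. g x powr ?p)"
      using q by (intro borel_integrable_atLeastAtMost' continuous_on_powr' cont continuous_on_const) (use g(2) in auto)
  qed auto
  have i1: "set_integrable lborel {a<..b} (\<lambda>x. w x * g x)"
    using B g(2) by (intro set_integrable_mult_bounded[OF w_int, where B = B]) auto
  have d: "(m - a) / 2 ^ n = (b - a) / 2 ^ Suc n" "(b - m) / 2 ^ n = (b - a) / 2 ^ Suc n"
    by (auto simp: m_def field_simps)
  have "lint (\<lambda>x. w x * g x) {a<..m} \<le> \<eta> * lint w {a<..m} + dyadic_sum q n a m / q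
      + lint (\<lambda>x. g x powr ?p) {a<..m} / ?p"
    using m by (intro Suc.IH Suc.prems) (auto simp: d)
  moreover have "lint (\<lambda>x. w x * g x) {m<..b} \<le> \<eta> * lint w {m<..b} + dyadic_sum q n m b / q
      + lint (\<lambda>x. g x powr ?p) {m<..b} / ?p"
    using m by (intro Suc.IH Suc.prems) (auto simp: d)
  moreover have "lint w {a<..b} = lint w {a<..m} + lint w {m<..b}"
    "lint (\<lambda>x. w x * g x) {a<..b} = lint (\<lambda>x. w x * g x) {a<..m} + lint (\<lambda>x. w x * g x) {m<..b}"
    "lint (\<lambda>x. g x powr ?p) {a<..b} = lint (\<lambda>x. g x powr ?p) {a<..m} + lint (\<lambda>x. g x powr ?p) {m<..b}"
    using m by (auto intro!: lint_split w_int gi i1)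
  moreover have "dyadic_sum q (Suc n) a b = dyadic_sum q n a m + dyadic_sum q n m b" by (simp add: m_def)
  ultimately show ?case
    by (simp only: distrib_left add_divide_distrib)
qed

lemma lint_mult_continuous_le:
  assumes q: "1 < q" and M: "\<And>n. dyadic_sum q n a b \<le> M" and ab: "a < b"
    and g: "continuous_on UNIV g" "\<And>x. 0 \<le> g x"
  shows "lint (\<lambda>x. w x * g x) {a<..b} \<le> M / q + lint (\<lambda>x. g x powr (q / (q - 1))) {a<..b} / (q / (q - 1))"
proof (rule field_le_epsilon)
  fix e :: real assume "0 < e"
  have wp: "0 < lint w {a<..b}" using lint_pos[OF w_meas w_pos w_int ab] .
  define \<eta> where "\<eta> = e / lint w {a<..b}"
  have \<eta>: "0 < \<eta>" using wp \<open>0 < e\<close> by (simp add: \<eta>_def)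
  have "uniformly_continuous_on {a..b} g"
    using g(1) by (intro compact_uniformly_continuous) (auto intro: continuous_on_subset)
  then obtain d where d: "0 < d" "\<And>x y. x \<in> {a..b} \<Longrightarrow> y \<in> {a..b} \<Longrightarrow> dist x y < d \<Longrightarrow> dist (g x) (g y) < \<eta>"
    using \<eta> unfolding uniformly_continuous_on_def by metis
  have "(\<lambda>n. (b - a) / 2 ^ n) \<longlonglongrightarrow> 0" by (rule LIMSEQ_divide_realpow_zero) simp
  then have "\<forall>\<^sub>F n in sequentially. (b - a) / 2 ^ n < d" using d(1) by (rule order_tendstoD)
  then obtain n where n: "(b - a) / 2 ^ n < d" by (auto simp: eventually_sequentially)
  have "lint (\<lambda>x. w x * g x) {a<..b} \<le> \<eta> * lint w {a<..b} + dyadic_sum q n a b / q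
      + lint (\<lambda>x. g x powr (q / (q - 1))) {a<..b} / (q / (q - 1))"
  proof (rule lint_mult_continuous_le_dyadic_sum[OF q g ab])
    fix x y assume "x \<in> {a..b}" "y \<in> {a..b}" "\<bar>x - y\<bar> \<le> (b - a) / 2 ^ n"
    then show "\<bar>g x - g y\<bar> \<le> \<eta>" using d(2)[of x y] n by (auto simp: dist_real_def)
  qed
  also have "\<eta> * lint w {a<..b} = e" using wp by (simp add: \<eta>_def)
  also have "dyadic_sum q n a b / q \<le> M / q" using M q by (intro divide_right_mono) auto
  finally show "lint (\<lambda>x. w x * g x) {a<..b} \<le> M / q + lint (\<lambda>x. g x powr (q / (q - 1))) {a<..b} / (q / (q - 1)) + e"
    by simp
qed

lemma lint_mult_bounded_le:
  assumes q: "1 < q" and M: "\<And>n. dyadic_sum q n a b \<le> M" and ab: "a < b"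
    and g [measurable]: "g \<in> borel_measurable borel" and gK: "\<And>x. 0 \<le> g x" "\<And>x. g x \<le> K"
  shows "lint (\<lambda>x. w x * g x) {a<..b} \<le> M / q + lint (\<lambda>x. g x powr (q / (q - 1))) {a<..b} / (q / (q - 1))"
proof -
  let ?p = "q / (q - 1)"
  have K: "0 \<le> K" using gK[of 0] by linarith
  \<comment> \<open>This supplies continuous functions converging to g off a negligible set;
    clipping them to [0, K] makes dominated convergence applicable on both sides.\<close>
  have "g measurable_on UNIV"
    by (rule lebesgue_measurable_imp_measurable_on) (auto simp: borel_measurable_if_I measurable_completion)
  then obtain N f where N: "negligible N" and f: "\<And>n. continuous_on UNIV (f n)"
      "\<And>x. x \<notin> N \<Longrightarrow> (\<lambda>n. f n x) \<longlonglongrightarrow> g x"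
    unfolding measurable_on_def by auto
  define h where "h n x = max 0 (min K (f n x))" for n x
  have hc: "continuous_on UNIV (h n)" for n unfolding h_def by (intro continuous_intros f)
  have [measurable]: "h n \<in> borel_measurable borel" for n using hc by (rule borel_measurable_continuous_onI)
  have h: "0 \<le> h n x" "h n x \<le> K" for n x using K by (auto simp: h_def)
  have lim: "(\<lambda>n. h n x) \<longlonglongrightarrow> g x" if "x \<notin> N" for x
  proof -
    have "(\<lambda>n. h n x) \<longlonglongrightarrow> max 0 (min K (g x))" unfolding h_def by (intro tendsto_intros f that)
    then show ?thesis using gK[of x] by (simp add: max_def min_def split: if_splits)
  qed
  have "AE x in lebesgue. x \<notin> N" using N by (simp add: negligible_iff_null_sets AE_not_in)
  then have "AE x in lborel. x \<notin> N"
    by (simp add: AE_completion_iff)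
  then have AElim: "AE x in lborel. (\<lambda>n. h n x) \<longlonglongrightarrow> g x" by eventually_elim (rule lim)
  have l1: "(\<lambda>n. lint (\<lambda>x. w x * h n x) {a<..b}) \<longlonglongrightarrow> lint (\<lambda>x. w x * g x) {a<..b}"
    unfolding set_lebesgue_integral_def
  proof (rule integral_dominated_convergence[where w = "\<lambda>x. K * (indicator {a<..b} x * w x)"])
    show "integrable lborel (\<lambda>x. K * (indicator {a<..b} x * w x))"
      using w_int[of a b] unfolding set_integrable_def by (intro integrable_mult_right) auto
    show "AE x in lborel. (\<lambda>n. indicat_real {a<..b} x *\<^sub>R (w x * h n x)) \<longlonglongrightarrow> indicat_real {a<..b} x *\<^sub>R (w x * g x)"
      using AElim by eventually_elim (intro tendsto_intros)
    show "AE x in lborel. norm (indicat_real {a<..b} x *\<^sub>R (w x * h n x)) \<le> K * (indicat_real {a<..b} x * w x)" for n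
      using h w_pos[THEN less_imp_le] by (intro AE_I2) (auto simp: indicator_def abs_mult mult.commute[of K] intro!: mult_left_mono)
  qed auto
  have l2: "(\<lambda>n. lint (\<lambda>x. h n x powr ?p) {a<..b}) \<longlonglongrightarrow> lint (\<lambda>x. g x powr ?p) {a<..b}"
    unfolding set_lebesgue_integral_def
  proof (rule integral_dominated_convergence[where w = "\<lambda>x. K powr ?p * indicator {a<..b} x"])
    show "AE x in lborel. (\<lambda>n. indicat_real {a<..b} x *\<^sub>R (h n x powr ?p)) \<longlonglongrightarrow> indicat_real {a<..b} x *\<^sub>R (g x powr ?p)"
      using AElim by eventually_elim (use q h in \<open>auto intro!: tendsto_intros tendsto_powr'\<close>)
    show "AE x in lborel. norm (indicat_real {a<..b} x *\<^sub>R (h n x powr ?p)) \<le> K powr ?p * indicat_real {a<..b} x" for n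
      using h q by (intro AE_I2) (auto simp: indicator_def intro!: powr_mono2)
  qed (auto intro!: integrable_mult_right integrable_indicator_Ioc)
  show ?thesis
  proof (rule LIMSEQ_le[OF l1 tendsto_add[OF tendsto_const tendsto_divide[OF l2 tendsto_const]]])
    show "?p \<noteq> 0" using q by auto
    show "\<exists>N. \<forall>n\<ge>N. lint (\<lambda>x. w x * h n x) {a<..b} \<le> M / q + lint (\<lambda>x. h n x powr ?p) {a<..b} / ?p"
      using lint_mult_continuous_le[OF q M ab hc h(1)] by auto
  qed
qed

text \<open>Test with min(w, n)^(q-1), whose power q/(q-1) is min(w, n)^q. If I is the integral of
  the latter, then I \<le> M/q + (1 - 1/q) I; truncation makes I finite, so it can be absorbed and I
  \<le> M. Monotone convergence in n removes the truncation.\<close>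

lemma reverse_Hoelder:
  assumes q: "1 < q" and M: "\<And>n. dyadic_sum q n a b \<le> M" and ab: "a < b"
  shows "set_integrable lborel {a<..b} (\<lambda>x. w x powr q)" "lint (\<lambda>x. w x powr q) {a<..b} \<le> M"
proof -
  let ?p = "q / (q - 1)"
  define F where "F n x = indicator {a<..b} x * min (w x) (real n) powr q" for n :: nat and x
  have Fi: "integrable lborel (F n)" for n
  proof (rule Bochner_Integration.integrable_bound)
    show "integrable lborel (\<lambda>x. indicat_real {a<..b} x * real n powr q)"
      by (intro integrable_mult_left integrable_indicator_Ioc)
    show "AE x in lborel. norm (F n x) \<le> norm (indicator {a<..b} x * real n powr q)"
      using q w_pos[THEN less_imp_le] by (intro AE_I2) (auto simp: F_def indicator_def intro!: powr_mono2)
  qed (auto simp: F_def[abs_def])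
  have Fm: "integral\<^sup>L lborel (F n) \<le> M" for n
  proof -
    define g where "g x = min (w x) (real n) powr (q - 1)" for x
    have gp: "g x powr ?p = min (w x) (real n) powr q" for x
      using q by (simp add: g_def powr_powr)
    have [measurable]: "g \<in> borel_measurable borel" by (auto simp: g_def[abs_def])
    have gK: "0 \<le> g x" "g x \<le> real n powr (q - 1)" for x
      using w_pos[of x] q by (auto simp: g_def intro!: powr_mono2)
    have ig: "set_integrable lborel {a<..b} (\<lambda>x. w x * g x)"
      using gK by (intro set_integrable_mult_bounded[OF w_int, where B = "real n powr (q - 1)"]) auto
    have "integral\<^sup>L lborel (F n) \<le> lint (\<lambda>x. w x * g x) {a<..b}"
      unfolding set_lebesgue_integral_def
    proof (rule integral_mono[OF Fi])
      show "integrable lborel (\<lambda>x. indicat_real {a<..b} x *\<^sub>R (w x * g x))" using ig by (simp add: set_integrable_def)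
      fix x
      have "min (w x) (real n) powr q = min (w x) (real n) * g x"
        using w_pos[of x] q by (cases "n = 0") (auto simp: g_def powr_diff min_def)
      also have "\<dots> \<le> w x * g x" using gK[of x] by (intro mult_right_mono) auto
      finally show "F n x \<le> indicat_real {a<..b} x *\<^sub>R (w x * g x)"
        by (auto simp: F_def indicator_def)
    qed
    also have "\<dots> \<le> M / q + lint (\<lambda>x. g x powr ?p) {a<..b} / ?p"
      by (rule lint_mult_bounded_le[OF q M ab _ gK]) auto
    also have "lint (\<lambda>x. g x powr ?p) {a<..b} = integral\<^sup>L lborel (F n)"
      unfolding gp F_def set_lebesgue_integral_def by simp
    finally show ?thesis using q by (simp add: field_simps)
  qed
  have inc: "F m x \<le> F n x" if "m \<le> n" for m n x
    using that q w_pos[of x] by (auto simp: F_def indicator_def intro!: powr_mono2)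
  have "convergent (\<lambda>n. integral\<^sup>L lborel (F n))"
  proof (rule Bseq_mono_convergent)
    show "Bseq (\<lambda>n. integral\<^sup>L lborel (F n))"
    proof (rule BseqI'[of _ M])
      fix n
      have "0 \<le> integral\<^sup>L lborel (F n)" by (intro integral_nonneg_AE AE_I2) (auto simp: F_def)
      then show "norm (integral\<^sup>L lborel (F n)) \<le> M" using Fm[of n] by simp
    qed
    show "\<forall>m n. m \<le> n \<longrightarrow> integral\<^sup>L lborel (F m) \<le> integral\<^sup>L lborel (F n)"
      using inc by (auto intro!: integral_mono Fi)
  qed
  then obtain L where L: "(\<lambda>n. integral\<^sup>L lborel (F n)) \<longlonglongrightarrow> L" unfolding convergent_def by auto
  have lim: "(\<lambda>n. F n x) \<longlonglongrightarrow> indicator {a<..b} x * w x powr q" for x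
  proof (rule tendsto_eventually)
    obtain N where "w x \<le> real N" using real_arch_simple by blast
    then show "\<forall>\<^sub>F n in sequentially. F n x = indicator {a<..b} x * w x powr q"
      unfolding eventually_sequentially F_def by (intro exI[of _ N]) (auto simp: min_def)
  qed
  have mc: "AE x in lborel. mono (\<lambda>n. F n x)" using inc by (auto simp: mono_def)
  show "set_integrable lborel {a<..b} (\<lambda>x. w x powr q)"
    unfolding set_integrable_def real_scaleR_def
    by (rule integrable_monotone_convergence[OF Fi mc _ L]) (auto simp: lim)
  have "lint (\<lambda>x. w x powr q) {a<..b} = L"
    unfolding set_lebesgue_integral_def real_scaleR_def
    by (rule integral_monotone_convergence[OF Fi mc _ L]) (auto simp: lim)
  then show "lint (\<lambda>x. w x powr q) {a<..b} \<le> M" using LIMSEQ_le_const2[OF L] Fm by auto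
qed

end

section \<open>Duality and openness of the A_p classes\<close>

text \<open>Raising the A_p inequality to the power p' - 1 = 1/(p - 1), with p' = p/(p - 1),
  interchanges the roles of the two factors.\<close>

lemma Ap_weight_dual:
  assumes "Ap_weight p w"
  shows "Ap_weight (p / (p - 1)) (\<lambda>x. w x powr (1 / (1 - p)))"
proof -
  define p' where "p' = p / (p - 1)"
  have p: "1 < p" and wp: "\<And>x. 0 < w x" and [measurable]: "w \<in> borel_measurable borel"
    and i: "\<And>a b. set_integrable lborel {a<..b} w" "\<And>a b. set_integrable lborel {a<..b} (\<lambda>x. w x powr (1 / (1 - p)))"
    using assms by (auto simp: Ap_weight_def)
  obtain C where C: "\<And>a b. a < b \<Longrightarrow> (lint w {a<..b} / (b - a)) *
       (lint (\<lambda>x. w x powr (1 / (1 - p))) {a<..b} / (b - a)) powr (p - 1) \<le> C"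
    using assms unfolding Ap_weight_def by blast
  have p': "1 < p'" "(1 / (1 - p)) * (1 / (1 - p')) = 1" "(p - 1) * (p' - 1) = 1"
    using p by (auto simp: p'_def field_simps)
  have bk: "(w x powr (1 / (1 - p))) powr (1 / (1 - p')) = w x" for x
    using wp[of x] p'(2) by (simp only: powr_powr) simp
  have bd: "lint (\<lambda>x. w x powr (1 / (1 - p))) {a<..b} / (b - a) * (lint w {a<..b} / (b - a)) powr (p' - 1) \<le> C powr (p' - 1)"
    if "a < b" for a b
  proof -
    let ?u = "lint w {a<..b} / (b - a)" and ?v = "lint (\<lambda>x. w x powr (1 / (1 - p))) {a<..b} / (b - a)"
    have pos: "0 < ?u" "0 < ?v" using lint_pos[of w a b] lint_pos[of "\<lambda>x. w x powr (1 / (1 - p))" a b] wp i that by (auto simp: less_imp_neq[THEN not_sym])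
    have "?v * ?u powr (p' - 1) = (?u * ?v powr (p - 1)) powr (p' - 1)"
      using pos unfolding powr_mult powr_powr p'(3) by (simp only: powr_one less_imp_le mult.commute)
    also have "\<dots> \<le> C powr (p' - 1)" using C[OF that] pos p' by (intro powr_mono2 mult_nonneg_nonneg) auto
    finally show ?thesis .
  qed
  show ?thesis
    unfolding Ap_weight_def p'_def[symmetric] bk using p' wp i bd by (auto simp: less_imp_neq[THEN not_sym])
qed

text \<open>Hoelder's inequality on the complement F of E gives |F|^p \<le> w(F) *
  \<sigma>(I)^(p-1), where I is the interval and \<sigma> the dual weight. As |F| \<ge> |I|/2, the
  A_p condition leaves w(F) at least the fraction 2^(-p)/C of w(I).\<close>

lemma Ap_weight_imp_A_infinity:
  assumes "Ap_weight p w"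
  shows "\<exists>\<beta>. A_infinity w \<beta>"
proof -
  have p: "1 < p" and wp: "\<And>x. 0 < w x" and wm [measurable]: "w \<in> borel_measurable borel"
    and i: "\<And>a b. set_integrable lborel {a<..b} w" "\<And>a b. set_integrable lborel {a<..b} (\<lambda>x. w x powr (1 / (1 - p)))"
    using assms by (auto simp: Ap_weight_def)
  obtain C0 where C0: "\<And>a b. a < b \<Longrightarrow> (lint w {a<..b} / (b - a)) *
       (lint (\<lambda>x. w x powr (1 / (1 - p))) {a<..b} / (b - a)) powr (p - 1) \<le> C0"
    using assms unfolding Ap_weight_def by blast
  \<comment> \<open>Raising the constant to at least 1 ensures that \<open>\<beta>\<close> is
    nonnegative.\<close>
  define C where "C = max C0 1"
  have C: "a < b \<Longrightarrow> (lint w {a<..b} / (b - a)) *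
       (lint (\<lambda>x. w x powr (1 / (1 - p))) {a<..b} / (b - a)) powr (p - 1) \<le> C" "1 \<le> C" for a b
    using C0[of a b] by (auto simp: C_def)
  define \<beta> where "\<beta> = 1 - (1/2) powr p / C"
  have "(1/2::real) powr p \<le> 1" "0 < (1/2::real) powr p" using p by (auto intro!: powr_le1)
  then have \<beta>: "0 \<le> \<beta>" "\<beta> < 1" using C(2) unfolding \<beta>_def by (auto simp: divide_simps)
  have "lint w E \<le> \<beta> * lint w {a<..b}"
    if ab: "a < b" and E: "E \<in> sets borel" "E \<subseteq> {a<..b}" "measure lborel E \<le> (b - a) / 2" for a b E
  proof -
    let ?s = "\<lambda>x. w x powr (1 / (1 - p))"
    define F where "F = {a<..b} - E"
    have F [measurable]: "F \<in> sets borel" "F \<subseteq> {a<..b}" using E by (auto simp: F_def)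
    have Fi: "set_integrable lborel F w" "set_integrable lborel F ?s" "set_integrable lborel E w"
      using F E by (auto intro!: set_integrable_subset[OF i(1)[of a b]] set_integrable_subset[OF i(2)[of a b]])
    have split: "lint w {a<..b} = lint w E + lint w F"
    proof -
      have "{a<..b} = E \<union> F" "E \<inter> F = {}" using E by (auto simp: F_def)
      then show ?thesis using Fi by (metis set_integral_Un)
    qed
    have "(b - a) / 2 \<le> measure lborel F"
    proof -
      have "measure lborel F = measure lborel {a<..b} - measure lborel E"
        unfolding F_def using E ab by (intro measure_Diff) auto
      then show ?thesis using E(3) ab by simp
    qed
    also have "measure lborel F = (\<integral>x. (indicator F x * w x) powr (1/p) * (indicator F x * ?s x) powr (1 - 1/p) \<partial>lborel)"
    proof -
      have "(indicator F x * w x) powr (1/p) * (indicator F x * ?s x) powr (1 - 1/p) = indicat_real F x" for x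
      proof (cases "x \<in> F")
        case True
        have "1 / (1 - p) * (1 - 1/p) = - (1/p)" using p by (simp add: field_simps)
        then have "?s x powr (1 - 1/p) = w x powr (- (1/p))"
          by (simp only: powr_powr)
        then show ?thesis using True wp[of x] by (simp add: powr_minus)
      qed simp
      then show ?thesis by simp
    qed
    also have "\<dots> \<le> lint w F powr (1/p) * lint ?s F powr (1 - 1/p)"
      unfolding set_lebesgue_integral_def real_scaleR_def
      using Fi p wp[THEN less_imp_le] by (intro Hoelder_powr(2)) (auto simp: set_integrable_def)
    also have "\<dots> \<le> lint w F powr (1/p) * lint ?s {a<..b} powr (1 - 1/p)"
    proof (intro mult_left_mono powr_mono2)
      show "lint ?s F \<le> lint ?s {a<..b}" using F by (intro lint_mono_set i) auto
      show "0 \<le> lint ?s F" unfolding set_lebesgue_integral_def by (intro integral_nonneg_AE AE_I2) auto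
    qed (use p in auto)
    finally have 1: "(b - a) / 2 \<le> lint w F powr (1/p) * lint ?s {a<..b} powr (1 - 1/p)" .
    have F0: "0 \<le> lint w F" unfolding set_lebesgue_integral_def using wp[THEN less_imp_le] by (intro integral_nonneg_AE AE_I2) auto
    have s0: "0 < lint ?s {a<..b}" "0 < lint w {a<..b}" using lint_pos[of w a b] lint_pos[of ?s a b] wp i ab by (auto simp: less_imp_neq[THEN not_sym])
    have "((b - a) / 2) powr p \<le> (lint w F powr (1/p) * lint ?s {a<..b} powr (1 - 1/p)) powr p"
      using 1 p ab by (intro powr_mono2) auto
    also have "\<dots> = lint w F * lint ?s {a<..b} powr (p - 1)"
    proof -
      have e: "1 / p * p = 1" "(1 - 1 / p) * p = p - 1" using p by (auto simp: field_simps)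
      show ?thesis using F0 by (simp only: powr_mult powr_powr e) simp
    qed
    finally have 2: "((b - a) / 2) powr p \<le> lint w F * lint ?s {a<..b} powr (p - 1)" .
    have "(b - a) powr p = (b - a) * (b - a) powr (p - 1)" using ab by (simp add: powr_diff)
    then have 3: "lint w {a<..b} * lint ?s {a<..b} powr (p - 1) \<le> C * (b - a) powr p"
      using C(1)[OF ab] ab s0 by (simp add: powr_divide divide_le_eq mult_ac)
    have "(1/2) powr p * (lint w {a<..b} * lint ?s {a<..b} powr (p - 1)) \<le> (1/2) powr p * (C * (b - a) powr p)"
      using 3 by (intro mult_left_mono) auto
    also have "\<dots> = C * ((b - a) / 2) powr p" using ab by (simp add: powr_divide)
    also have "\<dots> \<le> C * (lint w F * lint ?s {a<..b} powr (p - 1))" using 2 C(2) by (intro mult_left_mono) auto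
    finally have "(1/2) powr p * lint w {a<..b} \<le> C * lint w F"
      using s0 by (simp add: mult_ac)
    then have "(1/2) powr p / C * lint w {a<..b} \<le> lint w F" using C(2) by (simp add: field_simps)
    then show ?thesis using split unfolding \<beta>_def by (simp add: algebra_simps)
  qed
  then have "A_infinity w \<beta>" using wp i \<beta> by unfold_locales auto
  then show ?thesis by blast
qed

text \<open>Lowering the exponent from P to q raises the power of w in the dual factor, so the
  reverse Hoelder inequality is applied to the dual weight. With 1 + \<epsilon> = (P - 1)/(q - 1),
  its power 1 + \<epsilon> is exactly \<open>w x powr (1 / (1 - q))\<close>, and taking the power q
  - 1 of the resulting estimate restores the exponent P - 1 of the A_P condition.\<close>

theorem Ap_weight_open:
  assumes "Ap_weight P w"
  shows "\<exists>q0. 1 < q0 \<and> q0 < P \<and> (\<forall>q. q0 \<le> q \<and> q \<le> P \<longrightarrow> Ap_weight q w)"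
proof -
  let ?s = "\<lambda>x. w x powr (1 / (1 - P))"
  have P: "1 < P" and wp: "\<And>x. 0 < w x" and wm [measurable]: "w \<in> borel_measurable borel"
    and i: "\<And>a b. set_integrable lborel {a<..b} w" "\<And>a b. set_integrable lborel {a<..b} ?s"
    using assms by (auto simp: Ap_weight_def)
  obtain C where C: "\<And>a b. a < b \<Longrightarrow> (lint w {a<..b} / (b - a)) *
       (lint ?s {a<..b} / (b - a)) powr (P - 1) \<le> C"
    using assms unfolding Ap_weight_def by blast
  obtain \<beta> where "A_infinity ?s \<beta>" using Ap_weight_imp_A_infinity[OF Ap_weight_dual[OF assms]] by blast
  then interpret s: A_infinity ?s \<beta> .
  have "\<exists>e>0. \<forall>\<epsilon>. 0 < \<epsilon> \<and> \<epsilon> \<le> e \<longrightarrow> 4 powr \<epsilon> * \<beta> < 1"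
  proof -
    have "((\<lambda>\<epsilon>. 4 powr \<epsilon> * \<beta>) \<longlongrightarrow> 4 powr 0 * \<beta>) (at_right 0)"
      by (intro tendsto_intros) auto
    then have "\<forall>\<^sub>F \<epsilon> in at_right 0. 4 powr \<epsilon> * \<beta> < 1"
      using s.\<beta> by (intro order_tendstoD) auto
    then obtain b where "b > 0" "\<And>y. 0 < y \<Longrightarrow> y < b \<Longrightarrow> 4 powr y * \<beta> < 1"
      unfolding eventually_at_right_field by auto
    then show ?thesis by (intro exI[of _ "b/2"]) auto
  qed
  then obtain e where e: "0 < e" "\<And>\<epsilon>. 0 < \<epsilon> \<Longrightarrow> \<epsilon> \<le> e \<Longrightarrow> 4 powr \<epsilon> * \<beta> < 1" by blast
  \<comment> \<open>The value of q for which (P - 1)/(q - 1) equals 1 + e, the largest admissible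
    exponent.\<close>
  define q0 where "q0 = 1 + (P - 1) / (1 + e)"
  have q0: "1 < q0" "q0 < P" using P e(1) by (auto simp: q0_def field_simps)
  have "Ap_weight q w" if q: "q0 \<le> q" "q \<le> P" for q
  proof (cases "q = P")
    case True then show ?thesis using assms by simp
  next
    case False
    define \<epsilon> where "\<epsilon> = (P - 1) / (q - 1) - 1"
    have q1: "1 < q" "q < P" using q q0 False by auto
    have "(P - 1) / (q - 1) \<le> (P - 1) / (q0 - 1)" using q q0 q1 P by (intro divide_left_mono) auto
    also have "\<dots> = 1 + e" using P e by (simp add: q0_def)
    finally have \<epsilon>: "0 < \<epsilon>" "\<epsilon> \<le> e" using q1 by (auto simp: \<epsilon>_def field_simps)
    note bb = e(2)[OF \<epsilon>]
    define K where "K = 2 powr \<epsilon> / (1 - 4 powr \<epsilon> * \<beta>)"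
    have K0: "0 \<le> K" using bb by (simp add: K_def)
    have eq: "?s x powr (1 + \<epsilon>) = w x powr (1 / (1 - q))" for x
    proof -
      have "(1 + \<epsilon>) * (q - 1) = P - 1" using q1 by (simp add: \<epsilon>_def)
      then have h: "(1 + \<epsilon>) * (1 - q) = 1 - P" by (simp add: algebra_simps)
      have "1 / (1 - P) * (1 + \<epsilon>) = 1 / (1 - q)"
        unfolding h[symmetric] using \<epsilon> by simp
      then show ?thesis by (simp only: powr_powr)
    qed
    have rh: "s.dyadic_sum (1 + \<epsilon>) n a b \<le> K * s.mean a b powr \<epsilon> * lint ?s {a<..b}" if "a < b" for a b n
      using s.rh_bound_all[OF \<epsilon>(1) bb, of n] that unfolding s.rh_bound_def K_def by blast
    have ii: "set_integrable lborel {a<..b} (\<lambda>x. w x powr (1 / (1 - q)))" if "a < b" for a b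
      using s.reverse_Hoelder(1)[OF _ rh[OF that] that] \<epsilon> unfolding eq by simp
    then have ii: "set_integrable lborel {a<..b} (\<lambda>x. w x powr (1 / (1 - q)))" for a b
      by (cases "a < b") (auto simp: set_integrable_def)
    have "lint w {a<..b} / (b - a) * (lint (\<lambda>x. w x powr (1 / (1 - q))) {a<..b} / (b - a)) powr (q - 1)
       \<le> K powr (q - 1) * C" if ab: "a < b" for a b
    proof -
      let ?v = "s.mean a b"
      have v: "0 < ?v" using s.mean_pos[OF ab] .
      have "lint (\<lambda>x. w x powr (1 / (1 - q))) {a<..b} \<le> K * ?v powr \<epsilon> * lint ?s {a<..b}"
        using s.reverse_Hoelder(2)[OF _ rh[OF ab] ab] \<epsilon> unfolding eq by simp
      also have "\<dots> = K * ?v powr (1 + \<epsilon>) * (b - a)" using v ab by (simp add: s.lint_mean powr_add)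
      finally have "lint (\<lambda>x. w x powr (1 / (1 - q))) {a<..b} / (b - a) \<le> K * ?v powr (1 + \<epsilon>)"
        using ab by (simp add: field_simps)
      then have "(lint (\<lambda>x. w x powr (1 / (1 - q))) {a<..b} / (b - a)) powr (q - 1) \<le> (K * ?v powr (1 + \<epsilon>)) powr (q - 1)"
        using q1 ab by (intro powr_mono2) (auto intro!: divide_nonneg_pos simp: set_lebesgue_integral_def)
      also have "\<dots> = K powr (q - 1) * ?v powr (P - 1)"
        using v K0 q1 by (simp add: powr_mult powr_powr \<epsilon>_def)
      finally have "lint w {a<..b} / (b - a) * (lint (\<lambda>x. w x powr (1 / (1 - q))) {a<..b} / (b - a)) powr (q - 1)
        \<le> lint w {a<..b} / (b - a) * (K powr (q - 1) * ?v powr (P - 1))"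
        using lint_pos[OF wm wp i(1) ab] ab by (intro mult_left_mono) auto
      also have "\<dots> \<le> K powr (q - 1) * C" using mult_left_mono[OF C[OF ab], of "K powr (q - 1)"]
        by (simp add: s.mean_def mult_ac)
      finally show ?thesis .
    qed
    then show ?thesis unfolding Ap_weight_def using q1 wp i ii by auto
  qed
  then show ?thesis using q0 by blast
qed

section \<open>Periodic functions and the modular inequality for Steklov means\<close>

definition periodic :: "(real \<Rightarrow> 'a) \<Rightarrow> bool" where
  "periodic f \<longleftrightarrow> (\<forall>x. f (x + 2 * pi) = f x)"

lemma periodic_of_int: "periodic f \<Longrightarrow> f (x + of_int k * (2 * pi)) = f x"
proof -
  assume "periodic f"
  then interpret periodic_fun_simple f "2 * pi" by unfold_locales (auto simp: periodic_def)
  show ?thesis by (rule plus_of_int)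
qed

lemma nn_integral_shift:
  fixes F :: "real \<Rightarrow> ennreal"
  assumes [measurable]: "F \<in> borel_measurable borel"
  shows "(\<integral>\<^sup>+x. F (t + x) \<partial>lborel) = (\<integral>\<^sup>+x. F x \<partial>lborel)"
  using nn_integral_real_affine[of F 1 t] by simp

lemma nn_integral_Ioc_split:
  fixes F :: "real \<Rightarrow> ennreal"
  assumes [measurable]: "F \<in> borel_measurable borel" and "a \<le> b" "b \<le> c"
  shows "(\<integral>\<^sup>+x\<in>{a<..c}. F x \<partial>lborel) = (\<integral>\<^sup>+x\<in>{a<..b}. F x \<partial>lborel) + (\<integral>\<^sup>+x\<in>{b<..c}. F x \<partial>lborel)"
  using assms by (subst nn_integral_add[symmetric]) (auto intro!: nn_integral_cong simp: indicator_def)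

lemma nn_integral_Ioc_shift:
  fixes F :: "real \<Rightarrow> ennreal"
  assumes [measurable]: "F \<in> borel_measurable borel"
  shows "(\<integral>\<^sup>+x\<in>{a + t<..b + t}. F x \<partial>lborel) = (\<integral>\<^sup>+x\<in>{a<..b}. F (x + t) \<partial>lborel)"
  by (subst nn_integral_shift[of _ t, symmetric]) (auto intro!: nn_integral_cong simp: indicator_def add.commute)

lemma nn_integral_periodic_Ioc:
  fixes F :: "real \<Rightarrow> ennreal"
  assumes [measurable]: "F \<in> borel_measurable borel" and F: "periodic F"
  shows "(\<integral>\<^sup>+x\<in>{a<..a + 2 * pi}. F x \<partial>lborel) = (\<integral>\<^sup>+x\<in>{0<..2 * pi}. F x \<partial>lborel)"
proof -
  define k :: int where "k = \<lfloor>a / (2 * pi)\<rfloor>"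
  define s where "s = a - of_int k * (2 * pi)"
  have "of_int k \<le> a / (2 * pi)" "a / (2 * pi) \<le> of_int k + 1"
    unfolding k_def by linarith+
  then have s: "0 \<le> s" "s \<le> 2 * pi"
    unfolding s_def by (auto simp: field_simps)
  have "(\<integral>\<^sup>+x\<in>{a<..a + 2 * pi}. F x \<partial>lborel)
     = (\<integral>\<^sup>+x\<in>{s + of_int k * (2 * pi)<..(s + 2 * pi) + of_int k * (2 * pi)}. F x \<partial>lborel)"
    by (simp add: s_def add_ac)
  also have "\<dots> = (\<integral>\<^sup>+x\<in>{s<..s + 2 * pi}. F x \<partial>lborel)"
    by (subst nn_integral_Ioc_shift) (auto simp: periodic_of_int[OF F])
  also have "\<dots> = (\<integral>\<^sup>+x\<in>{s<..2 * pi}. F x \<partial>lborel) + (\<integral>\<^sup>+x\<in>{2 * pi<..s + 2 * pi}. F x \<partial>lborel)"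
    using s by (intro nn_integral_Ioc_split) auto
  also have "(\<integral>\<^sup>+x\<in>{2 * pi<..s + 2 * pi}. F x \<partial>lborel) = (\<integral>\<^sup>+x\<in>{0<..s}. F x \<partial>lborel)"
    using nn_integral_Ioc_shift[of F 0 "2 * pi" s] F by (simp add: periodic_def)
  also have "(\<integral>\<^sup>+x\<in>{s<..2 * pi}. F x \<partial>lborel) + (\<integral>\<^sup>+x\<in>{0<..s}. F x \<partial>lborel) = (\<integral>\<^sup>+x\<in>{0<..2 * pi}. F x \<partial>lborel)"
    using s nn_integral_Ioc_split[of F 0 s "2 * pi"] by (simp add: add.commute)
  finally show ?thesis .
qed

lemma nn_integral_Icc_Ioc:
  fixes F :: "real \<Rightarrow> ennreal"
  shows "(\<integral>\<^sup>+x\<in>{a..b}. F x \<partial>lborel) = (\<integral>\<^sup>+x\<in>{a<..b}. F x \<partial>lborel)"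
proof (rule nn_integral_cong_AE)
  have "AE x in lborel. x \<noteq> a" by (rule AE_lborel_singleton)
  then show "AE x in lborel. F x * indicator {a..b} x = F x * indicator {a<..b} x"
    by eventually_elim (auto simp: indicator_def)
qed

lemma nn_integral_periodic_shift:
  fixes F :: "real \<Rightarrow> ennreal"
  assumes [measurable]: "F \<in> borel_measurable borel" and F: "periodic F"
  shows "(\<integral>\<^sup>+x\<in>{0..2 * pi}. F (x + t) \<partial>lborel) = (\<integral>\<^sup>+x\<in>{0..2 * pi}. F x \<partial>lborel)"
  unfolding nn_integral_Icc_Ioc
  using nn_integral_Ioc_shift[of F 0 t "2 * pi"] nn_integral_periodic_Ioc[OF assms, of t] by (simp add: add.commute)

lemma nn_integral_periodic_finite:
  fixes F :: "real \<Rightarrow> ennreal"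
  assumes [measurable]: "F \<in> borel_measurable borel" and F: "periodic F"
    and fin: "(\<integral>\<^sup>+x\<in>{0..2 * pi}. F x \<partial>lborel) < \<infinity>"
  shows "(\<integral>\<^sup>+x\<in>{a..b}. F x \<partial>lborel) < \<infinity>"
proof -
  have fin': "(\<integral>\<^sup>+x\<in>{0<..2 * pi}. F x \<partial>lborel) < \<infinity>" using fin unfolding nn_integral_Icc_Ioc .
  have *: "(\<integral>\<^sup>+x\<in>{a<..a + real n * (2 * pi)}. F x \<partial>lborel) < \<infinity>" for n :: nat
  proof (induction n)
    case (Suc n)
    have "(\<integral>\<^sup>+x\<in>{a<..a + real (Suc n) * (2 * pi)}. F x \<partial>lborel)
       = (\<integral>\<^sup>+x\<in>{a<..a + real n * (2 * pi)}. F x \<partial>lborel)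
        + (\<integral>\<^sup>+x\<in>{a + real n * (2 * pi)<..(a + real n * (2 * pi)) + 2 * pi}. F x \<partial>lborel)"
      by (subst nn_integral_Ioc_split[of F a "a + real n * (2 * pi)"]) (auto simp: algebra_simps)
    also have "\<dots> < \<infinity>" using Suc fin' unfolding nn_integral_periodic_Ioc[OF assms(1,2)] by simp
    finally show ?case .
  qed simp
  obtain n :: nat where n: "(b - a) / (2 * pi) \<le> real n" using real_arch_simple by blast
  then have "b \<le> a + real n * (2 * pi)" by (simp add: field_simps)
  then have "(\<integral>\<^sup>+x\<in>{a<..b}. F x \<partial>lborel) \<le> (\<integral>\<^sup>+x\<in>{a<..a + real n * (2 * pi)}. F x \<partial>lborel)"
    by (intro nn_integral_mono) (auto simp: indicator_def)
  then show ?thesis unfolding nn_integral_Icc_Ioc using * order.strict_trans1 by blast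
qed

section \<open>Steklov means and the modular inequality\<close>

text \<open>The Steklov mean in terms of \<open>lborel\<close> and half-open windows.
  \<open>steklov_eq_avg\<close> identifies it with \<open>steklov\<close> even for functions that
  agree only almost everywhere.\<close>

definition avg :: "real \<Rightarrow> (real \<Rightarrow> real) \<Rightarrow> real \<Rightarrow> real" where
  "avg u f x = lint f {x - u / 2<..x + u / 2} / u"

definition periodic_L1 :: "(real \<Rightarrow> real) \<Rightarrow> bool" where
  "periodic_L1 f \<longleftrightarrow> f \<in> borel_measurable borel \<and> periodic f \<and> (\<forall>a b. set_integrable lborel {a<..b} f)"

lemma lint_shift: "(LINT t:{a<..b}|lborel. f (x + t)) = lint f {x + a<..x + b}"
  unfolding set_lebesgue_integral_def
  by (subst lborel_integral_real_affine[of 1 _ x]) (auto intro!: Bochner_Integration.integral_cong simp: indicator_def)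

lemma avg_eq: "avg u f x = (\<integral>t. indicator {- u / 2<..u / 2} t * f (x + t) \<partial>lborel) / u"
  using lint_shift[of "- u / 2" "u / 2" f x] by (simp add: avg_def set_lebesgue_integral_def)

lemma borel_measurable_avg [measurable]:
  assumes [measurable]: "f \<in> borel_measurable borel"
  shows "avg u f \<in> borel_measurable borel"
  unfolding avg_eq[abs_def] by measurable

lemma lint_add_period:
  assumes "periodic f" shows "lint f {a + 2 * pi<..b + 2 * pi} = lint f {a<..b}"
  using lint_shift[of a b f "2 * pi"] assms by (simp add: periodic_def add.commute)

lemma periodic_avg: "periodic f \<Longrightarrow> periodic (avg u f)"
  using lint_add_period[of f "x - u / 2" "x + u / 2" for x]
  by (auto simp: periodic_def avg_def algebra_simps)

lemma lint_nonneg: "(\<And>x. 0 \<le> f x) \<Longrightarrow> 0 \<le> lint f A"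
  unfolding set_lebesgue_integral_def by (intro integral_nonneg_AE AE_I2) auto

text \<open>Integrate a supporting line of \<open>\<Phi>\<close> at the mean value of f.\<close>

lemma Jensen_lint:
  fixes \<Phi> :: "real \<Rightarrow> real"
  assumes c: "convex_on UNIV \<Phi>" and f: "set_integrable lborel {a<..b} f"
    and pf: "set_integrable lborel {a<..b} (\<lambda>x. \<Phi> (f x))" and ab: "a < b"
  shows "\<Phi> (lint f {a<..b} / (b - a)) \<le> lint (\<lambda>x. \<Phi> (f x)) {a<..b} / (b - a)"
proof -
  let ?m = "lint f {a<..b} / (b - a)"
  obtain d where d: "\<And>y. \<Phi> ?m + d * (y - ?m) \<le> \<Phi> y"
    using convex_le_Inf_differential[OF c, of ?m] by auto
  have i: "set_integrable lborel {a<..b} (\<lambda>x. c)" for c :: real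
    unfolding set_integrable_def using integrable_mult_left[OF integrable_indicator_Ioc[of a b], of c] by auto
  have "lint (\<lambda>x. (\<Phi> ?m - d * ?m) + d * f x) {a<..b} \<le> lint (\<lambda>x. \<Phi> (f x)) {a<..b}"
  proof (intro set_integral_mono set_integral_add set_integrable_mult_right f pf i)
    show "\<Phi> ?m - d * ?m + d * f x \<le> \<Phi> (f x)" for x using d[of "f x"] by (simp add: right_diff_distrib)
  qed
  also have "lint (\<lambda>x. (\<Phi> ?m - d * ?m) + d * f x) {a<..b} = (\<Phi> ?m - d * ?m) * (b - a) + d * lint f {a<..b}"
  proof -
    have k: "lint (\<lambda>x. c) {a<..b} = c * (b - a)" for c using ab by (simp add: set_integral_const)
    have "set_integrable lborel {a<..b} (\<lambda>x. d * f x)" using f by simp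
    from set_integral_add(2)[OF i this] show ?thesis by (simp only: k set_integral_mult_right)
  qed
  also have "\<dots> = \<Phi> ?m * (b - a)"
  proof -
    have *: "v = m * l \<Longrightarrow> (P - d * m) * l + d * v = P * l" for P m l v :: real by (simp add: algebra_simps)
    show ?thesis using ab by (intro *) simp
  qed
  finally show ?thesis using ab by (simp add: pos_le_divide_eq)
qed

lemma young_fun_mono: "young_fun \<phi> \<Longrightarrow> 0 \<le> x \<Longrightarrow> x \<le> y \<Longrightarrow> \<phi> x \<le> \<phi> y"
  unfolding young_fun_def mono_on_def by (cases "x = 0") auto

lemma young_fun_nonneg: "young_fun \<phi> \<Longrightarrow> 0 \<le> \<phi> x" by (simp add: young_fun_def)

lemma young_fun_meas: "young_fun \<phi> \<Longrightarrow> \<phi> \<in> borel_measurable borel"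
  by (auto simp: young_fun_def intro: borel_measurable_continuous_onI)

text \<open>\<open>lower\<close> and \<open>upper\<close> spell out quasiconvexity of \<phi>^(1/q):
  up to the dilation \<open>C\<^sub>0\<close>, the function \<phi> behaves like the q-th power of a
  convex function. The essential point is that the same q governs the weight class of W.\<close>

locale weighted_orlicz =
  fixes \<phi> W \<Phi> :: "real \<Rightarrow> real" and q C\<^sub>0 :: real
  assumes \<phi>: "young_fun \<phi>" and \<Phi>: "young_fun \<Phi>" "convex_on UNIV \<Phi>"
    and W: "Ap_weight q W" and perW: "periodic W" and C0: "1 \<le> C\<^sub>0"
    and lower: "\<And>x. 0 \<le> x \<Longrightarrow> \<Phi> x \<le> \<phi> x powr (1 / q)"
    and upper: "\<And>x. 0 \<le> x \<Longrightarrow> \<phi> x powr (1 / q) \<le> \<Phi> (C\<^sub>0 * x)"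
begin

lemma q: "1 < q" and W_pos: "0 < W x" and W_meas [measurable]: "W \<in> borel_measurable borel"
    and W_int: "set_integrable lborel {a<..b} W"
    and \<sigma>_int: "set_integrable lborel {a<..b} (\<lambda>x. W x powr (1 / (1 - q)))"
  using W by (auto simp: Ap_weight_def)

lemma \<phi>_meas [measurable]: "\<phi> \<in> borel_measurable borel" and \<Phi>_meas [measurable]: "\<Phi> \<in> borel_measurable borel"
  using \<phi> \<Phi> by (auto intro: young_fun_meas)

definition \<sigma> :: "real \<Rightarrow> real" where "\<sigma> x = W x powr (1 / (1 - q))"

lemma \<sigma>_pos: "0 < \<sigma> x" using W_pos[of x] by (simp add: \<sigma>_def)
lemma \<sigma>_meas [measurable]: "\<sigma> \<in> borel_measurable borel" unfolding \<sigma>_def[abs_def] by measurable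
lemma \<sigma>_int': "set_integrable lborel {a<..b} \<sigma>" using \<sigma>_int by (simp add: \<sigma>_def[abs_def])

definition Ap_const :: real where
  "Ap_const = (SOME C. \<forall>a b. a < b \<longrightarrow> (lint W {a<..b} / (b - a)) * (lint \<sigma> {a<..b} / (b - a)) powr (q - 1) \<le> C)"

lemma Ap_const: "a < b \<Longrightarrow> (lint W {a<..b} / (b - a)) * (lint \<sigma> {a<..b} / (b - a)) powr (q - 1) \<le> Ap_const"
proof -
  have "\<exists>C. \<forall>a b. a < b \<longrightarrow> (lint W {a<..b} / (b - a)) * (lint \<sigma> {a<..b} / (b - a)) powr (q - 1) \<le> C"
    using W by (auto simp: Ap_weight_def \<sigma>_def[abs_def])
  from someI_ex[OF this] show "a < b \<Longrightarrow> ?thesis" unfolding Ap_const_def by blast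
qed

lemma \<phi>_le_powr: "0 \<le> x \<Longrightarrow> \<phi> (x / C\<^sub>0) \<le> \<Phi> x powr q"
proof -
  assume x: "0 \<le> x"
  have "\<phi> (x / C\<^sub>0) = (\<phi> (x / C\<^sub>0) powr (1/q)) powr q"
    using q young_fun_nonneg[OF \<phi>] by (simp add: powr_powr)
  also have "\<dots> \<le> \<Phi> x powr q"
    using upper[of "x / C\<^sub>0"] x C0 q by (intro powr_mono2) auto
  finally show ?thesis .
qed

lemma powr_le_\<phi>: "0 \<le> x \<Longrightarrow> \<Phi> x powr q \<le> \<phi> x"
proof -
  assume x: "0 \<le> x"
  have "\<Phi> x powr q \<le> (\<phi> x powr (1/q)) powr q"
    using lower[OF x] q young_fun_nonneg[OF \<Phi>(1)] by (intro powr_mono2) auto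
  also have "\<dots> = \<phi> x" using q young_fun_nonneg[OF \<phi>] by (simp add: powr_powr)
  finally show ?thesis .
qed

lemma \<Phi>_scale: "0 \<le> l \<Longrightarrow> l \<le> 1 \<Longrightarrow> \<Phi> (l * x) \<le> l * \<Phi> x"
  using convex_onD[OF \<Phi>(2), of l 0 x] \<Phi>(1) by (simp add: young_fun_def)

lemma \<Psi>_scale: "0 \<le> l \<Longrightarrow> l \<le> 1 \<Longrightarrow> \<Phi> (l * x) powr q \<le> l * \<Phi> x powr q"
proof -
  assume l: "0 \<le> l" "l \<le> 1"
  have "\<Phi> (l * x) powr q \<le> (l * \<Phi> x) powr q"
    using \<Phi>_scale[OF l] young_fun_nonneg[OF \<Phi>(1)] q by (intro powr_mono2) auto
  also have "\<dots> = l powr q * \<Phi> x powr q" by (simp add: powr_mult)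
  also have "l powr q \<le> l" using l q powr_mono'[of 1 q l] by (cases "l = 0") auto
  finally show ?thesis by (auto simp: mult_right_mono)
qed

text \<open>Split \<phi>(f)^(1/q) as (\<phi>(f) W)^(1/q) * \<sigma>^(1 - 1/q). This is an identity
  because \<sigma>^(1 - 1/q) = W^(-1/q).\<close>

lemma Hoelder_weight:
  assumes [measurable]: "f \<in> borel_measurable borel"
    and fin: "(\<integral>\<^sup>+y\<in>{a<..b}. ennreal (\<phi> (f y) * W y) \<partial>lborel) < \<infinity>"
  shows "set_integrable lborel {a<..b} (\<lambda>y. \<phi> (f y) * W y)"
    and "set_integrable lborel {a<..b} (\<lambda>y. \<phi> (f y) powr (1 / q))"
    and "lint (\<lambda>y. \<phi> (f y) powr (1 / q)) {a<..b}
      \<le> lint (\<lambda>y. \<phi> (f y) * W y) {a<..b} powr (1 / q) * lint \<sigma> {a<..b} powr (1 - 1 / q)"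
proof -
  let ?J = "{a<..b}"
  define X Y where "X y = indicator ?J y * (\<phi> (f y) * W y)" and "Y y = indicator ?J y * \<sigma> y" for y
  have X0: "0 \<le> X y" "0 \<le> Y y" for y
    using young_fun_nonneg[OF \<phi>] W_pos[THEN less_imp_le] \<sigma>_pos[THEN less_imp_le] by (auto simp: X_def Y_def)
  have "(\<integral>\<^sup>+y\<in>?J. ennreal (\<phi> (f y) * W y) \<partial>lborel) = (\<integral>\<^sup>+y. ennreal (X y) \<partial>lborel)"
    by (intro nn_integral_cong) (auto simp: X_def indicator_def)
  then have Xi: "integrable lborel X"
    using fin X0 by (intro integrableI_nonneg) (auto simp: X_def[abs_def])
  have Yi: "integrable lborel Y"
    using \<sigma>_int'[of a b] by (simp add: Y_def[abs_def] set_integrable_def)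
  have XY: "X y powr (1/q) * Y y powr (1 - 1/q) = indicator ?J y * \<phi> (f y) powr (1/q)" for y
  proof (cases "y \<in> ?J")
    case True
    have "1 / (1 - q) * (1 - 1/q) = - (1/q)" using q by (simp add: field_simps)
    then have "\<sigma> y powr (1 - 1/q) = W y powr (- (1/q))" by (simp only: \<sigma>_def powr_powr)
    then show ?thesis using True W_pos[of y] by (simp add: X_def Y_def powr_mult powr_minus)
  qed (simp add: X_def Y_def)
  have q1: "0 < 1/q" "1/q < 1" using q by auto
  note H = Hoelder_powr[OF Xi Yi X0 q1, unfolded XY]
  show "set_integrable lborel ?J (\<lambda>y. \<phi> (f y) * W y)" "set_integrable lborel ?J (\<lambda>y. \<phi> (f y) powr (1 / q))"
    "lint (\<lambda>y. \<phi> (f y) powr (1 / q)) ?J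
      \<le> lint (\<lambda>y. \<phi> (f y) * W y) ?J powr (1 / q) * lint \<sigma> ?J powr (1 - 1 / q)"
    using Xi H by (simp_all add: set_integrable_def set_lebesgue_integral_def X_def[abs_def] Y_def[abs_def])
qed

text \<open>Jensen's inequality for \<open>\<Phi>\<close>, then \<open>lower\<close>, then Hoelder's
  inequality against the dual weight, and finally the q-th power. The division by
  \<open>C\<^sub>0\<close> pays for bounding \<phi> by \<Phi>^q.\<close>

lemma modular_avg_pointwise:
  assumes f: "periodic_L1 f" "\<And>x. 0 \<le> f x" and u: "0 < u"
  shows "ennreal (\<phi> (avg u f x / C\<^sub>0)) \<le> ennreal (avg u \<sigma> x powr (q - 1)) *
     (ennreal (1 / u) * (\<integral>\<^sup>+t\<in>{- u / 2<..u / 2}. ennreal (\<phi> (f (x + t)) * W (x + t)) \<partial>lborel))"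
proof -
  have [measurable]: "f \<in> borel_measurable borel" using f by (simp add: periodic_L1_def)
  define J where "J = {x - u / 2<..x + u / 2}"
  have [measurable]: "J \<in> sets borel" by (simp add: J_def)
  have shift: "(\<integral>\<^sup>+t\<in>{- u / 2<..u / 2}. ennreal (\<phi> (f (x + t)) * W (x + t)) \<partial>lborel)
     = (\<integral>\<^sup>+y\<in>J. ennreal (\<phi> (f y) * W y) \<partial>lborel)"
    using nn_integral_Ioc_shift[of "\<lambda>y. ennreal (\<phi> (f y) * W y)" "- u / 2" x "u / 2"]
    by (simp add: J_def add.commute)
  have s: "0 < avg u \<sigma> x"
    using lint_pos[OF \<sigma>_meas \<sigma>_pos \<sigma>_int'] u by (simp add: avg_def)
  show ?thesis
  \<comment> \<open>When the local integral is infinite so is the right-hand side, since the mean of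
    \<open>\<sigma>\<close> is positive; otherwise Bochner integrals may be used.\<close>
  proof (cases "(\<integral>\<^sup>+y\<in>J. ennreal (\<phi> (f y) * W y) \<partial>lborel) = \<infinity>")
    case True
    then show ?thesis unfolding shift using s u by (simp add: ennreal_mult_top)
  next
    case False
    define X Y where "X = lint (\<lambda>y. \<phi> (f y) * W y) J" and "Y = lint \<sigma> J"
    have "(\<integral>\<^sup>+y\<in>J. ennreal (\<phi> (f y) * W y) \<partial>lborel) < \<infinity>" using False by (simp add: less_top)
    note H = Hoelder_weight[OF \<open>f \<in> borel_measurable borel\<close> this[unfolded J_def], folded J_def, folded X_def Y_def]
    have Pi: "set_integrable lborel J (\<lambda>y. \<Phi> (f y))"
    proof (rule set_integrable_bound[OF H(2)])
      show "AE y in lborel. y \<in> J \<longrightarrow> norm (\<Phi> (f y)) \<le> norm (\<phi> (f y) powr (1/q))"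
        using lower f(2) young_fun_nonneg[OF \<Phi>(1)] by (intro AE_I2) auto
    qed (auto simp: set_borel_measurable_def)
    have "\<Phi> (avg u f x) \<le> lint (\<lambda>y. \<Phi> (f y)) J / u"
      using Jensen_lint[OF \<Phi>(2) _ Pi[unfolded J_def]] f u by (simp add: avg_def periodic_L1_def J_def)
    also have "\<dots> \<le> lint (\<lambda>y. \<phi> (f y) powr (1/q)) J / u"
      using lower f(2) u by (intro divide_right_mono set_integral_mono Pi H(2)) auto
    also have "\<dots> \<le> X powr (1/q) * Y powr (1 - 1/q) / u"
      using H(3) u by (intro divide_right_mono) auto
    finally have 1: "\<Phi> (avg u f x) \<le> X powr (1/q) * Y powr (1 - 1/q) / u" .
    have X0: "0 \<le> X" "0 \<le> Y"
      unfolding X_def Y_def using young_fun_nonneg[OF \<phi>] W_pos[THEN less_imp_le] \<sigma>_pos[THEN less_imp_le]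
      by (auto intro!: lint_nonneg)
    have Ys: "Y = u * avg u \<sigma> x"
      using u by (simp add: avg_def Y_def J_def)
    have "0 \<le> avg u f x" using lint_nonneg[of f] f u by (simp add: avg_def)
    then have "\<phi> (avg u f x / C\<^sub>0) \<le> \<Phi> (avg u f x) powr q" by (rule \<phi>_le_powr)
    also have "\<dots> \<le> (X powr (1/q) * Y powr (1 - 1/q) / u) powr q"
      using 1 q young_fun_nonneg[OF \<Phi>(1)] by (intro powr_mono2) auto
    also have "\<dots> = X * Y powr (q - 1) / u powr q"
    proof -
      have e: "1 / q * q = 1" "(1 - 1 / q) * q = q - 1" using q by (auto simp: field_simps)
      show ?thesis using X0 by (simp only: powr_divide powr_mult powr_powr e) simp
    qed
    also have "\<dots> = avg u \<sigma> x powr (q - 1) * (1 / u * X)"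
      using u unfolding Ys powr_mult by (simp add: powr_diff mult_ac)
    finally have "ennreal (\<phi> (avg u f x / C\<^sub>0)) \<le> ennreal (avg u \<sigma> x powr (q - 1) * (1 / u * X))"
      by (rule ennreal_leI)
    also have "\<dots> = ennreal (avg u \<sigma> x powr (q - 1)) * (ennreal (1 / u) * ennreal X)"
      using u X0 by (simp add: ennreal_mult[symmetric])
    also have "ennreal X = (\<integral>\<^sup>+y\<in>J. ennreal (\<phi> (f y) * W y) \<partial>lborel)"
      unfolding X_def set_lebesgue_integral_def using H(1) young_fun_nonneg[OF \<phi>] W_pos[THEN less_imp_le]
      by (subst nn_integral_eq_integral[symmetric])
        (auto simp: set_integrable_def indicator_def intro!: nn_integral_cong)
    finally show ?thesis unfolding shift .
  qed
qed

text \<open>For t in the window, both y - t and the window of width u around it lie in J = (y - u, y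
  + u]. Hence W and the mean of \<open>\<sigma>\<close> are controlled by integrals over J, to which
  A_q applies. The factor 2 u is the length of J, and 2^(q-1) arises because the mean of
  \<open>\<sigma>\<close> is taken over half that length.\<close>

lemma weight_kernel_bound:
  assumes u: "0 < u"
  shows "(\<integral>\<^sup>+t\<in>{- u / 2<..u / 2}. ennreal (W (y - t) * avg u \<sigma> (y - t) powr (q - 1)) \<partial>lborel)
    \<le> ennreal (2 * u * 2 powr (q - 1) * Ap_const)"
proof -
  let ?s = "2 * (lint \<sigma> {y - u<..y + u} / (2 * u))"
  have S: "avg u \<sigma> (y - t) \<le> ?s" if "t \<in> {- u / 2<..u / 2}" for t
  proof -
    have "lint \<sigma> {y - t - u / 2<..y - t + u / 2} \<le> lint \<sigma> {y - u<..y + u}"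
      using that \<sigma>_pos[THEN less_imp_le] by (intro lint_mono_set \<sigma>_int') auto
    then show ?thesis using u by (simp add: avg_def divide_right_mono)
  qed
  have S0: "0 \<le> avg u \<sigma> z" for z using lint_nonneg[of \<sigma>] \<sigma>_pos[THEN less_imp_le] u by (simp add: avg_def)
  have "(\<integral>\<^sup>+t\<in>{- u / 2<..u / 2}. ennreal (W (y - t) * avg u \<sigma> (y - t) powr (q - 1)) \<partial>lborel)
     \<le> (\<integral>\<^sup>+t. ennreal (?s powr (q - 1)) * ennreal (indicator {y - u<..y + u} (y - t) * W (y - t)) \<partial>lborel)"
  proof (rule nn_integral_mono)
    fix t
    show "ennreal (W (y - t) * avg u \<sigma> (y - t) powr (q - 1)) * indicator {- u / 2<..u / 2} t
      \<le> ennreal (?s powr (q - 1)) * ennreal (indicator {y - u<..y + u} (y - t) * W (y - t))"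
    proof (cases "t \<in> {- u / 2<..u / 2}")
      case True
      then have "avg u \<sigma> (y - t) powr (q - 1) \<le> ?s powr (q - 1)"
        using S S0 q by (intro powr_mono2) auto
      then have "W (y - t) * avg u \<sigma> (y - t) powr (q - 1) \<le> ?s powr (q - 1) * W (y - t)"
        using W_pos[of "y - t"] by (simp add: mult.commute)
      moreover have "y - t \<in> {y - u<..y + u}" using True u by auto
      ultimately show ?thesis using True W_pos[of "y - t"] by (simp add: ennreal_mult[symmetric] ennreal_leI)
    qed simp
  qed
  also have "\<dots> = ennreal (?s powr (q - 1)) * (\<integral>\<^sup>+t. ennreal (indicator {y - u<..y + u} (y - t) * W (y - t)) \<partial>lborel)"
    by (intro nn_integral_cmult) measurable
  also have "(\<integral>\<^sup>+t. ennreal (indicator {y - u<..y + u} (y - t) * W (y - t)) \<partial>lborel)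
     = (\<integral>\<^sup>+t. ennreal (indicator {y - u<..y + u} t * W t) \<partial>lborel)"
    using nn_integral_real_affine[of "\<lambda>t. ennreal (indicator {y - u<..y + u} t * W t)" "-1" y] by simp
  also have "\<dots> = ennreal (lint W {y - u<..y + u})"
    using W_int[of "y - u" "y + u"] W_pos[THEN less_imp_le] unfolding set_lebesgue_integral_def set_integrable_def
    by (subst nn_integral_eq_integral) auto
  also have "ennreal (?s powr (q - 1)) * ennreal (lint W {y - u<..y + u}) = ennreal (?s powr (q - 1) * lint W {y - u<..y + u})"
    using lint_nonneg[of W] W_pos[THEN less_imp_le] by (simp add: ennreal_mult)
  also have "\<dots> \<le> ennreal (2 * u * 2 powr (q - 1) * Ap_const)"
  proof (rule ennreal_leI)
    have "2 * u * 2 powr (q - 1) * (lint W {y - u<..y + u} / ((y + u) - (y - u)) *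
        (lint \<sigma> {y - u<..y + u} / ((y + u) - (y - u))) powr (q - 1)) \<le> 2 * u * 2 powr (q - 1) * Ap_const"
      using u by (intro mult_left_mono Ap_const) auto
    then show "?s powr (q - 1) * lint W {y - u<..y + u} \<le> 2 * u * 2 powr (q - 1) * Ap_const"
      unfolding powr_mult using u by (simp add: mult_ac)
  qed
  finally show ?thesis .
qed

lemma Ap_const_nonneg: "0 \<le> Ap_const"
proof -
  have "0 \<le> (lint W {0<..1} / (1 - 0)) * (lint \<sigma> {0<..1} / (1 - 0)) powr (q - 1)"
    using lint_nonneg[of W] W_pos[THEN less_imp_le] by simp
  then show ?thesis using Ap_const[of 0 1] by simp
qed

abbreviation modular :: "(real \<Rightarrow> real) \<Rightarrow> ennreal" where
  "modular f \<equiv> \<integral>\<^sup>+x\<in>{0..2 * pi}. ennreal (\<phi> (f x) * W x) \<partial>lborel"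

text \<open>The maximum with 1 is there because the constant later serves as the divisor in
  \<open>modular_scale_down\<close>.\<close>

definition modular_const :: real where "modular_const = max 1 (2 * 2 powr (q - 1) * Ap_const)"

text \<open>Integrate the pointwise estimate against W, exchange the integrals, and translate x by t
  over a full period: f is then evaluated at x and all weights at x - t. The remaining t-integral of
  the weights is at most a constant times u, which cancels 1/u; hence the bound is uniform in
  u.\<close>

lemma modular_avg:
  assumes f: "periodic_L1 f" "\<And>x. 0 \<le> f x" and u: "0 < u"
  shows "modular (\<lambda>x. avg u f x / C\<^sub>0) \<le> ennreal modular_const * modular f"
proof -
  have [measurable]: "f \<in> borel_measurable borel" and perf: "periodic f" using f by (auto simp: periodic_L1_def)
  define G where "G x = ennreal (W x * avg u \<sigma> x powr (q - 1))" for x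
  define H where "H x = ennreal (\<phi> (f x) * W x)" for x
  have [measurable]: "G \<in> borel_measurable borel" "H \<in> borel_measurable borel"
    unfolding G_def[abs_def] H_def[abs_def] by measurable
  have periodic\<sigma>: "periodic \<sigma>" using perW by (simp add: periodic_def \<sigma>_def)
  have perG: "periodic G" "periodic H" using perW periodic_avg[OF periodic\<sigma>, of u] perf by (auto simp: periodic_def G_def H_def)
  let ?I = "{- u / 2<..u / 2}" and ?T = "{0..2 * pi}"
  have "modular (\<lambda>x. avg u f x / C\<^sub>0) \<le> (\<integral>\<^sup>+x\<in>?T. G x * (ennreal (1 / u) * (\<integral>\<^sup>+t\<in>?I. H (x + t) \<partial>lborel)) \<partial>lborel)"
  proof (intro nn_integral_mono mult_right_mono)
    fix x
    have "ennreal (\<phi> (avg u f x / C\<^sub>0) * W x) = ennreal (\<phi> (avg u f x / C\<^sub>0)) * ennreal (W x)"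
      using W_pos[of x] young_fun_nonneg[OF \<phi>] by (simp add: ennreal_mult)
    also have "\<dots> \<le> (ennreal (avg u \<sigma> x powr (q - 1)) * (ennreal (1 / u) * (\<integral>\<^sup>+t\<in>?I. H (x + t) \<partial>lborel))) * ennreal (W x)"
      unfolding H_def by (intro mult_right_mono modular_avg_pointwise[OF f u]) auto
    also have "\<dots> = G x * (ennreal (1 / u) * (\<integral>\<^sup>+t\<in>?I. H (x + t) \<partial>lborel))"
      unfolding G_def using W_pos[of x] by (simp add: ennreal_mult mult_ac)
    finally show "ennreal (\<phi> (avg u f x / C\<^sub>0) * W x) \<le> G x * (ennreal (1 / u) * (\<integral>\<^sup>+t\<in>?I. H (x + t) \<partial>lborel))" .
  qed simp
  also have "\<dots> = (\<integral>\<^sup>+x. (\<integral>\<^sup>+t. ennreal (1 / u) * (G x * H (x + t) * indicator ?T x * indicator ?I t) \<partial>lborel) \<partial>lborel)"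
    by (intro nn_integral_cong) (simp add: nn_integral_cmult[symmetric] nn_integral_multc[symmetric] mult_ac)
  also have "\<dots> = (\<integral>\<^sup>+t. (\<integral>\<^sup>+x. ennreal (1 / u) * (G x * H (x + t) * indicator ?T x * indicator ?I t) \<partial>lborel) \<partial>lborel)"
    by (rule lborel_pair.Fubini'[symmetric]) measurable
  also have "\<dots> = (\<integral>\<^sup>+t. ennreal (1 / u) * indicator ?I t * (\<integral>\<^sup>+x\<in>?T. G x * H (x + t) \<partial>lborel) \<partial>lborel)"
    by (intro nn_integral_cong) (simp add: nn_integral_cmult[symmetric] mult_ac)
  also have "\<dots> = (\<integral>\<^sup>+t. ennreal (1 / u) * indicator ?I t * (\<integral>\<^sup>+x\<in>?T. G (x - t) * H x \<partial>lborel) \<partial>lborel)"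
  proof (intro nn_integral_cong)
    fix t
    have "periodic (\<lambda>x. G x * H (x + t))" using perG unfolding periodic_def by (metis add.assoc add.commute)
    then have "(\<integral>\<^sup>+x\<in>?T. G (x + - t) * H (x + - t + t) \<partial>lborel) = (\<integral>\<^sup>+x\<in>?T. G x * H (x + t) \<partial>lborel)"
      by (intro nn_integral_periodic_shift) measurable
    then show "ennreal (1 / u) * indicator ?I t * (\<integral>\<^sup>+x\<in>?T. G x * H (x + t) \<partial>lborel)
      = ennreal (1 / u) * indicator ?I t * (\<integral>\<^sup>+x\<in>?T. G (x - t) * H x \<partial>lborel)" by simp
  qed
  also have "\<dots> = (\<integral>\<^sup>+t. (\<integral>\<^sup>+x. ennreal (1 / u) * (G (x - t) * H x * indicator ?T x * indicator ?I t) \<partial>lborel) \<partial>lborel)"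
    by (intro nn_integral_cong) (simp add: nn_integral_cmult[symmetric] mult_ac)
  also have "\<dots> = (\<integral>\<^sup>+x. (\<integral>\<^sup>+t. ennreal (1 / u) * (G (x - t) * H x * indicator ?T x * indicator ?I t) \<partial>lborel) \<partial>lborel)"
    by (rule lborel_pair.Fubini') measurable
  also have "\<dots> = (\<integral>\<^sup>+x. ennreal (1 / u) * H x * indicator ?T x * (\<integral>\<^sup>+t\<in>?I. G (x - t) \<partial>lborel) \<partial>lborel)"
    by (intro nn_integral_cong) (simp add: nn_integral_cmult[symmetric] mult_ac)
  also have "\<dots> \<le> (\<integral>\<^sup>+x. ennreal (1 / u) * H x * indicator ?T x * ennreal (2 * u * 2 powr (q - 1) * Ap_const) \<partial>lborel)"
    unfolding G_def by (intro nn_integral_mono mult_left_mono weight_kernel_bound u) auto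
  also have "\<dots> = (\<integral>\<^sup>+x. (ennreal (1 / u) * ennreal (2 * u * 2 powr (q - 1) * Ap_const)) * (H x * indicator ?T x) \<partial>lborel)"
    by (simp add: mult_ac)
  also have "\<dots> = (ennreal (1 / u) * ennreal (2 * u * 2 powr (q - 1) * Ap_const)) * modular f"
    unfolding H_def by (intro nn_integral_cmult) measurable
  also have "ennreal (1 / u) * ennreal (2 * u * 2 powr (q - 1) * Ap_const) \<le> ennreal modular_const"
    using u Ap_const_nonneg by (subst ennreal_mult[symmetric]) (auto simp: modular_const_def intro!: ennreal_leI)
  finally show ?thesis by (auto simp: mult_right_mono)
qed

end

section \<open>The Orlicz norm\<close>

definition dual_ball :: "(real \<Rightarrow> real) \<Rightarrow> (real \<Rightarrow> real) \<Rightarrow> (real \<Rightarrow> real) set" where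
  "dual_ball \<phi> W = {g \<in> borel_measurable borel.
     (\<integral>\<^sup>+x\<in>{0..2 * pi}. compl_fun \<phi> \<bar>g x\<bar> * ennreal (W x) \<partial>lborel) \<le> 1}"

definition pairing :: "(real \<Rightarrow> real) \<Rightarrow> (real \<Rightarrow> real) \<Rightarrow> (real \<Rightarrow> real) \<Rightarrow> ennreal" where
  "pairing W f g = (\<integral>\<^sup>+x\<in>{0..2 * pi}. ennreal (\<bar>f x * g x\<bar> * W x) \<partial>lborel)"

lemma nn_integral_torus: "(\<integral>\<^sup>+x. F x \<partial>torus) = (\<integral>\<^sup>+x\<in>{0..2 * pi}. F x \<partial>lborel)"
  by (subst nn_integral_restrict_space) (auto simp: nn_integral_completion)

text \<open>A test function on the torus, extended by 0, is almost everywhere equal to a Borel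
  function on the line. After this reduction the Tonelli arguments can be carried out over
  \<open>lborel\<close>.\<close>

lemma orlicz_norm_eq_SUP_dual_ball: "orlicz_norm \<phi> W f = (SUP g\<in>dual_ball \<phi> W. pairing W f g)"
  unfolding orlicz_norm_def
proof (rule SUP_eq)
  fix g assume g: "g \<in> {g. g \<in> borel_measurable torus \<and>
                (\<integral>\<^sup>+x. compl_fun \<phi> \<bar>g x\<bar> * ennreal (W x) \<partial>torus) \<le> 1}"
  then have "(\<lambda>x. if x \<in> {0..2 * pi} then g x else 0) \<in> borel_measurable lebesgue"
    by (intro borel_measurable_if_I) auto
  from completion_ex_borel_measurable_real[OF this] obtain g' where
    g': "g' \<in> borel_measurable borel" "AE x in lborel. (if x \<in> {0..2 * pi} then g x else 0) = g' x"
    by auto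
  have 1: "(\<integral>\<^sup>+x. compl_fun \<phi> \<bar>g x\<bar> * ennreal (W x) \<partial>torus)
     = (\<integral>\<^sup>+x\<in>{0..2 * pi}. compl_fun \<phi> \<bar>g' x\<bar> * ennreal (W x) \<partial>lborel)"
    unfolding nn_integral_torus using g'(2)
    by (intro nn_integral_cong_AE) (auto elim!: eventually_mono simp: indicator_def)
  have 2: "(\<integral>\<^sup>+x. ennreal (\<bar>f x * g x\<bar> * W x) \<partial>torus) = pairing W f g'"
    unfolding nn_integral_torus pairing_def using g'(2)
    by (intro nn_integral_cong_AE) (auto elim!: eventually_mono simp: indicator_def)
  show "\<exists>g'\<in>dual_ball \<phi> W. (\<integral>\<^sup>+x. ennreal (\<bar>f x * g x\<bar> * W x) \<partial>torus) \<le> pairing W f g'"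
    using g g' 1 2 by (intro bexI[of _ g']) (auto simp: dual_ball_def)
next
  fix g assume g: "g \<in> dual_ball \<phi> W"
  then have "g \<in> borel_measurable torus"
    unfolding dual_ball_def by (auto intro!: measurable_restrict_space1 measurable_completion)
  then show "\<exists>g'\<in>{g. g \<in> borel_measurable torus \<and>
        (\<integral>\<^sup>+x. compl_fun \<phi> \<bar>g x\<bar> * ennreal (W x) \<partial>torus) \<le> 1}.
      pairing W f g \<le> (\<integral>\<^sup>+x. ennreal (\<bar>f x * g' x\<bar> * W x) \<partial>torus)"
    using g by (intro bexI[of _ g]) (auto simp: dual_ball_def pairing_def nn_integral_torus)
qed

lemma compl_fun_Young: "0 \<le> x \<Longrightarrow> 0 \<le> \<phi> x \<Longrightarrow> ennreal (x * y) \<le> ennreal (\<phi> x) + compl_fun \<phi> y"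
proof -
  assume x: "0 \<le> x" "0 \<le> \<phi> x"
  have "ennreal (x * y) \<le> ennreal (\<phi> x + max 0 (x * y - \<phi> x))"
    by (intro ennreal_leI) auto
  also have "\<dots> = ennreal (\<phi> x) + ennreal (x * y - \<phi> x)"
    using x by (subst ennreal_plus) (auto simp: max_def ennreal_neg)
  also have "ennreal (x * y - \<phi> x) \<le> compl_fun \<phi> y"
    unfolding compl_fun_def using x by (intro SUP_upper) auto
  finally show ?thesis by (simp add: add_left_mono)
qed

text \<open>The supremum runs over an uncountable family, but of continuous functions of y; it is
  lower semicontinuous, so its superlevel sets are open.\<close>

lemma borel_measurable_compl_fun [measurable]: "compl_fun \<phi> \<in> borel_measurable borel"
proof (rule borel_measurableI_greater)
  fix a :: ennreal
  have "{y. a < compl_fun \<phi> y} = (\<Union>x\<in>{0..}. {y. a < ennreal (x * y - \<phi> x)})"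
    by (auto simp: compl_fun_def less_SUP_iff)
  moreover have "open {y. a < ennreal (x * y - \<phi> x)}" for x
    by (intro open_Collect_less continuous_on_const continuous_on_ennreal) (intro continuous_intros)
  ultimately show "{y \<in> space borel. a < compl_fun \<phi> y} \<in> sets borel"
    by (auto intro!: borel_open open_UN)
qed

text \<open>The device for turning estimates of normalised functions into norm inequalities. Testing
  with every real l strictly above X avoids dividing by X and so includes X = 0; an infinite X is
  trivial.\<close>

lemma ennreal_le_mult_by_scaling:
  fixes X Y :: ennreal
  assumes *: "\<And>l. 0 < l \<Longrightarrow> X < ennreal l \<Longrightarrow> Y \<le> ennreal (C * l)" and C: "0 < C"
  shows "Y \<le> ennreal C * X"
proof (cases X)
  case (real r)
  show ?thesis
  proof (rule ennreal_le_epsilon)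
    fix e :: real assume e: "0 < e"
    have "Y \<le> ennreal (C * (r + e / C))"
      using real e C by (intro *) (auto intro!: ennreal_lessI add_nonneg_pos)
    also have "C * (r + e / C) = C * r + e" using C by (simp add: field_simps)
    also have "ennreal (C * r + e) = ennreal C * X + ennreal e"
      using real C e by (simp add: ennreal_mult)
    finally show "Y \<le> ennreal C * X + ennreal e" .
  qed
next
  case top
  then show ?thesis using C by (simp add: ennreal_mult_top)
qed

section \<open>Stability of periodic integrable functions under Steklov means\<close>

lemma periodic_L1_meas: "periodic_L1 f \<Longrightarrow> f \<in> borel_measurable borel" and periodic_L1_periodic: "periodic_L1 f \<Longrightarrow> periodic f"
  and periodic_L1_int: "periodic_L1 f \<Longrightarrow> set_integrable lborel {a<..b} f"
  by (auto simp: periodic_L1_def)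

lemma periodic_L1_abs: "periodic_L1 f \<Longrightarrow> periodic_L1 (\<lambda>x. \<bar>f x\<bar>)"
  by (auto simp: periodic_L1_def periodic_def intro: set_integrable_abs)

lemma periodic_L1_cmult: "periodic_L1 f \<Longrightarrow> periodic_L1 (\<lambda>x. c * f x)"
  by (auto simp: periodic_L1_def periodic_def)

lemma periodic_L1_add: "periodic_L1 f \<Longrightarrow> periodic_L1 g \<Longrightarrow> periodic_L1 (\<lambda>x. f x + g x)"
  by (auto simp: periodic_L1_def periodic_def)

lemma periodic_L1_diff: "periodic_L1 f \<Longrightarrow> periodic_L1 g \<Longrightarrow> periodic_L1 (\<lambda>x. f x - g x)"
  by (auto simp: periodic_L1_def periodic_def)

lemma periodic_L1_sum: "(\<And>i. i \<in> I \<Longrightarrow> periodic_L1 (f i)) \<Longrightarrow> periodic_L1 (\<lambda>x. \<Sum>i\<in>I. f i x)"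
  by (induction I rule: infinite_finite_induct) (auto intro!: periodic_L1_add simp: periodic_L1_def[of "\<lambda>_. 0"] periodic_def set_integrable_def)

lemma periodic_L1_bounded:
  assumes [measurable]: "f \<in> borel_measurable borel" and "periodic f" and B: "\<And>x. \<bar>f x\<bar> \<le> B"
  shows "periodic_L1 f"
  unfolding periodic_L1_def
proof (intro conjI allI assms)
  fix a b :: real
  have "set_integrable lborel {a<..b} (\<lambda>x. 1 * f x)"
    using B integrable_indicator_Ioc[of a b] by (intro set_integrable_mult_bounded[where B = B]) (auto simp: set_integrable_def)
  then show "set_integrable lborel {a<..b} f" by simp
qed

lemma periodic_L1_const: "periodic_L1 (\<lambda>x. c)"
  by (rule periodic_L1_bounded[of _ "\<bar>c\<bar>"]) (auto simp: periodic_def)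

lemma periodic_reduce:
  assumes "periodic f" shows "\<exists>y\<in>{0..2 * pi}. f y = f x"
proof -
  define k :: int where "k = \<lfloor>x / (2 * pi)\<rfloor>"
  define s where "s = x - of_int k * (2 * pi)"
  have "of_int k \<le> x / (2 * pi)" "x / (2 * pi) \<le> of_int k + 1"
    unfolding k_def by linarith+
  then have s: "0 \<le> s" "s \<le> 2 * pi"
    unfolding s_def by (auto simp: field_simps)
  have "f s = f x" using periodic_of_int[OF assms, of s k] by (simp add: s_def)
  then show ?thesis using s by auto
qed

lemma avg_mono: "periodic_L1 f \<Longrightarrow> periodic_L1 g \<Longrightarrow> 0 < u \<Longrightarrow> (\<And>x. f x \<le> g x) \<Longrightarrow> avg u f x \<le> avg u g x"
  unfolding avg_def by (intro divide_right_mono set_integral_mono periodic_L1_int) auto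

lemma avg_nonneg: "0 < u \<Longrightarrow> (\<And>x. 0 \<le> f x) \<Longrightarrow> 0 \<le> avg u f x"
  unfolding avg_def using lint_nonneg[of f] by auto

lemma avg_cmult: "avg u (\<lambda>x. c * f x) x = c * avg u f x"
  by (simp add: avg_def)

lemma avg_abs: "periodic_L1 f \<Longrightarrow> 0 < u \<Longrightarrow> \<bar>avg u f x\<bar> \<le> avg u (\<lambda>x. \<bar>f x\<bar>) x"
  using avg_mono[of f "\<lambda>x. \<bar>f x\<bar>" u x] avg_mono[of "\<lambda>x. (-1) * f x" "\<lambda>x. \<bar>f x\<bar>" u x] avg_cmult[of u "-1" f x]
    periodic_L1_abs[of f] periodic_L1_cmult[of f "-1"] by (auto simp: abs_le_iff)

lemma avg_const: "0 < u \<Longrightarrow> avg u (\<lambda>x. c) x = c"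
  by (simp add: avg_def set_integral_const)

lemma avg_le_bound:
  assumes "periodic_L1 f" "0 < u" "\<And>x. \<bar>f x\<bar> \<le> B"
  shows "\<bar>avg u f x\<bar> \<le> B"
proof -
  have "\<bar>avg u f x\<bar> \<le> avg u (\<lambda>x. \<bar>f x\<bar>) x" using assms by (intro avg_abs)
  also have "\<dots> \<le> avg u (\<lambda>x. B) x" using assms by (intro avg_mono periodic_L1_abs periodic_L1_const)
  finally show ?thesis using avg_const[of u B] assms by simp
qed

lemma avg_bounded:
  assumes f: "periodic_L1 f" and u: "0 < u"
  shows "\<exists>B. \<forall>x. \<bar>avg u f x\<bar> \<le> B"
proof (intro exI allI)
  fix x
  obtain y where y: "y \<in> {0..2 * pi}" "avg u f y = avg u f x" using periodic_reduce[OF periodic_avg[OF periodic_L1_periodic[OF f]]] by blast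
  have "\<bar>avg u f y\<bar> \<le> avg u (\<lambda>x. \<bar>f x\<bar>) y" by (rule avg_abs[OF f u])
  also have "\<dots> \<le> lint (\<lambda>x. \<bar>f x\<bar>) {- u / 2<..2 * pi + u / 2} / u"
    unfolding avg_def using y u by (intro divide_right_mono lint_mono_set periodic_L1_int[OF periodic_L1_abs[OF f]]) auto
  finally show "\<bar>avg u f x\<bar> \<le> lint (\<lambda>x. \<bar>f x\<bar>) {- u / 2<..2 * pi + u / 2} / u" by (simp add: y(2))
qed

lemma periodic_L1_avg: "periodic_L1 f \<Longrightarrow> 0 < u \<Longrightarrow> periodic_L1 (avg u f)"
  using avg_bounded[of f u] by (auto intro: periodic_L1_bounded borel_measurable_avg periodic_avg periodic_L1_periodic periodic_L1_meas)

lemma periodic_L1_avg_pow: "periodic_L1 f \<Longrightarrow> 0 < u \<Longrightarrow> periodic_L1 ((avg u ^^ j) f)"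
  by (induction j) (auto intro: periodic_L1_avg)

lemma avg_pow_nonneg: "0 < u \<Longrightarrow> (\<And>x. 0 \<le> f x) \<Longrightarrow> 0 \<le> (avg u ^^ j) f x"
  by (induction j arbitrary: x) (auto intro: avg_nonneg)

lemma avg_pow_abs: "periodic_L1 f \<Longrightarrow> 0 < u \<Longrightarrow> \<bar>(avg u ^^ j) f x\<bar> \<le> (avg u ^^ j) (\<lambda>x. \<bar>f x\<bar>) x"
proof (induction j arbitrary: x)
  case (Suc j)
  have "\<bar>avg u ((avg u ^^ j) f) x\<bar> \<le> avg u (\<lambda>x. \<bar>(avg u ^^ j) f x\<bar>) x"
    using Suc.prems by (intro avg_abs periodic_L1_avg_pow)
  also have "\<dots> \<le> avg u ((avg u ^^ j) (\<lambda>x. \<bar>f x\<bar>)) x"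
    using Suc by (intro avg_mono periodic_L1_abs periodic_L1_avg_pow) auto
  finally show ?case by simp
qed simp

lemma ennreal_avg:
  assumes f: "periodic_L1 f" "\<And>x. 0 \<le> f x" and u: "0 < u"
  shows "ennreal (u * avg u f x) = (\<integral>\<^sup>+y. ennreal (f y) * indicator {x - u / 2<..x + u / 2} y \<partial>lborel)"
proof -
  have "u * avg u f x = (\<integral>y. indicator {x - u / 2<..x + u / 2} y * f y \<partial>lborel)"
    using u by (simp add: avg_def set_lebesgue_integral_def)
  also have "ennreal \<dots> = (\<integral>\<^sup>+y. ennreal (indicator {x - u / 2<..x + u / 2} y * f y) \<partial>lborel)"
    using periodic_L1_int[OF f(1)] f(2) by (intro nn_integral_eq_integral[symmetric]) (auto simp: set_integrable_def)
  also have "\<dots> = (\<integral>\<^sup>+y. ennreal (f y) * indicator {x - u / 2<..x + u / 2} y \<partial>lborel)"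
    by (intro nn_integral_cong) (auto simp: indicator_def)
  finally show ?thesis .
qed

lemma emeasure_between:
  assumes "A \<in> sets lborel" "{l<..<r} \<subseteq> A" "A \<subseteq> {l..r::real}"
  shows "emeasure lborel A = ennreal (r - l)"
proof (cases "l \<le> r")
  case True
  have "emeasure lborel A \<le> emeasure lborel {l..r}" "emeasure lborel {l<..<r} \<le> emeasure lborel A"
    using assms by (auto intro!: emeasure_mono)
  then show ?thesis using True by simp
next
  case False
  then have "A = {}" using assms by auto
  then show ?thesis using False by (simp add: ennreal_neg)
qed

text \<open>The trapezoidal kernel of the composition is a superposition of box kernels.\<close>

lemma avg_avg_mixture:
  assumes f: "periodic_L1 f" "\<And>x. 0 \<le> f x" and s: "0 < s" and h: "0 < h"
  shows "ennreal (avg s (avg h f) x) = (\<integral>\<^sup>+u. ennreal (1 / (2 * h * s)) * ennreal (u * avg u f x) * indicator {\<bar>s - h\<bar><..s + h} u \<partial>lborel)"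
proof -
  have [measurable]: "f \<in> borel_measurable borel" using f by (auto simp: periodic_L1_def)
  have st: "ennreal (avg u g y) = ennreal (1 / u) * ennreal (u * avg u g y)" if "0 < u" "periodic_L1 g" "\<And>x. 0 \<le> g x" for u g y
    using that avg_nonneg[of u g y] by (simp add: ennreal_mult[symmetric])
  have "ennreal (avg s (avg h f) x) = ennreal (1 / s) * (\<integral>\<^sup>+t. ennreal (avg h f t) * indicator {x - s / 2<..x + s / 2} t \<partial>lborel)"
    using f s h by (subst st[OF s]) (auto intro!: periodic_L1_avg avg_nonneg ennreal_avg arg_cong2[of _ _ _ _ "(*)"])
  also have "\<dots> = (\<integral>\<^sup>+t. ennreal (1 / s) * (ennreal (1 / h) * (\<integral>\<^sup>+y. ennreal (f y) * indicator {t - h / 2<..t + h / 2} y \<partial>lborel)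
      * indicator {x - s / 2<..x + s / 2} t) \<partial>lborel)"
    unfolding st[OF h f(1,2)] ennreal_avg[OF f h]
    by (intro nn_integral_cmult[symmetric]) (unfold indicator_def greaterThanAtMost_iff, measurable)
  also have "\<dots> = (\<integral>\<^sup>+t. (\<integral>\<^sup>+y. ennreal (1 / s) * ennreal (1 / h) * (ennreal (f y) * (indicator {t - h / 2<..t + h / 2} y
      * indicator {x - s / 2<..x + s / 2} t)) \<partial>lborel) \<partial>lborel)"
    by (intro nn_integral_cong) (simp add: nn_integral_cmult[symmetric] nn_integral_multc[symmetric] mult_ac)
  also have "\<dots> = (\<integral>\<^sup>+y. (\<integral>\<^sup>+t. ennreal (1 / s) * ennreal (1 / h) * (ennreal (f y) * (indicator {t - h / 2<..t + h / 2} y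
      * indicator {x - s / 2<..x + s / 2} t)) \<partial>lborel) \<partial>lborel)"
    by (rule lborel_pair.Fubini'[symmetric]) (unfold indicator_def greaterThanAtMost_iff, measurable)
  \<comment> \<open>The inner integral is the overlap of the window of width s around x with that of
    width h around y: a trapezoid in |x - y|, which \<open>ennreal\<close> cuts off at 0.\<close>
  also have "\<dots> = (\<integral>\<^sup>+y. ennreal (1 / (2 * h * s)) * (ennreal (f y) * ennreal (s + h - max \<bar>s - h\<bar> (2 * \<bar>x - y\<bar>))) \<partial>lborel)"
  proof (intro nn_integral_cong)
    fix y
    have "(\<integral>\<^sup>+t. ennreal (1 / s) * ennreal (1 / h) * (ennreal (f y) * (indicator {t - h / 2<..t + h / 2} y
        * indicator {x - s / 2<..x + s / 2} t)) \<partial>lborel)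
       = (\<integral>\<^sup>+t. ennreal (1 / s) * ennreal (1 / h) * ennreal (f y) * indicator ({x - s / 2<..x + s / 2} \<inter> {y - h / 2..<y + h / 2}) t \<partial>lborel)"
      by (intro nn_integral_cong) (auto simp: indicator_def mult.assoc)
    also have "\<dots> = ennreal (1 / s) * ennreal (1 / h) * ennreal (f y) * emeasure lborel ({x - s / 2<..x + s / 2} \<inter> {y - h / 2..<y + h / 2})"
      by (intro nn_integral_cmult_indicator) auto
    also have "emeasure lborel ({x - s / 2<..x + s / 2} \<inter> {y - h / 2..<y + h / 2})
       = ennreal (min (x + s / 2) (y + h / 2) - max (x - s / 2) (y - h / 2))"
      by (rule emeasure_between) auto
    also have "min (x + s / 2) (y + h / 2) - max (x - s / 2) (y - h / 2) = (s + h - max \<bar>s - h\<bar> (2 * \<bar>x - y\<bar>)) / 2"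
      by (auto simp: min_def max_def abs_if)
    also have "ennreal (1 / s) * ennreal (1 / h) * ennreal (f y) * ennreal ((s + h - max \<bar>s - h\<bar> (2 * \<bar>x - y\<bar>)) / 2)
       = ennreal (1 / (2 * h * s)) * (ennreal (f y) * ennreal (s + h - max \<bar>s - h\<bar> (2 * \<bar>x - y\<bar>)))"
    proof -
      have "ennreal (1 / s) * ennreal (1 / h) * ennreal (f y) * ennreal (E / 2) = ennreal (1 / (2 * h * s)) * (ennreal (f y) * ennreal E)" for E
      proof (cases "0 \<le> E")
        case True
        then show ?thesis using s h f(2)[of y] by (simp add: ennreal_mult[symmetric] field_simps)
      next
        case False
        then have "ennreal (E / 2) = 0" "ennreal E = 0" by (auto simp: ennreal_eq_0_iff)
        then show ?thesis by simp
      qed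
      then show ?thesis .
    qed
    finally show "(\<integral>\<^sup>+t. ennreal (1 / s) * ennreal (1 / h) * (ennreal (f y) * (indicator {t - h / 2<..t + h / 2} y
        * indicator {x - s / 2<..x + s / 2} t)) \<partial>lborel)
      = ennreal (1 / (2 * h * s)) * (ennreal (f y) * ennreal (s + h - max \<bar>s - h\<bar> (2 * \<bar>x - y\<bar>)))" .
  qed
  \<comment> \<open>The same trapezoid is the measure of all u in the interval from |s - h| to s + h
    whose window around x contains y.\<close>
  also have "\<dots> = (\<integral>\<^sup>+y. (\<integral>\<^sup>+u. ennreal (1 / (2 * h * s)) * (ennreal (f y) * (indicator {x - u / 2<..x + u / 2} y
      * indicator {\<bar>s - h\<bar><..s + h} u)) \<partial>lborel) \<partial>lborel)"
  proof (intro nn_integral_cong)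
    fix y
    have "(\<integral>\<^sup>+u. ennreal (1 / (2 * h * s)) * (ennreal (f y) * (indicator {x - u / 2<..x + u / 2} y
        * indicator {\<bar>s - h\<bar><..s + h} u)) \<partial>lborel)
       = (\<integral>\<^sup>+u. ennreal (1 / (2 * h * s)) * ennreal (f y) * indicator ({\<bar>s - h\<bar><..s + h} \<inter> {2 * (x - y)<..} \<inter> {2 * (y - x)..}) u \<partial>lborel)"
      by (intro nn_integral_cong) (auto simp: indicator_def mult.assoc)
    also have "\<dots> = ennreal (1 / (2 * h * s)) * ennreal (f y) * emeasure lborel ({\<bar>s - h\<bar><..s + h} \<inter> {2 * (x - y)<..} \<inter> {2 * (y - x)..})"
      by (intro nn_integral_cmult_indicator) auto
    also have "emeasure lborel ({\<bar>s - h\<bar><..s + h} \<inter> {2 * (x - y)<..} \<inter> {2 * (y - x)..}) = ennreal (s + h - max \<bar>s - h\<bar> (2 * \<bar>x - y\<bar>))"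
      by (rule emeasure_between) (auto simp: abs_if split: if_splits)
    finally show "ennreal (1 / (2 * h * s)) * (ennreal (f y) * ennreal (s + h - max \<bar>s - h\<bar> (2 * \<bar>x - y\<bar>)))
       = (\<integral>\<^sup>+u. ennreal (1 / (2 * h * s)) * (ennreal (f y) * (indicator {x - u / 2<..x + u / 2} y
        * indicator {\<bar>s - h\<bar><..s + h} u)) \<partial>lborel)" by (simp add: mult.assoc)
  qed
  also have "\<dots> = (\<integral>\<^sup>+u. (\<integral>\<^sup>+y. ennreal (1 / (2 * h * s)) * (ennreal (f y) * (indicator {x - u / 2<..x + u / 2} y
      * indicator {\<bar>s - h\<bar><..s + h} u)) \<partial>lborel) \<partial>lborel)"
    by (rule lborel_pair.Fubini'[symmetric]) (unfold indicator_def greaterThanAtMost_iff, measurable)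
  also have "\<dots> = (\<integral>\<^sup>+u. ennreal (1 / (2 * h * s)) * ennreal (u * avg u f x) * indicator {\<bar>s - h\<bar><..s + h} u \<partial>lborel)"
  proof (intro nn_integral_cong)
    fix u
    show "(\<integral>\<^sup>+y. ennreal (1 / (2 * h * s)) * (ennreal (f y) * (indicator {x - u / 2<..x + u / 2} y
      * indicator {\<bar>s - h\<bar><..s + h} u)) \<partial>lborel) = ennreal (1 / (2 * h * s)) * ennreal (u * avg u f x) * indicator {\<bar>s - h\<bar><..s + h} u"
    proof (cases "u \<in> {\<bar>s - h\<bar><..s + h}")
      case True
      then have "0 < u" by auto
      then show ?thesis using True unfolding ennreal_avg[OF f \<open>0 < u\<close>]
        by (simp add: nn_integral_cmult[symmetric])
    qed simp
  qed
  finally show ?thesis .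
qed

section \<open>Boundedness of Steklov means and their powers\<close>

context weighted_orlicz
begin

section \<open>The Orlicz norm as a seminorm\<close>

abbreviation N :: "(real \<Rightarrow> real) \<Rightarrow> ennreal" where "N \<equiv> orlicz_norm \<phi> W"

lemmas N_eq = orlicz_norm_eq_SUP_dual_ball[of \<phi> W]

lemma pairing_le_N: "g \<in> dual_ball \<phi> W \<Longrightarrow> pairing W f g \<le> N f"
  unfolding N_eq by (rule SUP_upper)

lemma N_leI: "(\<And>g. g \<in> dual_ball \<phi> W \<Longrightarrow> pairing W f g \<le> B) \<Longrightarrow> N f \<le> B"
  unfolding N_eq by (rule SUP_least)

lemma pairing_mono_AE:
  assumes "AE x in lborel. x \<in> {0..2 * pi} \<longrightarrow> \<bar>f x\<bar> \<le> \<bar>h x\<bar>"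
  shows "pairing W f g \<le> pairing W h g"
  unfolding pairing_def
proof (rule nn_integral_mono_AE)
  show "AE x in lborel. ennreal (\<bar>f x * g x\<bar> * W x) * indicator {0..2 * pi} x
      \<le> ennreal (\<bar>h x * g x\<bar> * W x) * indicator {0..2 * pi} x"
    using assms
  proof eventually_elim
    case (elim x)
    then show ?case using W_pos[of x]
      by (cases "x \<in> {0..2 * pi}") (auto intro!: ennreal_leI mult_right_mono simp: abs_mult)
  qed
qed

lemma N_mono_AE: "AE x in lborel. x \<in> {0..2 * pi} \<longrightarrow> \<bar>f x\<bar> \<le> \<bar>h x\<bar> \<Longrightarrow> N f \<le> N h"
  using pairing_mono_AE[of f h] pairing_le_N by (intro N_leI) (blast intro: order_trans)

lemma N_mono: "(\<And>x. \<bar>f x\<bar> \<le> \<bar>h x\<bar>) \<Longrightarrow> N f \<le> N h"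
  by (rule N_mono_AE) auto

lemma dual_ball_meas: "g \<in> dual_ball \<phi> W \<Longrightarrow> g \<in> borel_measurable borel"
  by (simp add: dual_ball_def)

lemma pairing_cmult:
  assumes [measurable]: "f \<in> borel_measurable borel" and g: "g \<in> dual_ball \<phi> W"
  shows "pairing W (\<lambda>x. c * f x) g = ennreal \<bar>c\<bar> * pairing W f g"
proof -
  have [measurable]: "g \<in> borel_measurable borel" using g by (rule dual_ball_meas)
  have "ennreal (\<bar>c * f x * g x\<bar> * W x) = ennreal \<bar>c\<bar> * ennreal (\<bar>f x * g x\<bar> * W x)" for x
    using W_pos[of x] ennreal_mult[of "\<bar>c\<bar>" "\<bar>f x * g x\<bar> * W x"] by (simp add: abs_mult mult.assoc)
  then show ?thesis
    unfolding pairing_def by (subst nn_integral_cmult[symmetric]) (simp_all add: mult.assoc)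
qed

lemma N_cmult: "f \<in> borel_measurable borel \<Longrightarrow> N (\<lambda>x. c * f x) = ennreal \<bar>c\<bar> * N f"
  unfolding N_eq by (simp add: pairing_cmult SUP_mult_left_ennreal)

lemma pairing_suminf:
  assumes [measurable]: "\<And>i. F i \<in> borel_measurable borel" and g: "g \<in> dual_ball \<phi> W"
    and le: "\<And>x. ennreal \<bar>f x\<bar> \<le> (\<Sum>i. ennreal \<bar>F i x\<bar>)"
  shows "pairing W f g \<le> (\<Sum>i. pairing W (F i) g)"
proof -
  have [measurable]: "g \<in> borel_measurable borel" using g by (rule dual_ball_meas)
  have *: "ennreal (\<bar>h x * g x\<bar> * W x) * indicator {0..2 * pi} x
     = ennreal \<bar>h x\<bar> * (ennreal (\<bar>g x\<bar> * W x) * indicator {0..2 * pi} x)" for h x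
    using W_pos[of x] by (simp add: abs_mult ennreal_mult mult_ac)
  have "pairing W f g \<le> (\<integral>\<^sup>+x. (\<Sum>i. ennreal \<bar>F i x\<bar>) * (ennreal (\<bar>g x\<bar> * W x) * indicator {0..2 * pi} x) \<partial>lborel)"
    unfolding pairing_def * by (intro nn_integral_mono mult_right_mono le) auto
  also have "\<dots> = (\<integral>\<^sup>+x. (\<Sum>i. ennreal \<bar>F i x\<bar> * (ennreal (\<bar>g x\<bar> * W x) * indicator {0..2 * pi} x)) \<partial>lborel)"
    by simp
  also have "\<dots> = (\<Sum>i. pairing W (F i) g)"
    unfolding pairing_def * by (intro nn_integral_suminf) measurable
  finally show ?thesis .
qed

lemma N_suminf:
  assumes "\<And>i. F i \<in> borel_measurable borel" and "\<And>x. ennreal \<bar>f x\<bar> \<le> (\<Sum>i. ennreal \<bar>F i x\<bar>)"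
  shows "N f \<le> (\<Sum>i. N (F i))"
proof (rule N_leI)
  fix g assume g: "g \<in> dual_ball \<phi> W"
  have "pairing W f g \<le> (\<Sum>i. pairing W (F i) g)" using assms g by (intro pairing_suminf)
  also have "\<dots> \<le> (\<Sum>i. N (F i))" using g by (intro suminf_le pairing_le_N) auto
  finally show "pairing W f g \<le> (\<Sum>i. N (F i))" .
qed

lemma N_0: "N (\<lambda>x. 0) = 0"
  using N_cmult[of "\<lambda>x. 0" 0] by simp

lemma N_add:
  assumes "f \<in> borel_measurable borel" "h \<in> borel_measurable borel"
  shows "N (\<lambda>x. f x + h x) \<le> N f + N h"
proof -
  note [measurable] = assms
  show ?thesis
  proof (rule N_leI)
    fix g assume g: "g \<in> dual_ball \<phi> W"
    have [measurable]: "g \<in> borel_measurable borel" using g by (rule dual_ball_meas)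
    have "pairing W (\<lambda>x. f x + h x) g \<le> (\<integral>\<^sup>+x. ennreal (\<bar>f x * g x\<bar> * W x) * indicator {0..2 * pi} x
        + ennreal (\<bar>h x * g x\<bar> * W x) * indicator {0..2 * pi} x \<partial>lborel)"
      unfolding pairing_def
    proof (rule nn_integral_mono)
      fix x
      have "\<bar>(f x + h x) * g x\<bar> * W x \<le> \<bar>f x * g x\<bar> * W x + \<bar>h x * g x\<bar> * W x"
      proof -
        have "\<bar>(f x + h x) * g x\<bar> \<le> \<bar>f x * g x\<bar> + \<bar>h x * g x\<bar>"
          by (simp only: distrib_right abs_triangle_ineq)
        from mult_right_mono[OF this, of "W x"] show ?thesis using W_pos[of x] by (simp add: distrib_right)
      qed
      then have "ennreal (\<bar>(f x + h x) * g x\<bar> * W x) \<le> ennreal (\<bar>f x * g x\<bar> * W x) + ennreal (\<bar>h x * g x\<bar> * W x)"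
        using W_pos[of x] ennreal_leI by (simp add: ennreal_plus[symmetric] del: ennreal_plus)
      then show "ennreal (\<bar>(f x + h x) * g x\<bar> * W x) * indicator {0..2 * pi} x
        \<le> ennreal (\<bar>f x * g x\<bar> * W x) * indicator {0..2 * pi} x + ennreal (\<bar>h x * g x\<bar> * W x) * indicator {0..2 * pi} x"
        by (cases "x \<in> {0..2 * pi}") auto
    qed
    also have "\<dots> = pairing W f g + pairing W h g"
      unfolding pairing_def by (intro nn_integral_add) measurable
    also have "\<dots> \<le> N f + N h" using g by (intro add_mono pairing_le_N)
    finally show "pairing W (\<lambda>x. f x + h x) g \<le> N f + N h" .
  qed
qed

lemma N_sum:
  assumes "\<And>i. i \<in> I \<Longrightarrow> f i \<in> borel_measurable borel"
  shows "N (\<lambda>x. \<Sum>i\<in>I. f i x) \<le> (\<Sum>i\<in>I. N (f i))"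
  using assms
proof (induction I rule: infinite_finite_induct)
  case (insert i I)
  then have "N (\<lambda>x. f i x + (\<Sum>i\<in>I. f i x)) \<le> N (f i) + N (\<lambda>x. \<Sum>i\<in>I. f i x)"
    by (intro N_add borel_measurable_sum) auto
  also have "\<dots> \<le> N (f i) + (\<Sum>i\<in>I. N (f i))" using insert by (intro add_left_mono) auto
  finally show ?case using insert by simp
qed (auto simp: N_0)

text \<open>Young's inequality under the integral; 2 is the sum of the bound 1 for the modular of f
  and the bound 1 in the dual ball.\<close>

lemma N_le_2_of_modular:
  assumes [measurable]: "f \<in> borel_measurable borel" and m: "modular (\<lambda>x. \<bar>f x\<bar>) \<le> 1"
  shows "N f \<le> 2"
proof (rule N_leI)
  fix g assume g: "g \<in> dual_ball \<phi> W"
  have [measurable]: "g \<in> borel_measurable borel" using g by (rule dual_ball_meas)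
  have "pairing W f g \<le> (\<integral>\<^sup>+x. ennreal (\<phi> \<bar>f x\<bar> * W x) * indicator {0..2 * pi} x
      + compl_fun \<phi> \<bar>g x\<bar> * ennreal (W x) * indicator {0..2 * pi} x \<partial>lborel)"
    unfolding pairing_def
  proof (rule nn_integral_mono)
    fix x
    have "ennreal (\<bar>f x * g x\<bar> * W x) = ennreal (\<bar>f x\<bar> * \<bar>g x\<bar>) * ennreal (W x)"
      using W_pos[of x] by (simp add: ennreal_mult abs_mult)
    also have "\<dots> \<le> (ennreal (\<phi> \<bar>f x\<bar>) + compl_fun \<phi> \<bar>g x\<bar>) * ennreal (W x)"
      using young_fun_nonneg[OF \<phi>] by (intro mult_right_mono compl_fun_Young) auto
    also have "\<dots> = ennreal (\<phi> \<bar>f x\<bar> * W x) + compl_fun \<phi> \<bar>g x\<bar> * ennreal (W x)"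
      using W_pos[of x] young_fun_nonneg[OF \<phi>] by (simp add: distrib_right ennreal_mult)
    finally show "ennreal (\<bar>f x * g x\<bar> * W x) * indicator {0..2 * pi} x
      \<le> ennreal (\<phi> \<bar>f x\<bar> * W x) * indicator {0..2 * pi} x + compl_fun \<phi> \<bar>g x\<bar> * ennreal (W x) * indicator {0..2 * pi} x"
      by (cases "x \<in> {0..2 * pi}") auto
  qed
  also have "\<dots> = modular (\<lambda>x. \<bar>f x\<bar>) + (\<integral>\<^sup>+x\<in>{0..2 * pi}. compl_fun \<phi> \<bar>g x\<bar> * ennreal (W x) \<partial>lborel)"
    by (intro nn_integral_add) measurable
  also have "\<dots> \<le> 1 + 1" using m g by (intro add_mono) (auto simp: dual_ball_def)
  finally show "pairing W f g \<le> 2" by simp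
qed

text \<open>With \<Psi> = \<Phi>^q this bounds the complementary function at \<Psi>(x)/x, with a
  normalisation by \<open>\<rho>\<close>. For y \<le> x the linear term alone is at most
  \<Psi>(x)/\<rho>. For y > x, \<Psi>(y)/y dominates \<Psi>(x)/x by \<open>\<Psi>_scale\<close>, and
  \<phi> dominates \<Psi>, so the expression is at most 0.\<close>

lemma compl_fun_le_\<Phi>:
  assumes x: "0 < x" and \<rho>: "1 \<le> \<rho>"
  shows "compl_fun \<phi> (\<Phi> x powr q / x / \<rho>) \<le> ennreal (\<Phi> x powr q / \<rho>)"
  unfolding compl_fun_def
proof (rule SUP_least)
  fix y :: real assume "y \<in> {0..}"
  then have y: "0 \<le> y" by simp
  have "y * (\<Phi> x powr q / x / \<rho>) - \<phi> y \<le> \<Phi> x powr q / \<rho>"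
  proof (cases "y \<le> x")
    case True
    have "y * (\<Phi> x powr q / x / \<rho>) = (y / x) * (\<Phi> x powr q / \<rho>)" by simp
    also have "\<dots> \<le> 1 * (\<Phi> x powr q / \<rho>)" using True x \<rho> by (intro mult_right_mono) auto
    finally show ?thesis using young_fun_nonneg[OF \<phi>, of y] by simp
  next
    case False
    then have "\<Phi> ((x / y) * y) powr q \<le> (x / y) * \<Phi> y powr q" using x by (intro \<Psi>_scale) auto
    also have "\<dots> \<le> (x / y) * \<phi> y" using powr_le_\<phi>[OF y] x y by (intro mult_left_mono) auto
    finally have "y * (\<Phi> x powr q / x) \<le> \<phi> y" using False x by (simp add: field_simps)
    then have "y * (\<Phi> x powr q / x) / \<rho> \<le> \<phi> y / \<rho>" using \<rho> by (intro divide_right_mono) auto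
    also have "\<dots> \<le> \<phi> y" using \<rho> mult_left_mono[OF \<rho> young_fun_nonneg[OF \<phi>, of y]] by (simp add: divide_le_eq)
    finally have "y * (\<Phi> x powr q / x / \<rho>) - \<phi> y \<le> 0" by simp
    also have "0 \<le> \<Phi> x powr q / \<rho>" using \<rho> by simp
    finally show ?thesis .
  qed
  then show "ennreal (y * (\<Phi> x powr q / x / \<rho>) - \<phi> y) \<le> ennreal (\<Phi> x powr q / \<rho>)" by (rule ennreal_leI)
qed

lemma compl_fun_0: "compl_fun \<phi> 0 = 0"
  unfolding compl_fun_def using young_fun_nonneg[OF \<phi>] by (auto intro!: SUP_eqI simp: ennreal_neg)

abbreviation \<Psi>_modular :: "(real \<Rightarrow> real) \<Rightarrow> ennreal" where
  "\<Psi>_modular f \<equiv> \<integral>\<^sup>+x\<in>{0..2 * pi}. ennreal (\<Phi> \<bar>f x\<bar> powr q * W x) \<partial>lborel"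

text \<open>The test function is \<open>\<Psi>(|f|) / |f|\<close> with \<open>\<Psi> = \<Phi>\<^sup>q\<close>, divided by the modular if
  the latter exceeds 1.\<close>

lemma \<Psi>_modular_le_1_bounded:
  assumes [measurable]: "f \<in> borel_measurable borel" and b: "\<And>x. \<bar>f x\<bar> \<le> B" and N: "N f < 1"
  shows "\<Psi>_modular f \<le> 1"
proof (rule ccontr)
  assume not: "\<not> \<Psi>_modular f \<le> 1"
  \<comment> \<open>Boundedness of f makes the modular finite, so that it can serve as the divisor
    \<open>\<rho>\<close>. The test function then pairs with f to exactly 1, contradicting
    \<open>N f < 1\<close>.\<close>
  have "\<Psi>_modular f \<le> (\<integral>\<^sup>+x\<in>{0..2 * pi}. ennreal (\<Phi> B powr q * W x) \<partial>lborel)"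
    using b W_pos[THEN less_imp_le] young_fun_nonneg[OF \<Phi>(1)] q
    by (intro nn_integral_mono mult_right_mono ennreal_leI powr_mono2 young_fun_mono[OF \<Phi>(1)]) auto
  also have "\<dots> = ennreal (\<Phi> B powr q) * (\<integral>\<^sup>+x\<in>{0<..2 * pi}. ennreal (W x) \<partial>lborel)"
    unfolding nn_integral_Icc_Ioc using W_pos[THEN less_imp_le]
    by (subst nn_integral_cmult[symmetric]) (auto simp: ennreal_mult mult.assoc)
  finally have bd: "\<Psi>_modular f \<le> ennreal (\<Phi> B powr q) * (\<integral>\<^sup>+x\<in>{0<..2 * pi}. ennreal (W x) \<partial>lborel)" .
  have "(\<integral>\<^sup>+x\<in>{0<..2 * pi}. ennreal (W x) \<partial>lborel) = (\<integral>\<^sup>+x. ennreal (indicator {0<..2 * pi} x * W x) \<partial>lborel)"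
    by (intro nn_integral_cong) (auto simp: indicator_def)
  also have "\<dots> < \<infinity>"
    using W_int[of 0 "2 * pi"] W_pos[THEN less_imp_le] unfolding set_integrable_def
    by (subst nn_integral_eq_integral) auto
  finally have Wfin: "(\<integral>\<^sup>+x\<in>{0<..2 * pi}. ennreal (W x) \<partial>lborel) < \<infinity>" .
  have "ennreal (\<Phi> B powr q) * (\<integral>\<^sup>+x\<in>{0<..2 * pi}. ennreal (W x) \<partial>lborel) < \<infinity>"
    using Wfin by (simp add: ennreal_mult_less_top)
  with bd have fin: "\<Psi>_modular f < \<infinity>" by (rule le_less_trans)
  then obtain \<rho> where \<rho>: "\<Psi>_modular f = ennreal \<rho>" "0 \<le> \<rho>" by (cases "\<Psi>_modular f") auto
  with not have \<rho>1: "1 < \<rho>" by (simp add: ennreal_le_1)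
  define g where "g x = (if f x = 0 then 0 else \<Phi> \<bar>f x\<bar> powr q / \<bar>f x\<bar> / \<rho>)" for x
  have [measurable]: "g \<in> borel_measurable borel" unfolding g_def[abs_def] by measurable
  have g0: "0 \<le> g x" for x using \<rho> by (auto simp: g_def)
  have "(\<integral>\<^sup>+x\<in>{0..2 * pi}. compl_fun \<phi> \<bar>g x\<bar> * ennreal (W x) \<partial>lborel)
     \<le> (\<integral>\<^sup>+x. ennreal (1 / \<rho>) * (ennreal (\<Phi> \<bar>f x\<bar> powr q * W x) * indicator {0..2 * pi} x) \<partial>lborel)"
  proof (rule nn_integral_mono)
    fix x
    have "compl_fun \<phi> \<bar>g x\<bar> \<le> ennreal (\<Phi> \<bar>f x\<bar> powr q / \<rho>)"
      using compl_fun_le_\<Phi>[of "\<bar>f x\<bar>" \<rho>] \<rho>1 g0[of x] by (auto simp: g_def compl_fun_0)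
    then have "compl_fun \<phi> \<bar>g x\<bar> * ennreal (W x) \<le> ennreal (\<Phi> \<bar>f x\<bar> powr q / \<rho>) * ennreal (W x)"
      by (intro mult_right_mono) auto
    also have "\<dots> = ennreal (1 / \<rho>) * ennreal (\<Phi> \<bar>f x\<bar> powr q * W x)"
      using \<rho>1 W_pos[of x] by (simp add: ennreal_mult[symmetric])
    finally show "compl_fun \<phi> \<bar>g x\<bar> * ennreal (W x) * indicator {0..2 * pi} x
      \<le> ennreal (1 / \<rho>) * (ennreal (\<Phi> \<bar>f x\<bar> powr q * W x) * indicator {0..2 * pi} x)"
      by (cases "x \<in> {0..2 * pi}") auto
  qed
  also have "\<dots> = ennreal (1 / \<rho>) * \<Psi>_modular f" by (intro nn_integral_cmult) measurable
  also have "\<dots> = 1" using \<rho> \<rho>1 by (simp add: ennreal_mult[symmetric])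
  finally have "g \<in> dual_ball \<phi> W" by (simp add: dual_ball_def)
  then have "pairing W f g < 1" using N pairing_le_N le_less_trans by blast
  moreover have "pairing W f g = ennreal (1 / \<rho>) * \<Psi>_modular f"
    unfolding pairing_def
  proof (subst nn_integral_cmult[symmetric])
    show "(\<integral>\<^sup>+x\<in>{0..2 * pi}. ennreal (\<bar>f x * g x\<bar> * W x) \<partial>lborel)
      = (\<integral>\<^sup>+x. ennreal (1 / \<rho>) * (ennreal (\<Phi> \<bar>f x\<bar> powr q * W x) * indicator {0..2 * pi} x) \<partial>lborel)"
    proof (intro nn_integral_cong)
      fix x
      have "\<bar>f x * g x\<bar> * W x = 1 / \<rho> * (\<Phi> \<bar>f x\<bar> powr q * W x)"
        using \<rho>1 \<Phi>(1) by (auto simp: g_def abs_mult young_fun_def)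
      then show "ennreal (\<bar>f x * g x\<bar> * W x) * indicator {0..2 * pi} x
        = ennreal (1 / \<rho>) * (ennreal (\<Phi> \<bar>f x\<bar> powr q * W x) * indicator {0..2 * pi} x)"
        using \<rho>1 W_pos[of x] ennreal_mult[of "1 / \<rho>" "\<Phi> \<bar>f x\<bar> powr q * W x"] by (simp add: mult.assoc)
    qed
  qed measurable
  ultimately show False using \<rho> \<rho>1 by (simp add: ennreal_mult[symmetric])
qed

lemma \<Psi>_modular_le_1:
  assumes [measurable]: "f \<in> borel_measurable borel" and N: "N f < 1"
  shows "\<Psi>_modular f \<le> 1"
proof -
  define F where "F n x = (if \<bar>f x\<bar> \<le> real n then f x else 0)" for n :: nat and x
  have [measurable]: "F n \<in> borel_measurable borel" for n unfolding F_def[abs_def] by measurable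
  have \<Phi>0: "\<Phi> 0 = 0" using \<Phi>(1) by (simp add: young_fun_def)
  have le: "\<Psi>_modular (F n) \<le> 1" for n
  proof (rule \<Psi>_modular_le_1_bounded)
    show "\<bar>F n x\<bar> \<le> real n" for x by (auto simp: F_def)
    have "N (F n) \<le> N f" by (intro N_mono) (auto simp: F_def)
    then show "N (F n) < 1" using N by simp
  qed simp
  have "\<Psi>_modular f = (\<integral>\<^sup>+x. (SUP n. ennreal (\<Phi> \<bar>F n x\<bar> powr q * W x) * indicator {0..2 * pi} x) \<partial>lborel)"
  proof (intro nn_integral_cong)
    fix x
    obtain n where n: "\<bar>f x\<bar> \<le> real n" using real_arch_simple by blast
    show "ennreal (\<Phi> \<bar>f x\<bar> powr q * W x) * indicator {0..2 * pi} x
      = (SUP n. ennreal (\<Phi> \<bar>F n x\<bar> powr q * W x) * indicator {0..2 * pi} x)"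
    proof (rule antisym)
      show "ennreal (\<Phi> \<bar>f x\<bar> powr q * W x) * indicator {0..2 * pi} x
        \<le> (SUP n. ennreal (\<Phi> \<bar>F n x\<bar> powr q * W x) * indicator {0..2 * pi} x)"
        using n by (intro SUP_upper2[of n]) (auto simp: F_def)
    qed (auto intro!: SUP_least simp: F_def \<Phi>0)
  qed
  also have "\<dots> = (SUP n. \<Psi>_modular (F n))"
  proof (rule nn_integral_monotone_convergence_SUP)
    show "incseq (\<lambda>n x. ennreal (\<Phi> \<bar>F n x\<bar> powr q * W x) * indicator {0..2 * pi} x)"
      by (intro incseq_SucI le_funI) (auto simp: F_def \<Phi>0)
  qed measurable
  also have "\<dots> \<le> 1" using le by (intro SUP_least)
  finally show ?thesis .
qed

section \<open>From the modular inequality to norm inequalities\<close>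

text \<open>Each factor pays for one step of \<open>N_avg_abs\<close>: a \<open>C\<^sub>0\<close>
  for passing from \<Phi>^q to \<phi>, another in \<open>modular_avg\<close>, the third together
  with \<open>modular_const\<close> in \<open>modular_scale_down\<close>, and the 2 in
  \<open>N_le_2_of_modular\<close>.\<close>

definition norm_const :: real where "norm_const = 2 * C\<^sub>0 ^ 3 * modular_const"

lemma modular_const: "1 \<le> modular_const" by (simp add: modular_const_def)
lemma norm_const: "1 \<le> norm_const"
proof -
  have "1 \<le> C\<^sub>0 ^ 3" using C0 by simp
  then have "1 \<le> 2 * C\<^sub>0 ^ 3" by simp
  from mult_mono[OF this modular_const] this show ?thesis unfolding norm_const_def using C0 by simp
qed

text \<open>A modular need not be homogeneous, but \<Phi>^q satisfies \<Psi>(x/M) \<le> \<Psi>(x)/M.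
  Going from \<phi> to \<Phi>^q and back costs the additional divisor
  \<open>C\<^sub>0\<close>.\<close>

lemma modular_scale_down:
  assumes M: "1 \<le> M" and f: "\<And>x. 0 \<le> f x" and [measurable]: "f \<in> borel_measurable borel" and m: "modular f \<le> ennreal M"
  shows "modular (\<lambda>x. f x / (C\<^sub>0 * M)) \<le> 1"
proof -
  have "modular (\<lambda>x. f x / (C\<^sub>0 * M)) \<le> (\<integral>\<^sup>+x. ennreal (1 / M) * (ennreal (\<phi> (f x) * W x) * indicator {0..2 * pi} x) \<partial>lborel)"
  proof (rule nn_integral_mono)
    fix x
    have "\<phi> (f x / (C\<^sub>0 * M)) = \<phi> ((f x / M) / C\<^sub>0)" by (simp add: mult.commute)
    also have "\<dots> \<le> \<Phi> (f x / M) powr q" using f[of x] M by (intro \<phi>_le_powr) auto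
    also have "\<dots> \<le> 1 / M * \<Phi> (f x) powr q" using \<Psi>_scale[of "1 / M" "f x"] M by simp
    also have "\<dots> \<le> 1 / M * \<phi> (f x)" using powr_le_\<phi>[OF f[of x]] M by (intro mult_left_mono) auto
    finally have "ennreal (\<phi> (f x / (C\<^sub>0 * M)) * W x) \<le> ennreal (1 / M * \<phi> (f x) * W x)"
      using W_pos[of x] by (intro ennreal_leI mult_right_mono) auto
    also have "\<dots> = ennreal (1 / M) * ennreal (\<phi> (f x) * W x)"
      using M W_pos[of x] young_fun_nonneg[OF \<phi>] by (simp add: ennreal_mult[symmetric])
    finally show "ennreal (\<phi> (f x / (C\<^sub>0 * M)) * W x) * indicator {0..2 * pi} x
       \<le> ennreal (1 / M) * (ennreal (\<phi> (f x) * W x) * indicator {0..2 * pi} x)"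
      by (cases "x \<in> {0..2 * pi}") auto
  qed
  also have "\<dots> = ennreal (1 / M) * modular f" by (intro nn_integral_cmult) measurable
  also have "\<dots> \<le> ennreal (1 / M) * ennreal M" using m by (intro mult_left_mono) auto
  also have "\<dots> = 1" using M by (simp add: ennreal_mult[symmetric])
  finally show ?thesis .
qed

text \<open>For every real l above \<open>N f\<close>, the modular of |f|/(l C), with C the dilation
  constant, is at most 1; averaging, rescaling and Young's inequality then bound the norm of the
  mean. The absolute value under the mean makes it a majorant for operators with signed
  kernels.\<close>

theorem N_avg_abs:
  assumes f: "periodic_L1 f" and u: "0 < u"
  shows "N (avg u (\<lambda>x. \<bar>f x\<bar>)) \<le> ennreal norm_const * N f"
proof (rule ennreal_le_mult_by_scaling)
  show "0 < norm_const" using norm_const by simp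
  fix l :: real assume l: "0 < l" "N f < ennreal l"
  have [measurable]: "f \<in> borel_measurable borel" using f by (rule periodic_L1_meas)
  let ?F = "\<lambda>x. 1 / (l * C\<^sub>0) * \<bar>f x\<bar>" and ?S = "avg u (\<lambda>x. \<bar>f x\<bar>)"
  have "N (\<lambda>x. 1 / l * f x) = ennreal (1 / l) * N f" using l by (subst N_cmult) auto
  also have "\<dots> < ennreal (1 / l) * ennreal l" using l by (intro ennreal_mult_strict_left_mono) auto
  also have "\<dots> = 1" using l by (simp add: ennreal_mult[symmetric])
  finally have "\<Psi>_modular (\<lambda>x. 1 / l * f x) \<le> 1" by (intro \<Psi>_modular_le_1) auto
  moreover have "modular ?F \<le> \<Psi>_modular (\<lambda>x. 1 / l * f x)"
  proof (intro nn_integral_mono mult_right_mono ennreal_leI)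
    fix x
    have "\<phi> (\<bar>1 / l * f x\<bar> / C\<^sub>0) \<le> \<Phi> \<bar>1 / l * f x\<bar> powr q" by (rule \<phi>_le_powr) simp
    then show "\<phi> (?F x) \<le> \<Phi> \<bar>1 / l * f x\<bar> powr q" using l by (simp add: abs_mult)
  qed (use W_pos[THEN less_imp_le] in auto)
  ultimately have 1: "modular ?F \<le> 1" by (rule order_trans[rotated])
  have pF: "periodic_L1 ?F" by (intro periodic_L1_cmult periodic_L1_abs f)
  have S0: "0 \<le> ?S x" for x using u by (intro avg_nonneg) auto
  have [measurable]: "?S \<in> borel_measurable borel" by measurable
  have "modular (\<lambda>x. avg u ?F x / C\<^sub>0) \<le> ennreal modular_const * modular ?F"
    using l C0 u by (intro modular_avg pF) auto
  also have "\<dots> \<le> ennreal modular_const * 1" using 1 by (intro mult_left_mono) auto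
  finally have "modular (\<lambda>x. 1 / (l * C\<^sub>0) * ?S x / C\<^sub>0) \<le> ennreal modular_const" unfolding avg_cmult by simp
  then have "modular (\<lambda>x. (1 / (l * C\<^sub>0) * ?S x / C\<^sub>0) / (C\<^sub>0 * modular_const)) \<le> 1"
    using S0 l C0 modular_const by (intro modular_scale_down) auto
  also have "(\<lambda>x. (1 / (l * C\<^sub>0) * ?S x / C\<^sub>0) / (C\<^sub>0 * modular_const)) = (\<lambda>x. \<bar>1 / (l * C\<^sub>0 ^ 3 * modular_const) * ?S x\<bar>)"
    using S0 l C0 modular_const by (auto simp: fun_eq_iff power3_eq_cube abs_mult)
  finally have "N (\<lambda>x. 1 / (l * C\<^sub>0 ^ 3 * modular_const) * ?S x) \<le> 2"
    by (intro N_le_2_of_modular) auto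
  then have "ennreal (1 / (l * C\<^sub>0 ^ 3 * modular_const)) * N ?S \<le> 2"
    using l C0 modular_const by (subst (asm) N_cmult) auto
  then have "ennreal (l * C\<^sub>0 ^ 3 * modular_const) * (ennreal (1 / (l * C\<^sub>0 ^ 3 * modular_const)) * N ?S) \<le> ennreal (l * C\<^sub>0 ^ 3 * modular_const) * 2"
    by (intro mult_left_mono) auto
  also have "ennreal (l * C\<^sub>0 ^ 3 * modular_const) * (ennreal (1 / (l * C\<^sub>0 ^ 3 * modular_const)) * N ?S) = N ?S"
    using l C0 modular_const by (simp add: mult.assoc[symmetric] ennreal_mult[symmetric])
  also have "ennreal (l * C\<^sub>0 ^ 3 * modular_const) * 2 = ennreal (norm_const * l)"
    using l C0 modular_const by (simp add: norm_const_def ennreal_numeral[symmetric] ennreal_mult[symmetric] mult_ac del: ennreal_numeral)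
  finally show "N ?S \<le> ennreal (norm_const * l)" .
qed

text \<open>By \<open>avg_avg_mixture\<close>, composing the means of steps s and h integrates the
  means of step u against u du/(2hs) on the interval from |s - h| to s + h, a probability measure.
  With g fixed, pairing commutes with this integral by Tonelli, so the same B survives each step.
  The induction therefore runs over all s simultaneously and works with the pairing instead of the
  norm.\<close>

lemma pairing_avg_pow:
  assumes f: "periodic_L1 f" "\<And>x. 0 \<le> f x" and h: "0 < h" and g: "g \<in> dual_ball \<phi> W"
    and B: "\<And>u. 0 < u \<Longrightarrow> pairing W (avg u f) g \<le> B"
  shows "0 < s \<Longrightarrow> pairing W (avg s ((avg h ^^ j) f)) g \<le> B"
proof (induction j arbitrary: s)
  case 0
  then show ?case using B by simp
next
  case (Suc j)
  have [measurable]: "g \<in> borel_measurable borel" using g by (rule dual_ball_meas)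
  define F where "F = (avg h ^^ j) f"
  have F: "periodic_L1 F" "\<And>x. 0 \<le> F x" using f h by (auto simp: F_def intro: periodic_L1_avg_pow avg_pow_nonneg)
  have [measurable]: "F \<in> borel_measurable borel" using F by (auto simp: periodic_L1_def)
  define G where "G x = ennreal (\<bar>g x\<bar> * W x) * indicator {0..2 * pi} x" for x
  have [measurable]: "G \<in> borel_measurable borel" unfolding G_def[abs_def] by measurable
  have pair: "pairing W H g = (\<integral>\<^sup>+x. ennreal (H x) * G x \<partial>lborel)" if "\<And>x. 0 \<le> H x" for H
    unfolding pairing_def G_def using that W_pos[THEN less_imp_le]
    by (intro nn_integral_cong) (auto simp: abs_mult ennreal_mult mult.assoc)
  let ?I = "{\<bar>s - h\<bar><..s + h}"
  have [measurable]: "(\<lambda>(x, u). ennreal (u * avg u F x)) \<in> borel_measurable (borel \<Otimes>\<^sub>M borel)"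
    unfolding avg_eq indicator_def greaterThanAtMost_iff by measurable
  have "pairing W (avg s (avg h F)) g = (\<integral>\<^sup>+x. ennreal (avg s (avg h F) x) * G x \<partial>lborel)"
    using F Suc.prems h by (intro pair avg_nonneg)
  also have "\<dots> = (\<integral>\<^sup>+x. (\<integral>\<^sup>+u. ennreal (1 / (2 * h * s)) * ennreal (u * avg u F x) * indicator ?I u * G x \<partial>lborel) \<partial>lborel)"
    unfolding avg_avg_mixture[OF F Suc.prems h]
    by (intro nn_integral_cong nn_integral_multc[symmetric]) measurable
  also have "\<dots> = (\<integral>\<^sup>+u. (\<integral>\<^sup>+x. ennreal (1 / (2 * h * s)) * ennreal (u * avg u F x) * indicator ?I u * G x \<partial>lborel) \<partial>lborel)"
    by (rule lborel_pair.Fubini'[symmetric]) measurable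
  also have "\<dots> \<le> (\<integral>\<^sup>+u. ennreal (1 / (2 * h * s)) * B * (ennreal u * indicator {\<bar>s - h\<bar>..s + h} u) \<partial>lborel)"
  proof (rule nn_integral_mono)
    fix u
    show "(\<integral>\<^sup>+x. ennreal (1 / (2 * h * s)) * ennreal (u * avg u F x) * indicator ?I u * G x \<partial>lborel)
      \<le> ennreal (1 / (2 * h * s)) * B * (ennreal u * indicator {\<bar>s - h\<bar>..s + h} u)"
    proof (cases "u \<in> ?I")
      case True
      then have u: "0 < u" by auto
      have "(\<integral>\<^sup>+x. ennreal (1 / (2 * h * s)) * ennreal (u * avg u F x) * indicator ?I u * G x \<partial>lborel)
        = (\<integral>\<^sup>+x. ennreal (1 / (2 * h * s)) * ennreal u * (ennreal (avg u F x) * G x) \<partial>lborel)"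
        using True u avg_nonneg[of u F] F(2) by (intro nn_integral_cong) (simp add: ennreal_mult mult_ac)
      also have "\<dots> = ennreal (1 / (2 * h * s)) * ennreal u * pairing W (avg u F) g"
        using u F by (subst nn_integral_cmult) (auto simp: pair avg_nonneg)
      also have "\<dots> \<le> ennreal (1 / (2 * h * s)) * ennreal u * B"
        unfolding F_def by (intro mult_left_mono Suc.IH u) auto
      finally show ?thesis using True by (simp add: mult_ac)
    qed simp
  qed
  also have "\<dots> = ennreal (1 / (2 * h * s)) * B * (\<integral>\<^sup>+u. ennreal u * indicator {\<bar>s - h\<bar>..s + h} u \<partial>lborel)"
    by (intro nn_integral_cmult) measurable
  also have "(\<integral>\<^sup>+u. ennreal u * indicator {\<bar>s - h\<bar>..s + h} u \<partial>lborel) = ennreal ((s + h)\<^sup>2 / 2 - \<bar>s - h\<bar>\<^sup>2 / 2)"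
    using Suc.prems h
    by (intro nn_integral_FTC_Icc) (auto intro!: derivative_eq_intros)
  also have "(s + h)\<^sup>2 / 2 - \<bar>s - h\<bar>\<^sup>2 / 2 = 2 * h * s" by (simp add: power2_eq_square field_simps)
  also have "ennreal (1 / (2 * h * s)) * B * ennreal (2 * h * s) = B"
  proof -
    have "ennreal (1 / (2 * h * s)) * ennreal (2 * h * s) = 1"
      using Suc.prems h by (simp add: ennreal_mult[symmetric])
    then show ?thesis by (metis mult.assoc mult.commute mult_1)
  qed
  finally show ?case by (simp add: F_def)
qed

theorem N_avg_pow:
  assumes f: "periodic_L1 f" and h: "0 < h"
  shows "N ((avg h ^^ j) f) \<le> ennreal norm_const * N f"
proof (cases j)
  case 0
  have "1 * N f \<le> ennreal norm_const * N f" using norm_const by (intro mult_right_mono) (auto simp: ennreal_1[symmetric] simp del: ennreal_1 intro: ennreal_leI)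
  then show ?thesis using 0 by simp
next
  case (Suc i)
  have "pairing W ((avg h ^^ j) f) g \<le> ennreal norm_const * N f" if g: "g \<in> dual_ball \<phi> W" for g
  proof -
    have "\<bar>(avg h ^^ j) f x\<bar> \<le> \<bar>avg h ((avg h ^^ i) (\<lambda>x. \<bar>f x\<bar>)) x\<bar>" for x
      using avg_pow_abs[OF f h, of j x] by (simp add: Suc)
    then have "pairing W ((avg h ^^ j) f) g \<le> pairing W (avg h ((avg h ^^ i) (\<lambda>x. \<bar>f x\<bar>))) g"
      by (intro pairing_mono_AE) auto
    also have "\<dots> \<le> ennreal norm_const * N f"
      using order_trans[OF pairing_le_N[OF g] N_avg_abs[OF f]] h g
      by (intro pairing_avg_pow periodic_L1_abs f) auto
    finally show ?thesis .
  qed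
  then show ?thesis by (rule N_leI)
qed

end

section \<open>The kernel of the approximate inverse\<close>

text \<open>In terms of z = |x|/4 the claim follows from z \<le> sin(2z), which combines
  \<open>z * cos z \<le> sin z\<close> with (cos z)^2 \<ge> 1/2 for z \<le> pi/4. It is the lower
  bound for the factor 2 - 2 cos x produced by summation by parts.\<close>

lemma one_minus_cos_ge:
  assumes "\<bar>x\<bar> \<le> pi"
  shows "x\<^sup>2 / 4 \<le> 2 - 2 * cos x"
proof -
  define z where "z = \<bar>x\<bar> / 4"
  have z: "0 \<le> z" "z \<le> pi / 4" using assms by (auto simp: z_def)
  have 1: "z * cos z \<le> sin z"
  proof -
    have "sin 0 - 0 * cos 0 \<le> sin z - z * cos z"
    proof (rule DERIV_nonneg_imp_nondecreasing[OF z(1)])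
      fix t assume t: "0 \<le> t" "t \<le> z"
      have "((\<lambda>t. sin t - t * cos t) has_real_derivative t * sin t) (at t)"
        by (auto intro!: derivative_eq_intros)
      moreover have "0 \<le> t * sin t" using t z by (intro mult_nonneg_nonneg sin_ge_zero) auto
      ultimately show "\<exists>y. ((\<lambda>t. sin t - t * cos t) has_real_derivative y) (at t) \<and> 0 \<le> y" by blast
    qed
    then show ?thesis by simp
  qed
  have "cos (pi / 4) \<le> cos z" using z by (intro cos_monotone_0_pi_le) auto
  then have c: "1 / 2 \<le> (cos z)\<^sup>2" "0 \<le> cos z"
    using power_mono[of "cos (pi / 4)" "cos z" 2] cos_ge_zero[of z] z by (auto simp: cos_45 power_divide)
  have "2 * z * (1 / 2) \<le> 2 * z * (cos z)\<^sup>2" using c z by (intro mult_left_mono) auto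
  also have "\<dots> = 2 * (z * cos z) * cos z" by (simp add: power2_eq_square)
  also have "\<dots> \<le> 2 * sin z * cos z" using 1 c by (intro mult_right_mono mult_left_mono) auto
  also have "\<dots> = sin (2 * z)" by (simp add: sin_double)
  finally have "z \<le> sin (2 * z)" by simp
  then have "z\<^sup>2 \<le> (sin (2 * z))\<^sup>2" using z by (intro power_mono) auto
  moreover have "2 - 2 * cos x = 4 * (sin (2 * z))\<^sup>2"
  proof -
    have "cos x = cos (2 * (2 * z))" by (simp add: z_def)
    also have "\<dots> = 1 - 2 * (sin (2 * z))\<^sup>2" by (rule cos_double_sin)
    finally show ?thesis by simp
  qed
  moreover have "x\<^sup>2 / 4 = 4 * z\<^sup>2" by (simp add: z_def power_divide)
  ultimately show ?thesis by simp
qed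

text \<open>For x > 0 this is x^2 (1 - s(x)) with s(x) = sin(x/2)/(x/2); correspondingly the
  numerator 2 - 2 cos x of \<open>mult_symbol\<close> is x^2 s(x)^2. The suffixes \<open>_d1\<close>
  and \<open>_d2\<close> mark first and second derivatives.\<close>

definition mult_den :: "real \<Rightarrow> real" where "mult_den x = x\<^sup>2 - 2 * x * sin (x / 2)"
definition mult_den_d1 :: "real \<Rightarrow> real" where "mult_den_d1 x = 2 * x - 2 * sin (x / 2) - x * cos (x / 2)"
definition mult_den_d2 :: "real \<Rightarrow> real" where "mult_den_d2 x = 2 - 2 * cos (x / 2) + x / 2 * sin (x / 2)"

text \<open>With \<open>s(x) = sin (x/2) / (x/2)\<close>, the symbol of the Steklov mean of step 1,
  this is \<open>s(x)\<^sup>2 / (1 - s(x))\<close>.\<close>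

definition mult_symbol :: "real \<Rightarrow> real" where "mult_symbol x = (2 - 2 * cos x) / mult_den x"
definition mult_symbol_d1 :: "real \<Rightarrow> real" where "mult_symbol_d1 x = (2 * sin x * mult_den x - (2 - 2 * cos x) * mult_den_d1 x) / (mult_den x)\<^sup>2"
definition mult_symbol_d2 :: "real \<Rightarrow> real" where
  "mult_symbol_d2 x = (2 * cos x * mult_den x - (2 - 2 * cos x) * mult_den_d2 x) / (mult_den x)\<^sup>2
     - 2 * (2 * sin x * mult_den x - (2 - 2 * cos x) * mult_den_d1 x) * mult_den_d1 x / (mult_den x) ^ 3"

text \<open>With y = x/2 one needs y - sin y to be at least a multiple of y for y \<ge> 1/2. Up to y
  = 2 this holds because y - sin y is increasing and positive at 1/2, beyond it because sin y \<le>
  1 \<le> y/2.\<close>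

lemma mult_den_lower: "\<exists>d>0. \<forall>x\<ge>1. d * x\<^sup>2 \<le> mult_den x"
proof -
  define e :: real where "e = 1/2 - sin (1/2)"
  have e: "0 < e"
  proof -
    have pi: "(1/4::real) < pi / 2" using pi_gt3 by simp
    have "cos (1/4::real) < 1" using cos_monotone_0_pi[of 0 "1/4"] pi by simp
    moreover have "sin (1/4::real) * cos (1/4) \<le> 1/4 * cos (1/4)"
      using sin_x_le_x[of "1/4"] cos_ge_zero[of "1/4"] pi by (intro mult_right_mono) auto
    moreover have "sin (1/2::real) = 2 * sin (1/4) * cos (1/4)" using sin_double[of "1/4::real"] by simp
    ultimately show ?thesis unfolding e_def by linarith
  qed
  have mono: "e \<le> y - sin y" if "1/2 \<le> y" for y
  proof -
    have "1/2 - sin (1/2) \<le> y - sin y"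
    proof (rule DERIV_nonneg_imp_nondecreasing[OF that])
      fix t :: real
      show "\<exists>z. ((\<lambda>t. t - sin t) has_real_derivative z) (at t) \<and> 0 \<le> z"
        by (rule exI[of _ "1 - cos t"]) (auto intro!: derivative_eq_intros)
    qed
    then show ?thesis by (simp add: e_def)
  qed
  have bd: "min (e / 2) (1 / 2) * y \<le> y - sin y" if "1/2 \<le> y" for y
  proof (cases "y \<le> 2")
    case True
    have "min (e / 2) (1 / 2) * y \<le> e / 2 * 2" using True that e by (intro mult_mono) auto
    then show ?thesis using mono[OF that] by simp
  next
    case False
    have "min (e / 2) (1 / 2) * y \<le> 1 / 2 * y" using False by (intro mult_right_mono) auto
    then show ?thesis using False sin_le_one[of y] by linarith
  qed
  have "min (e / 2) (1 / 2) * x\<^sup>2 \<le> mult_den x" if "1 \<le> x" for x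
  proof -
    have "2 * x * (min (e / 2) (1 / 2) * (x / 2)) \<le> 2 * x * (x / 2 - sin (x / 2))"
      using bd[of "x / 2"] that by (intro mult_left_mono) auto
    then show ?thesis by (simp add: mult_den_def power2_eq_square algebra_simps)
  qed
  then show ?thesis using e by (intro exI[of _ "min (e / 2) (1 / 2)"]) auto
qed

lemma mult_den_pos: "1 \<le> x \<Longrightarrow> 0 < mult_den x"
proof -
  assume x: "1 \<le> x"
  obtain d where d: "d > 0" "\<And>x. 1 \<le> x \<Longrightarrow> d * x\<^sup>2 \<le> mult_den x" using mult_den_lower by blast
  have "0 < d * x\<^sup>2" using d(1) x by simp
  also have "\<dots> \<le> mult_den x" using d(2)[OF x] .
  finally show "0 < mult_den x" .
qed

lemma mult_den_deriv: "(mult_den has_real_derivative mult_den_d1 x) (at x)" "(mult_den_d1 has_real_derivative mult_den_d2 x) (at x)"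
  unfolding mult_den_def[abs_def] mult_den_d1_def[abs_def] mult_den_d2_def
  by (auto intro!: derivative_eq_intros simp: field_simps)

lemma mult_symbol_deriv:
  assumes "1 \<le> x"
  shows "(mult_symbol has_real_derivative mult_symbol_d1 x) (at x)" "(mult_symbol_d1 has_real_derivative mult_symbol_d2 x) (at x)"
proof -
  have d: "mult_den x \<noteq> 0" using mult_den_pos[OF assms] by simp
  show "(mult_symbol has_real_derivative mult_symbol_d1 x) (at x)"
    unfolding mult_symbol_def[abs_def] mult_symbol_d1_def using d
    by (auto intro!: derivative_eq_intros mult_den_deriv simp: power2_eq_square)
  define A B where "A = 2 * cos x * mult_den x - (2 - 2 * cos x) * mult_den_d2 x"
    and "B = 2 * sin x * mult_den x - (2 - 2 * cos x) * mult_den_d1 x"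
  have nB: "((\<lambda>x. 2 * sin x * mult_den x - (2 - 2 * cos x) * mult_den_d1 x) has_real_derivative A) (at x)"
    unfolding A_def by (rule derivative_eq_intros mult_den_deriv refl)+ (simp add: algebra_simps)
  have nD: "((\<lambda>x. (mult_den x)\<^sup>2) has_real_derivative 2 * mult_den x * mult_den_d1 x) (at x)"
    by (rule derivative_eq_intros mult_den_deriv refl)+ simp
  have "(mult_symbol_d1 has_real_derivative (A * (mult_den x)\<^sup>2 - B * (2 * mult_den x * mult_den_d1 x)) / ((mult_den x)\<^sup>2 * (mult_den x)\<^sup>2)) (at x)"
    unfolding mult_symbol_d1_def[abs_def] B_def using d by (intro DERIV_divide nB nD) simp
  moreover have "(A * (mult_den x)\<^sup>2 - B * (2 * mult_den x * mult_den_d1 x)) / ((mult_den x)\<^sup>2 * (mult_den x)\<^sup>2) = mult_symbol_d2 x"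
    unfolding mult_symbol_d2_def A_def[symmetric] B_def[symmetric]
    using d by (simp add: diff_divide_distrib power2_eq_square power3_eq_cube mult_ac)
  ultimately show "(mult_symbol_d1 has_real_derivative mult_symbol_d2 x) (at x)" by simp
qed

text \<open>The symbol and its second derivative need the decay x^(-2), since both are summed over x
  = m/n. The first derivative enters only at the corner x = 1, where boundedness suffices.\<close>

lemma mult_symbol_bounds: "\<exists>c>0. \<forall>x\<ge>1. \<bar>mult_symbol x\<bar> \<le> c / x\<^sup>2 \<and> \<bar>mult_symbol_d1 x\<bar> \<le> c \<and> \<bar>mult_symbol_d2 x\<bar> \<le> c / x\<^sup>2"
proof -
  obtain d where d: "d > 0" "\<And>x. 1 \<le> x \<Longrightarrow> d * x\<^sup>2 \<le> mult_den x" using mult_den_lower by blast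
  \<comment> \<open>The numbers come from |2 - 2 cos x| \<le> 4, from \<open>mult_den x\<close>
    \<le> 3 x^2 and from the bound 5 x for its two derivatives: 26 = 2 * 3 + 4 * 5 bounds both
    numerators, and 260 = 2 * 26 * 5.\<close>
  have dd: "0 < 4 / d" "0 < 26 / d\<^sup>2" "0 < 260 / d ^ 3" using d by auto
  define c where "c = 4 / d + 26 / d\<^sup>2 + 260 / d ^ 3"
  have c: "0 < c" "4 / d \<le> c" "26 / d\<^sup>2 \<le> c" "26 / d\<^sup>2 + 260 / d ^ 3 \<le> c" unfolding c_def using dd by linarith+
  have "\<bar>mult_symbol x\<bar> \<le> c / x\<^sup>2 \<and> \<bar>mult_symbol_d1 x\<bar> \<le> c \<and> \<bar>mult_symbol_d2 x\<bar> \<le> c / x\<^sup>2" if x: "1 \<le> x" for x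
  proof -
    have xx: "x \<le> x\<^sup>2" "1 \<le> x\<^sup>2" using x using self_le_power[of x 2] one_le_power[of x 2] by auto
    have dp: "0 < mult_den x" using mult_den_pos[OF x] .
    have N: "\<bar>2 - 2 * cos x\<bar> \<le> 4" using cos_ge_minus_one[of x] cos_le_one[of x] unfolding abs_le_iff by linarith
    have N1: "\<bar>2 * sin x\<bar> \<le> 2" "\<bar>2 * cos x\<bar> \<le> 2" by (auto simp: abs_mult)
    have xs: "\<bar>x * sin (x / 2)\<bar> \<le> x" "\<bar>x * cos (x / 2)\<bar> \<le> x"
      using x mult_left_mono[OF abs_sin_le_one[of "x/2"], of x] mult_left_mono[OF abs_cos_le_one[of "x/2"], of x] by (auto simp: abs_mult)
    have D0: "\<bar>mult_den x\<bar> \<le> 3 * x\<^sup>2" using xs xx unfolding mult_den_def abs_le_iff by (auto simp: mult.assoc)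
    have D1: "\<bar>mult_den_d1 x\<bar> \<le> 5 * x" using xs x sin_le_one[of "x/2"] sin_ge_minus_one[of "x/2"] unfolding mult_den_d1_def abs_le_iff by linarith
    have D2: "\<bar>mult_den_d2 x\<bar> \<le> 5 * x" using xs x cos_le_one[of "x/2"] cos_ge_minus_one[of "x/2"] unfolding mult_den_d2_def abs_le_iff by linarith
    have dx: "0 < d * x\<^sup>2" using d x by simp
    have dx2: "(d * x\<^sup>2)\<^sup>2 \<le> (mult_den x)\<^sup>2" "(d * x\<^sup>2) ^ 3 \<le> (mult_den x) ^ 3"
      using d(2)[OF x] dx by (auto intro!: power_mono)
    have A: "\<bar>2 * sin x * mult_den x - (2 - 2 * cos x) * mult_den_d1 x\<bar> \<le> 26 * x\<^sup>2"
    proof -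
      have "\<bar>2 * sin x * mult_den x - (2 - 2 * cos x) * mult_den_d1 x\<bar> \<le> \<bar>2 * sin x * mult_den x\<bar> + \<bar>(2 - 2 * cos x) * mult_den_d1 x\<bar>" by (rule abs_triangle_ineq4)
      also have "\<dots> = \<bar>2 * sin x\<bar> * \<bar>mult_den x\<bar> + \<bar>2 - 2 * cos x\<bar> * \<bar>mult_den_d1 x\<bar>" by (simp only: abs_mult)
      also have "\<dots> \<le> 2 * (3 * x\<^sup>2) + 4 * (5 * x)" using N N1 D0 D1 by (intro add_mono mult_mono) auto
      finally show ?thesis using xx by simp
    qed
    have B: "\<bar>2 * cos x * mult_den x - (2 - 2 * cos x) * mult_den_d2 x\<bar> \<le> 26 * x\<^sup>2"
    proof -
      have "\<bar>2 * cos x * mult_den x - (2 - 2 * cos x) * mult_den_d2 x\<bar> \<le> \<bar>2 * cos x * mult_den x\<bar> + \<bar>(2 - 2 * cos x) * mult_den_d2 x\<bar>" by (rule abs_triangle_ineq4)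
      also have "\<dots> = \<bar>2 * cos x\<bar> * \<bar>mult_den x\<bar> + \<bar>2 - 2 * cos x\<bar> * \<bar>mult_den_d2 x\<bar>" by (simp only: abs_mult)
      also have "\<dots> \<le> 2 * (3 * x\<^sup>2) + 4 * (5 * x)" using N N1 D0 D2 by (intro add_mono mult_mono) auto
      finally show ?thesis using xx by simp
    qed
    have "\<bar>mult_symbol x\<bar> \<le> 4 / (d * x\<^sup>2)"
      unfolding mult_symbol_def abs_divide using N d(2)[OF x] dp dx by (intro frac_le) auto
    also have "\<dots> = (4 / d) / x\<^sup>2" by simp
    also have "\<dots> \<le> c / x\<^sup>2" using c by (intro divide_right_mono) auto
    finally have 1: "\<bar>mult_symbol x\<bar> \<le> c / x\<^sup>2" .
    have A2: "\<bar>2 * sin x * mult_den x - (2 - 2 * cos x) * mult_den_d1 x\<bar> / (mult_den x)\<^sup>2 \<le> 26 * x\<^sup>2 / (d * x\<^sup>2)\<^sup>2"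
      using A dx2 dx by (intro frac_le) auto
    have B2: "\<bar>2 * cos x * mult_den x - (2 - 2 * cos x) * mult_den_d2 x\<bar> / (mult_den x)\<^sup>2 \<le> 26 * x\<^sup>2 / (d * x\<^sup>2)\<^sup>2"
      using B dx2 dx by (intro frac_le) auto
    have eq: "26 * x\<^sup>2 / (d * x\<^sup>2)\<^sup>2 = (26 / d\<^sup>2) / x\<^sup>2" using x d by (simp add: field_simps power2_eq_square)
    have "\<bar>mult_symbol_d1 x\<bar> \<le> (26 / d\<^sup>2) / x\<^sup>2" unfolding mult_symbol_d1_def abs_divide eq[symmetric] using A2 by simp
    also have "\<dots> \<le> (26 / d\<^sup>2) / 1" using xx x d by (intro divide_left_mono) auto
    finally have 2: "\<bar>mult_symbol_d1 x\<bar> \<le> c" using c by simp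
    have C2: "\<bar>2 * (2 * sin x * mult_den x - (2 - 2 * cos x) * mult_den_d1 x) * mult_den_d1 x\<bar> / (mult_den x) ^ 3 \<le> 2 * (26 * x\<^sup>2) * (5 * x) / (d * x\<^sup>2) ^ 3"
    proof (intro frac_le)
      have "\<bar>2 * (2 * sin x * mult_den x - (2 - 2 * cos x) * mult_den_d1 x) * mult_den_d1 x\<bar>
        = 2 * \<bar>2 * sin x * mult_den x - (2 - 2 * cos x) * mult_den_d1 x\<bar> * \<bar>mult_den_d1 x\<bar>" by (simp only: abs_mult abs_numeral)
      also have "\<dots> \<le> 2 * (26 * x\<^sup>2) * (5 * x)" using A D1 x by (intro mult_mono) auto
      finally show "\<bar>2 * (2 * sin x * mult_den x - (2 - 2 * cos x) * mult_den_d1 x) * mult_den_d1 x\<bar> \<le> 2 * (26 * x\<^sup>2) * (5 * x)" .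
    qed (use dx dx2 x in auto)
    have "2 * (26 * x\<^sup>2) * (5 * x) / (d * x\<^sup>2) ^ 3 = (260 / d ^ 3) / x ^ 3"
      using x d by (simp add: field_simps power2_eq_square power3_eq_cube)
    also have "\<dots> \<le> (260 / d ^ 3) / x\<^sup>2" using x d by (intro divide_left_mono power_increasing) auto
    finally have eq3: "2 * (26 * x\<^sup>2) * (5 * x) / (d * x\<^sup>2) ^ 3 \<le> (260 / d ^ 3) / x\<^sup>2" .
    have "\<bar>mult_symbol_d2 x\<bar> \<le> \<bar>2 * cos x * mult_den x - (2 - 2 * cos x) * mult_den_d2 x\<bar> / (mult_den x)\<^sup>2
       + \<bar>2 * (2 * sin x * mult_den x - (2 - 2 * cos x) * mult_den_d1 x) * mult_den_d1 x\<bar> / (mult_den x) ^ 3"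
    proof -
      have "\<bar>(mult_den x)\<^sup>2\<bar> = (mult_den x)\<^sup>2" "\<bar>(mult_den x) ^ 3\<bar> = (mult_den x) ^ 3" using dp by auto
      then show ?thesis unfolding mult_symbol_d2_def
        using abs_triangle_ineq4[of "(2 * cos x * mult_den x - (2 - 2 * cos x) * mult_den_d2 x) / (mult_den x)\<^sup>2"
          "2 * (2 * sin x * mult_den x - (2 - 2 * cos x) * mult_den_d1 x) * mult_den_d1 x / (mult_den x) ^ 3"]
        by (simp only: abs_divide)
    qed
    also have "\<dots> \<le> (26 / d\<^sup>2) / x\<^sup>2 + (260 / d ^ 3) / x\<^sup>2" using B2 C2 eq eq3 by linarith
    also have "\<dots> = (26 / d\<^sup>2 + 260 / d ^ 3) / x\<^sup>2" by (simp add: add_divide_distrib)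
    also have "\<dots> \<le> c / x\<^sup>2" using c by (intro divide_right_mono) auto
    finally show ?thesis using 1 2 by blast
  qed
  then show ?thesis using c(1) by blast
qed

text \<open>The intermediate points of the two first-order mean value steps are at most 2 t apart,
  whence the factor 2.\<close>

lemma second_difference_bound:
  fixes f f1 f2 :: "real \<Rightarrow> real"
  assumes t: "0 < t" and d1: "\<And>y. x - t \<le> y \<Longrightarrow> y \<le> x + t \<Longrightarrow> (f has_real_derivative f1 y) (at y)"
    and d2: "\<And>y. x - t \<le> y \<Longrightarrow> y \<le> x + t \<Longrightarrow> (f1 has_real_derivative f2 y) (at y)"
    and B: "\<And>y. x - t \<le> y \<Longrightarrow> y \<le> x + t \<Longrightarrow> \<bar>f2 y\<bar> \<le> B"
  shows "\<bar>f (x + t) - 2 * f x + f (x - t)\<bar> \<le> 2 * t\<^sup>2 * B"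
proof -
  obtain u where u: "x < u" "u < x + t" "f (x + t) - f x = (x + t - x) * f1 u"
    using MVT2[of x "x + t" f f1] t d1 by force
  obtain v where v: "x - t < v" "v < x" "f x - f (x - t) = (x - (x - t)) * f1 v"
    using MVT2[of "x - t" x f f1] t d1 by force
  obtain w where w: "v < w" "w < u" "f1 u - f1 v = (u - v) * f2 w"
    using MVT2[of v u f1 f2] u v d2 by force
  have "f (x + t) - 2 * f x + f (x - t) = t * ((u - v) * f2 w)"
  proof -
    have "f (x + t) - 2 * f x + f (x - t) = (f (x + t) - f x) - (f x - f (x - t))" by simp
    also have "\<dots> = t * (f1 u - f1 v)" unfolding u(3) v(3) by (simp add: algebra_simps)
    finally show ?thesis unfolding w(3) .
  qed
  also have "\<bar>\<dots>\<bar> \<le> t * (2 * t * B)"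
    unfolding abs_mult using u v w t B[of w] by (intro mult_mono) (auto intro: order_trans[of 0 "\<bar>f2 w\<bar>"])
  finally show ?thesis by (simp add: power2_eq_square)
qed

text \<open>Frozen at the value for x = 1 up to frequency n, because \<open>mult_symbol\<close> is
  singular at 0. The price is a corner at m = n, where one second difference is only of order
  1/n.\<close>

definition mult_coeff :: "nat \<Rightarrow> nat \<Rightarrow> real" where
  "mult_coeff n m = mult_symbol (max 1 (real m / real n))"

definition mult_coeff_diff2 :: "nat \<Rightarrow> nat \<Rightarrow> real" where
  "mult_coeff_diff2 n m = mult_coeff n (m + 2) - 2 * mult_coeff n (m + 1) + mult_coeff n m"

lemma sum_inverse_squares_le:
  assumes "1 \<le> n"
  shows "(\<Sum>m<M. if n < m then 1 / (real m)\<^sup>2 else 0) \<le> 1 / real n"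
proof -
  \<comment> \<open>The bound is strengthened to the telescoped value coming from 1/m^2 \<le>
    1/(m-1) - 1/m, which makes the induction on M work.\<close>
  have "(\<Sum>m<M. if n < m then 1 / (real m)\<^sup>2 else 0) \<le> (if n < M then 1 / real n - 1 / real (M - 1) else 0)"
  proof (induction M)
    case (Suc M)
    show ?case
    proof (cases "n < M")
      case True
      then obtain K where K: "M = Suc K" "1 \<le> K" "n \<le> K" using assms by (cases M) auto
      have "1 / (real M)\<^sup>2 \<le> 1 / (real K * real M)"
        using K by (intro divide_left_mono) (auto simp: power2_eq_square intro!: mult_right_mono)
      also have "\<dots> = 1 / real K - 1 / real M"
        using K by (simp add: divide_simps)
      finally show ?thesis using Suc True K by simp
    next
      case False
      then have "(\<Sum>m<Suc M. if n < m then 1 / (real m)\<^sup>2 else 0) \<le> 0" using Suc by simp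
      moreover have "n < Suc M \<Longrightarrow> n = M" using False by simp
      ultimately show ?thesis by auto
    qed
  qed simp
  also have "\<dots> \<le> 1 / real n" by simp
  finally show ?thesis .
qed

text \<open>About n coefficients are of order 1, and the others, of order n^2/m^2, sum to order n.
  The second differences vanish below n - 1, are of order 1/n at the corner n - 1, and from n on are
  of order (1/n^2)(n/m)^2 = 1/m^2, which sums to order 1/n.\<close>

lemma mult_coeff_bounds: "\<exists>c>0. \<forall>n\<ge>1. \<forall>M. (\<Sum>m<M. \<bar>mult_coeff n m\<bar>) \<le> c * real n \<and> (\<Sum>m<M. \<bar>mult_coeff_diff2 n m\<bar>) \<le> c / real n"
proof -
  obtain c where c: "c > 0" "\<And>x. 1 \<le> x \<Longrightarrow> \<bar>mult_symbol x\<bar> \<le> c / x\<^sup>2" "\<And>x. 1 \<le> x \<Longrightarrow> \<bar>mult_symbol_d1 x\<bar> \<le> c"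
    "\<And>x. 1 \<le> x \<Longrightarrow> \<bar>mult_symbol_d2 x\<bar> \<le> c / x\<^sup>2"
    using mult_symbol_bounds by blast
  have "(\<Sum>m<M. \<bar>mult_coeff n m\<bar>) \<le> 5 * c * real n \<and> (\<Sum>m<M. \<bar>mult_coeff_diff2 n m\<bar>) \<le> 5 * c / real n" if n: "1 \<le> n" for n M
  proof
    have rn: "1 \<le> real n" using n by simp
    have "\<bar>mult_coeff n m\<bar> \<le> (if m \<in> {..n} then c else 0) + c * (real n)\<^sup>2 * (if n < m then 1 / (real m)\<^sup>2 else 0)" for m
    proof (cases "n < m")
      case True
      then have "1 \<le> real m / real n" using n by simp
      then show ?thesis using c(2)[of "real m / real n"] True by (simp add: mult_coeff_def power_divide)
    next
      case False
      then have "max 1 (real m / real n) = 1" using n by simp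
      then show ?thesis using c(2)[of 1] False by (simp add: mult_coeff_def)
    qed
    then have "(\<Sum>m<M. \<bar>mult_coeff n m\<bar>) \<le> (\<Sum>m<M. (if m \<in> {..n} then c else 0) + c * (real n)\<^sup>2 * (if n < m then 1 / (real m)\<^sup>2 else 0))"
      by (intro sum_mono)
    also have "\<dots> = (\<Sum>m\<in>{..<M} \<inter> {..n}. c) + c * (real n)\<^sup>2 * (\<Sum>m<M. if n < m then 1 / (real m)\<^sup>2 else 0)"
      by (simp only: sum.distrib sum_distrib_left sum.inter_restrict finite_lessThan)
    also have "\<dots> \<le> (\<Sum>m\<in>{..n}. c) + c * (real n)\<^sup>2 * (1 / real n)"
      using c(1) n by (intro add_mono mult_left_mono sum_inverse_squares_le sum_mono2) auto
    also have "\<dots> \<le> 5 * c * real n"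
      using c(1) rn by (simp add: power2_eq_square algebra_simps) 
    finally show "(\<Sum>m<M. \<bar>mult_coeff n m\<bar>) \<le> 5 * c * real n" .
    have "\<bar>mult_coeff_diff2 n m\<bar> \<le> (if m = n - 1 then c / real n else 0) + (if m = n then 2 * c / (real n)\<^sup>2 else 0)
        + 2 * c * (if n < m then 1 / (real m)\<^sup>2 else 0)" for m
    proof (cases "n \<le> m")
      case True
      let ?x = "real (m + 1) / real n" and ?t = "1 / real n"
      have xt: "?x + ?t = real (m + 2) / real n" "?x - ?t = real m / real n"
        by (simp_all add: add_divide_distrib[symmetric] diff_divide_distrib[symmetric])
      have ge1: "1 \<le> real m / real n" "1 \<le> real (m + 1) / real n" "1 \<le> real (m + 2) / real n" using True n by (auto simp: field_simps)
      have "\<bar>mult_symbol (?x + ?t) - 2 * mult_symbol ?x + mult_symbol (?x - ?t)\<bar> \<le> 2 * ?t\<^sup>2 * (c / (real m / real n)\<^sup>2)"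
      proof (rule second_difference_bound[of _ _ _ mult_symbol_d1 mult_symbol_d2])
        fix y assume "?x - ?t \<le> y"
        then have y: "1 \<le> y" "real m / real n \<le> y" using ge1 unfolding xt by auto
        show "(mult_symbol has_real_derivative mult_symbol_d1 y) (at y)" "(mult_symbol_d1 has_real_derivative mult_symbol_d2 y) (at y)"
          using mult_symbol_deriv y by auto
        have mp: "0 < real m / real n" using ge1 by linarith
        have "\<bar>mult_symbol_d2 y\<bar> \<le> c / y\<^sup>2" using c y by auto
        also have "\<dots> \<le> c / (real m / real n)\<^sup>2" using y(2) mp c(1) by (intro divide_left_mono power_mono mult_pos_pos zero_less_power) linarith+
        finally show "\<bar>mult_symbol_d2 y\<bar> \<le> c / (real m / real n)\<^sup>2" .
      qed (use n in auto)
      also have "2 * ?t\<^sup>2 * (c / (real m / real n)\<^sup>2) = 2 * c * (1 / (real m)\<^sup>2)"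
        using n True by (simp add: field_simps)
      finally have "\<bar>mult_coeff_diff2 n m\<bar> \<le> 2 * c * (1 / (real m)\<^sup>2)"
        unfolding xt mult_coeff_diff2_def mult_coeff_def using ge1 by (simp add: max_absorb2)
      then show ?thesis using True c(1) n by (cases "m = n") auto
    next
      case False
      show ?thesis
      proof (cases "m = n - 1")
        case True
        have m2: "real (m + 2) / real n = 1 + 1 / real n" using True n by (simp add: field_simps of_nat_diff)
        obtain z where z: "1 < z" "mult_symbol (1 + 1 / real n) - mult_symbol 1 = (1 + 1 / real n - 1) * mult_symbol_d1 z"
          using MVT2[of 1 "1 + 1 / real n" mult_symbol mult_symbol_d1] n mult_symbol_deriv(1) by force
        have "mult_coeff_diff2 n m = mult_symbol (1 + 1 / real n) - mult_symbol 1"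
          using True n m2 unfolding mult_coeff_diff2_def mult_coeff_def by (simp add: max_def)
        also have "\<bar>\<dots>\<bar> = \<bar>mult_symbol_d1 z\<bar> / real n" unfolding z(2) by simp
        also have "\<dots> \<le> c / real n" using c(3)[of z] z by (intro divide_right_mono) auto
        finally show ?thesis using True n by (simp add: add_increasing2)
      next
        case F: False
        have *: "mult_coeff n j = mult_symbol 1" if "j \<le> n" for j using that n by (simp add: mult_coeff_def max_def)
        have "mult_coeff_diff2 n m = 0" using F False by (simp add: mult_coeff_diff2_def *)
        then show ?thesis using c(1) by simp
      qed
    qed
    then have "(\<Sum>m<M. \<bar>mult_coeff_diff2 n m\<bar>) \<le> (\<Sum>m<M. (if m = n - 1 then c / real n else 0) + (if m = n then 2 * c / (real n)\<^sup>2 else 0)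
        + 2 * c * (if n < m then 1 / (real m)\<^sup>2 else 0))"
      by (intro sum_mono)
    also have "\<dots> = (\<Sum>m<M. if m = n - 1 then c / real n else 0) + (\<Sum>m<M. if m = n then 2 * c / (real n)\<^sup>2 else 0)
        + 2 * c * (\<Sum>m<M. if n < m then 1 / (real m)\<^sup>2 else 0)"
      by (simp only: sum.distrib sum_distrib_left)
    also have "\<dots> \<le> c / real n + 2 * c / (real n)\<^sup>2 + 2 * c * (1 / real n)"
      using c(1) n by (intro add_mono mult_left_mono sum_inverse_squares_le) auto
    also have "\<dots> \<le> c / real n + 2 * c / real n + 2 * c / real n"
      using c(1) rn by (intro add_mono divide_left_mono) (auto simp: power2_eq_square)
    also have "\<dots> = 5 * c / real n" by (simp add: add_divide_distrib[symmetric])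
    finally show "(\<Sum>m<M. \<bar>mult_coeff_diff2 n m\<bar>) \<le> 5 * c / real n" .
  qed
  then show ?thesis using c(1) by (intro exI[of _ "5 * c"]) auto
qed

section \<open>Cosine series and summation by parts\<close>

definition cos_series :: "(nat \<Rightarrow> real) \<Rightarrow> real \<Rightarrow> real" where
  "cos_series c x = (\<Sum>m. c m * cos (real m * x))"

lemma summable_cos_series: "summable (\<lambda>m. \<bar>c m\<bar>) \<Longrightarrow> summable (\<lambda>m. \<bar>c m * cos (real m * x)\<bar>)"
  by (rule summable_comparison_test[of _ "\<lambda>m. \<bar>c m\<bar>"]) (auto simp: abs_mult mult_left_le)

lemma summable_cser': "summable (\<lambda>m. \<bar>c m\<bar>) \<Longrightarrow> summable (\<lambda>m. c m * cos (real m * x))"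
  by (rule summable_rabs_cancel[OF summable_cos_series])

lemma cos_series_abs_le: "summable (\<lambda>m. \<bar>c m\<bar>) \<Longrightarrow> \<bar>cos_series c x\<bar> \<le> (\<Sum>m. \<bar>c m\<bar>)"
proof -
  assume s: "summable (\<lambda>m. \<bar>c m\<bar>)"
  have "\<bar>cos_series c x\<bar> \<le> (\<Sum>m. \<bar>c m * cos (real m * x)\<bar>)"
    unfolding cos_series_def by (rule summable_rabs[OF summable_cos_series[OF s]])
  also have "\<dots> \<le> (\<Sum>m. \<bar>c m\<bar>)"
    by (intro suminf_le summable_cos_series s) (auto simp: abs_mult mult_left_le)
  finally show ?thesis .
qed

lemma continuous_cos_series: "summable (\<lambda>m. \<bar>c m\<bar>) \<Longrightarrow> continuous_on UNIV (cos_series c)"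
proof -
  assume s: "summable (\<lambda>m. \<bar>c m\<bar>)"
  have "uniform_limit UNIV (\<lambda>n x. \<Sum>m<n. c m * cos (real m * x)) (cos_series c) sequentially"
    unfolding cos_series_def[abs_def]
    by (rule Weierstrass_m_test[OF _ s]) (auto simp: abs_mult mult_left_le)
  then show ?thesis
    by (rule uniform_limit_theorem[rotated]) (auto intro!: continuous_intros always_eventually)
qed

lemma cos_series_even: "cos_series c (- x) = cos_series c x"
  by (simp add: cos_series_def)

lemma periodic_cos_series: "periodic (cos_series c)"
proof -
  have "periodic (cos :: real \<Rightarrow> real)" by (simp add: periodic_def)
  then have "cos (real m * (x + 2 * pi)) = cos (real m * x)" for m x
    using periodic_of_int[of cos "real m * x" "int m"] by (simp add: algebra_simps)
  then show ?thesis by (simp add: periodic_def cos_series_def)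
qed

text \<open>\<open>2 * cos_series q x - q 0\<close> is the two-sided series of the even extension of
  q. Multiplication by 2 - 2 cos x replaces its coefficients by negated second differences, and the
  one at 0 gives the boundary term \<open>2 * (q 0 - q 1)\<close>.\<close>

lemma cos_series_second_difference:
  fixes q :: "nat \<Rightarrow> real"
  assumes s: "summable (\<lambda>m. \<bar>q m\<bar>)"
  shows "(2 - 2 * cos x) * (2 * cos_series q x - q 0) = 2 * (q 0 - q 1)
    - 2 * (\<Sum>m. (q (m + 2) - 2 * q (m + 1) + q m) * cos (real (m + 1) * x))"
proof -
  have s1: "summable (\<lambda>m. \<bar>q (m + 1)\<bar>)" "summable (\<lambda>m. \<bar>q (m + 2)\<bar>)"
    using summable_ignore_initial_segment[OF s, of 1] summable_ignore_initial_segment[OF s, of 2] by auto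
  have sc: "summable (\<lambda>m. c m * cos (real (m + j) * x))" if "summable (\<lambda>m. \<bar>c m\<bar>)" for c :: "nat \<Rightarrow> real" and j
    by (rule summable_rabs_cancel, rule summable_comparison_test[OF _ that]) (auto simp: abs_mult mult_left_le)
  let ?T = "\<lambda>c. \<Sum>m. c m * cos (real (m + 1) * x)"
  have A: "cos_series q x = q 0 + ?T (\<lambda>m. q (m + 1))"
    using suminf_split_initial_segment[OF sc[OF s, of 0], of 1] by (simp add: cos_series_def)
  have trig: "(2 - 2 * cos x) * cos (real (m + 1) * x) = 2 * cos (real (m + 1) * x) - cos (real (m + 2) * x) - cos (real m * x)" for m
  proof -
    have "real (m + 2) * x = real (m + 1) * x + x" "real m * x = real (m + 1) * x - x" by (auto simp: algebra_simps)
    then show ?thesis by (simp only: cos_add cos_diff) (simp add: algebra_simps)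
  qed
  have B: "(\<Sum>m. q (m + 1) * cos (real (m + 2) * x)) = ?T q - q 0 * cos x"
    using suminf_split_initial_segment[OF sc[OF s, of 1], of 1] by (simp add: add_ac)
  have C: "(\<Sum>m. q (m + 1) * cos (real m * x)) = q 1 + ?T (\<lambda>m. q (m + 2))"
    using suminf_split_initial_segment[OF sc[OF s1(1), of 0], of 1] by (simp add: add_ac)
  have "(2 - 2 * cos x) * ?T (\<lambda>m. q (m + 1))
     = (\<Sum>m. 2 * (q (m + 1) * cos (real (m + 1) * x)) - q (m + 1) * cos (real (m + 2) * x) - q (m + 1) * cos (real m * x))"
    unfolding suminf_mult[OF sc[OF s1(1), of 1], symmetric]
  proof (rule suminf_cong)
    fix m
    have "(2 - 2 * cos x) * (q (m + 1) * cos (real (m + 1) * x)) = q (m + 1) * ((2 - 2 * cos x) * cos (real (m + 1) * x))"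
      by (simp only: mult.left_commute)
    also have "\<dots> = 2 * (q (m + 1) * cos (real (m + 1) * x)) - q (m + 1) * cos (real (m + 2) * x) - q (m + 1) * cos (real m * x)"
      unfolding trig by (simp only: right_diff_distrib mult.left_commute)
    finally show "(2 - 2 * cos x) * (q (m + 1) * cos (real (m + 1) * x)) = \<dots>" .
  qed
  also have "\<dots> = 2 * ?T (\<lambda>m. q (m + 1)) - (?T q - q 0 * cos x) - (q 1 + ?T (\<lambda>m. q (m + 2)))"
    unfolding B[symmetric] C[symmetric] using sc[OF s1(1), of 1] sc[OF s1(1), of 2] sc[OF s1(1), of 0]
    by (intro sums_unique[symmetric] sums_diff sums_mult summable_sums) simp_all
  finally have D: "(2 - 2 * cos x) * ?T (\<lambda>m. q (m + 1)) = 2 * ?T (\<lambda>m. q (m + 1)) - (?T q - q 0 * cos x) - (q 1 + ?T (\<lambda>m. q (m + 2)))" .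
  have "?T (\<lambda>m. q (m + 2) - 2 * q (m + 1) + q m) = (\<Sum>m. q (m + 2) * cos (real (m + 1) * x)
      - 2 * (q (m + 1) * cos (real (m + 1) * x)) + q m * cos (real (m + 1) * x))"
    by (rule suminf_cong) (simp add: algebra_simps)
  also have "\<dots> = ?T (\<lambda>m. q (m + 2)) - 2 * ?T (\<lambda>m. q (m + 1)) + ?T q"
    using sc[OF s1(1), of 1] sc[OF s1(2), of 1] sc[OF s, of 1]
    by (intro sums_unique[symmetric] sums_diff sums_add sums_mult summable_sums) simp_all
  finally have E: "?T (\<lambda>m. q (m + 2) - 2 * q (m + 1) + q m) = ?T (\<lambda>m. q (m + 2)) - 2 * ?T (\<lambda>m. q (m + 1)) + ?T q" .
  have "(2 - 2 * cos x) * (2 * cos_series q x - q 0) = 2 * ((2 - 2 * cos x) * ?T (\<lambda>m. q (m + 1))) + (2 - 2 * cos x) * q 0"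
    unfolding A by (simp add: algebra_simps)
  then show ?thesis unfolding D E by (simp add: algebra_simps)
qed

text \<open>The factors are the reciprocals of the squared norms 2 pi and pi of the cosines over a
  period, so that integrating against this kernel over one period has the multiplier
  \<open>mult_coeff n m\<close>.\<close>

definition inv_kernel_coeff :: "nat \<Rightarrow> nat \<Rightarrow> real" where
  "inv_kernel_coeff n m = (if m = 0 then 1 / (2 * pi) else 1 / pi) * mult_coeff n m"

definition inv_kernel :: "nat \<Rightarrow> real \<Rightarrow> real" where "inv_kernel n = cos_series (inv_kernel_coeff n)"

lemma summable_mult_coeff: "1 \<le> n \<Longrightarrow> summable (\<lambda>m. \<bar>mult_coeff n m\<bar>)" and summable_mult_coeff_diff2: "1 \<le> n \<Longrightarrow> summable (\<lambda>m. \<bar>mult_coeff_diff2 n m\<bar>)"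
proof -
  obtain c where c: "\<And>n M. 1 \<le> n \<Longrightarrow> (\<Sum>m<M. \<bar>mult_coeff n m\<bar>) \<le> c * real n"
    "\<And>n M. 1 \<le> n \<Longrightarrow> (\<Sum>m<M. \<bar>mult_coeff_diff2 n m\<bar>) \<le> c / real n" using mult_coeff_bounds by blast
  show "1 \<le> n \<Longrightarrow> summable (\<lambda>m. \<bar>mult_coeff n m\<bar>)" "1 \<le> n \<Longrightarrow> summable (\<lambda>m. \<bar>mult_coeff_diff2 n m\<bar>)"
    using c(1)[of n "Suc _"] c(2)[of n "Suc _"]
    by (auto intro!: bounded_imp_summable simp: lessThan_Suc_atMost simp del: sum.lessThan_Suc)
qed

lemma summable_inv_kernel_coeff: "1 \<le> n \<Longrightarrow> summable (\<lambda>m. \<bar>inv_kernel_coeff n m\<bar>)"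
proof (rule summable_comparison_test)
  assume n: "1 \<le> n"
  show "summable (\<lambda>m. (1 / pi) * \<bar>mult_coeff n m\<bar>)" by (intro summable_mult summable_mult_coeff n)
  have "\<bar>inv_kernel_coeff n m\<bar> \<le> 1 / pi * \<bar>mult_coeff n m\<bar>" for m
    unfolding inv_kernel_coeff_def abs_mult by (intro mult_right_mono) (auto simp: field_simps)
  then show "\<exists>N. \<forall>m\<ge>N. norm \<bar>inv_kernel_coeff n m\<bar> \<le> 1 / pi * \<bar>mult_coeff n m\<bar>" by auto
qed

lemma inv_kernel_eq: "1 \<le> n \<Longrightarrow> inv_kernel n x = (2 * cos_series (mult_coeff n) x - mult_coeff n 0) / (2 * pi)"
proof -
  assume n: "1 \<le> n"
  have "inv_kernel n x = inv_kernel_coeff n 0 + (\<Sum>m. inv_kernel_coeff n (m + 1) * cos (real (m + 1) * x))"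
    using suminf_split_initial_segment[OF summable_cser'[OF summable_inv_kernel_coeff[OF n]], where k = 1] by (simp add: cos_series_def inv_kernel_def)
  also have "(\<Sum>m. inv_kernel_coeff n (m + 1) * cos (real (m + 1) * x)) = (\<Sum>m. 1 / pi * (mult_coeff n (m + 1) * cos (real (m + 1) * x)))"
    by (simp add: inv_kernel_coeff_def)
  also have "\<dots> = 1 / pi * (\<Sum>m. mult_coeff n (m + 1) * cos (real (m + 1) * x))"
    using summable_ignore_initial_segment[OF summable_cser'[OF summable_mult_coeff[OF n]], where k = 1] by (intro suminf_mult)
  also have "(\<Sum>m. mult_coeff n (m + 1) * cos (real (m + 1) * x)) = cos_series (mult_coeff n) x - mult_coeff n 0"
    using suminf_split_initial_segment[OF summable_cser'[OF summable_mult_coeff[OF n]], where k = 1] by (simp add: cos_series_def)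
  finally show ?thesis by (simp add: inv_kernel_coeff_def field_simps)
qed

text \<open>The size n comes from the absolute sum of the coefficients, the decay away from 0 from
  the absolute sum of their second differences divided by 2 - 2 cos x. The latter is useful only
  within one period, hence the restriction to |x| \<le> pi.\<close>

theorem inv_kernel_bound: "\<exists>c>0. \<forall>n\<ge>1. \<forall>x. \<bar>inv_kernel n x\<bar> \<le> c * real n \<and> (\<bar>x\<bar> \<le> pi \<longrightarrow> x\<^sup>2 * \<bar>inv_kernel n x\<bar> \<le> c / real n)"
proof -
  obtain c where c: "c > 0" "\<And>n M. 1 \<le> n \<Longrightarrow> (\<Sum>m<M. \<bar>mult_coeff n m\<bar>) \<le> c * real n"
    "\<And>n M. 1 \<le> n \<Longrightarrow> (\<Sum>m<M. \<bar>mult_coeff_diff2 n m\<bar>) \<le> c / real n" using mult_coeff_bounds by blast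
  have "\<bar>inv_kernel n x\<bar> \<le> (4 * c) * real n \<and> (\<bar>x\<bar> \<le> pi \<longrightarrow> x\<^sup>2 * \<bar>inv_kernel n x\<bar> \<le> (4 * c) / real n)" if n: "1 \<le> n" for n x
  proof (intro conjI impI)
    have s1: "(\<Sum>m. \<bar>mult_coeff n m\<bar>) \<le> c * real n" "(\<Sum>m. \<bar>mult_coeff_diff2 n m\<bar>) \<le> c / real n"
      using c n by (auto intro!: suminf_le_const summable_mult_coeff summable_mult_coeff_diff2)
    have q0: "\<bar>mult_coeff n 0\<bar> \<le> c * real n" using c(2)[OF n, of 1] by simp
    have "\<bar>2 * cos_series (mult_coeff n) x - mult_coeff n 0\<bar> \<le> 3 * (c * real n)"
      using cos_series_abs_le[OF summable_mult_coeff[OF n], of x] s1 q0 by linarith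
    then have "\<bar>inv_kernel n x\<bar> \<le> 3 * (c * real n) / (2 * pi)"
      unfolding inv_kernel_eq[OF n] abs_divide by (simp add: divide_right_mono)
    also have "\<dots> \<le> 3 * (c * real n) / 1" using c(1) pi_gt3 by (intro divide_left_mono) auto
    finally show "\<bar>inv_kernel n x\<bar> \<le> (4 * c) * real n" using c(1) by (simp add: algebra_simps)
    assume x: "\<bar>x\<bar> \<le> pi"
    \<comment> \<open>Because the coefficients are frozen, the first two agree and the boundary term
      of the summation by parts vanishes.\<close>
    have q01: "mult_coeff n 0 = mult_coeff n 1" using n by (simp add: mult_coeff_def)
    have "\<bar>(2 - 2 * cos x) * (2 * cos_series (mult_coeff n) x - mult_coeff n 0)\<bar> = 2 * \<bar>\<Sum>m. mult_coeff_diff2 n m * cos (real (m + 1) * x)\<bar>"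
    proof -
      have "(2 - 2 * cos x) * (2 * cos_series (mult_coeff n) x - mult_coeff n 0) = - 2 * (\<Sum>m. mult_coeff_diff2 n m * cos (real (m + 1) * x))"
        using cos_series_second_difference[OF summable_mult_coeff[OF n], of x] q01 by (simp add: mult_coeff_diff2_def)
      then show ?thesis by (simp add: abs_mult)
    qed
    also have "\<bar>\<Sum>m. mult_coeff_diff2 n m * cos (real (m + 1) * x)\<bar> \<le> (\<Sum>m. \<bar>mult_coeff_diff2 n m\<bar>)"
    proof -
      have sm: "summable (\<lambda>m. \<bar>mult_coeff_diff2 n m * cos (real (m + 1) * x)\<bar>)"
        by (rule summable_comparison_test[OF _ summable_mult_coeff_diff2[OF n]]) (auto simp: abs_mult mult_left_le)
      have "\<bar>\<Sum>m. mult_coeff_diff2 n m * cos (real (m + 1) * x)\<bar> \<le> (\<Sum>m. \<bar>mult_coeff_diff2 n m * cos (real (m + 1) * x)\<bar>)"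
        by (rule summable_rabs[OF sm])
      also have "\<dots> \<le> (\<Sum>m. \<bar>mult_coeff_diff2 n m\<bar>)"
        by (intro suminf_le sm summable_mult_coeff_diff2 n) (auto simp: abs_mult mult_left_le)
      finally show ?thesis .
    qed
    finally have b: "\<bar>(2 - 2 * cos x) * (2 * cos_series (mult_coeff n) x - mult_coeff n 0)\<bar> \<le> 2 * (c / real n)" using s1 by simp
    have "x\<^sup>2 / 4 * \<bar>2 * cos_series (mult_coeff n) x - mult_coeff n 0\<bar> \<le> \<bar>2 - 2 * cos x\<bar> * \<bar>2 * cos_series (mult_coeff n) x - mult_coeff n 0\<bar>"
      using one_minus_cos_ge[OF x] by (intro mult_right_mono) auto
    then have "x\<^sup>2 * \<bar>2 * cos_series (mult_coeff n) x - mult_coeff n 0\<bar> \<le> 8 * (c / real n)"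
      using b by (simp add: abs_mult[symmetric])
    then have "x\<^sup>2 * \<bar>2 * cos_series (mult_coeff n) x - mult_coeff n 0\<bar> / (2 * pi) \<le> 8 * (c / real n) / (2 * pi)" by (intro divide_right_mono) auto
    also have "\<dots> \<le> 8 * (c / real n) / 2" using c(1) pi_gt3 by (intro divide_left_mono) auto
    finally show "x\<^sup>2 * \<bar>inv_kernel n x\<bar> \<le> (4 * c) / real n"
      unfolding inv_kernel_eq[OF n] abs_divide by simp
  qed
  then show ?thesis using c(1) by (intro exI[of _ "4 * c"]) auto
qed

section \<open>Convolution operators on the circle\<close>

lemma lint_Icc:
  fixes f :: "real \<Rightarrow> real"
  assumes [measurable]: "f \<in> borel_measurable borel"
  shows "(LINT x:{a..b}|lborel. f x) = lint f {a<..b}"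
  unfolding set_lebesgue_integral_def
proof (rule integral_cong_AE)
  have "AE x in lborel. x \<noteq> a" by (rule AE_lborel_singleton)
  then show "AE x in lborel. indicat_real {a..b} x *\<^sub>R f x = indicat_real {a<..b} x *\<^sub>R f x"
    by eventually_elim (auto simp: indicator_def)
qed measurable

lemma lint_period:
  assumes F: "periodic_L1 F"
  shows "lint F {a<..a + 2 * pi} = lint F {- pi<..pi}"
proof -
  define k :: int where "k = \<lfloor>(a + pi) / (2 * pi)\<rfloor>"
  define s where "s = a - of_int k * (2 * pi)"
  have "of_int k \<le> (a + pi) / (2 * pi)" "(a + pi) / (2 * pi) \<le> of_int k + 1"
    unfolding k_def by linarith+
  then have s: "- pi \<le> s" "s \<le> pi"
    unfolding s_def by (auto simp: field_simps)
  have periodic: "F (of_int k * (2 * pi) + t) = F t" for t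
    using periodic_of_int[OF periodic_L1_periodic[OF F], of t k] by (simp add: add.commute)
  have per1: "F (2 * pi + t) = F t" "F (t + 2 * pi) = F t" for t
    using periodic_L1_periodic[OF F] by (simp_all add: periodic_def add.commute)
  have "lint F {a<..a + 2 * pi} = lint F {of_int k * (2 * pi) + s<..of_int k * (2 * pi) + (s + 2 * pi)}"
    by (simp add: s_def)
  also have "\<dots> = lint F {s<..s + 2 * pi}"
    using lint_shift[of s "s + 2 * pi" F "of_int k * (2 * pi)"] by (simp add: periodic)
  also have "\<dots> = lint F {s<..pi} + lint F {pi<..s + 2 * pi}"
    using s by (intro lint_split periodic_L1_int F) auto
  also have "lint F {pi<..s + 2 * pi} = lint F {- pi<..s}"
    using lint_shift[of "- pi" s F "2 * pi"] by (simp add: per1 add.commute)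
  also have "lint F {s<..pi} + lint F {- pi<..s} = lint F {- pi<..pi}"
    using lint_split[OF periodic_L1_int[OF F], of "- pi" s pi] s by simp
  finally show ?thesis .
qed

section \<open>Operators with bounded, compactly supported kernels\<close>

definition kernel :: "(real \<Rightarrow> real) \<Rightarrow> bool" where
  "kernel k \<longleftrightarrow> k \<in> borel_measurable borel \<and> (\<exists>B u. 0 < u \<and> (\<forall>x. \<bar>k x\<bar> \<le> B * indicator {- u / 2<..u / 2} x))"

text \<open>Written with x + t, as in \<open>steklov\<close>. Composition nevertheless convolves the
  kernels, as \<open>kernel_op_kernel_op\<close> shows, and this is the source of
  commutativity.\<close>

definition kernel_op :: "(real \<Rightarrow> real) \<Rightarrow> (real \<Rightarrow> real) \<Rightarrow> real \<Rightarrow> real" where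
  "kernel_op k f x = (\<integral>t. k t * f (x + t) \<partial>lborel)"

lemma kernel_meas: "kernel k \<Longrightarrow> k \<in> borel_measurable borel" by (simp add: kernel_def)

lemma kernel_abs: "kernel k \<Longrightarrow> kernel (\<lambda>x. \<bar>k x\<bar>)" unfolding kernel_def by (auto intro: borel_measurable_abs)

lemma periodic_L1_shift: "periodic_L1 f \<Longrightarrow> periodic_L1 (\<lambda>t. f (x + t))"
proof -
  assume f: "periodic_L1 f"
  note [measurable] = periodic_L1_meas[OF f]
  have "set_integrable lborel {a<..b} (\<lambda>t. f (x + t))" for a b
    using lborel_integrable_real_affine[of "\<lambda>t. indicator {x + a<..x + b} t *\<^sub>R f t" 1 x] periodic_L1_int[OF f, of "x + a" "x + b"]
    unfolding set_integrable_def by (simp add: indicator_def)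
  moreover have "periodic (\<lambda>t. f (x + t))" using periodic_L1_periodic[OF f] unfolding periodic_def by (metis add.assoc)
  ultimately show ?thesis unfolding periodic_L1_def by auto
qed

lemma kernel_op_integrable:
  assumes k: "kernel k" and f: "periodic_L1 f"
  shows "integrable lborel (\<lambda>t. k t * f (x + t))"
proof -
  obtain B u where B: "0 < u" "\<And>x. \<bar>k x\<bar> \<le> B * indicator {- u / 2<..u / 2} x" using k by (auto simp: kernel_def)
  have "set_integrable lborel {- u / 2<..u / 2} (\<lambda>t. f (x + t) * k t)"
  proof (rule set_integrable_mult_bounded[where B = B])
    show "\<bar>k t\<bar> \<le> B" if "t \<in> {- u / 2<..u / 2}" for t using B(2)[of t] that by simp
  qed (use periodic_L1_int[OF periodic_L1_shift[OF f]] kernel_meas[OF k] in auto)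
  also have "set_integrable lborel {- u / 2<..u / 2} (\<lambda>t. f (x + t) * k t) \<longleftrightarrow> integrable lborel (\<lambda>t. k t * f (x + t))"
    unfolding set_integrable_def
  proof (rule Bochner_Integration.integrable_cong)
    fix t
    show "indicat_real {- u / 2<..u / 2} t *\<^sub>R (f (x + t) * k t) = k t * f (x + t)"
      using B(2)[of t] by (cases "t \<in> {- u / 2<..u / 2}") auto
  qed simp
  finally show ?thesis .
qed

lemma periodic_L1_kernel_op:
  assumes k: "kernel k" and f: "periodic_L1 f"
  shows "periodic_L1 (kernel_op k f)"
proof -
  note [measurable] = periodic_L1_meas[OF f] kernel_meas[OF k]
  obtain B u where B: "0 < u" "\<And>x. \<bar>k x\<bar> \<le> B * indicator {- u / 2<..u / 2} x" using k by (auto simp: kernel_def)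
  have kB: "kernel (\<lambda>t. B * indicator {- u / 2<..u / 2} t)"
    unfolding kernel_def using B(1) by (intro conjI exI[of _ "\<bar>B\<bar>"] exI[of _ u]) (auto simp: abs_mult)
  obtain M where M: "\<And>x. \<bar>avg u (\<lambda>x. \<bar>f x\<bar>) x\<bar> \<le> M" using avg_bounded[OF periodic_L1_abs[OF f] B(1)] by auto
  have "\<bar>kernel_op k f x\<bar> \<le> \<bar>B\<bar> * u * M" for x
  proof -
    have "\<bar>kernel_op k f x\<bar> \<le> (\<integral>t. \<bar>k t * f (x + t)\<bar> \<partial>lborel)" unfolding kernel_op_def by (rule integral_abs_bound)
    also have "\<dots> \<le> (\<integral>t. (B * indicator {- u / 2<..u / 2} t) * \<bar>f (x + t)\<bar> \<partial>lborel)"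
      using B(2) by (intro integral_mono kernel_op_integrable[OF kB periodic_L1_abs[OF f]] integrable_abs kernel_op_integrable[OF k f])
        (simp add: abs_mult mult_right_mono)
    also have "\<dots> = B * (u * avg u (\<lambda>x. \<bar>f x\<bar>) x)"
      using B(1) by (simp add: avg_eq mult.assoc)
    also have "\<dots> \<le> \<bar>B * (u * avg u (\<lambda>x. \<bar>f x\<bar>) x)\<bar>" by (rule abs_ge_self)
    also have "\<dots> \<le> \<bar>B\<bar> * (u * M)"
      unfolding abs_mult using M[of x] B(1) by (intro mult_left_mono) auto
    finally show ?thesis by (simp add: mult.assoc)
  qed
  moreover have "periodic (kernel_op k f)"
  proof -
    have "f (x + 2 * pi + t) = f (x + t)" for x t
      using periodic_L1_periodic[OF f, unfolded periodic_def, rule_format, of "x + t"] by (simp add: add_ac)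
    then show ?thesis by (simp add: periodic_def kernel_op_def)
  qed
  moreover have "kernel_op k f \<in> borel_measurable borel" unfolding kernel_op_def[abs_def] by measurable
  ultimately show ?thesis by (intro periodic_L1_bounded)
qed

lemma kernel_op_kernel_op:
  assumes k: "kernel k" and l: "kernel l" and f: "periodic_L1 f"
  shows "kernel_op k (kernel_op l f) x = (\<integral>y. (\<integral>t. k t * l (y - t) \<partial>lborel) * f (x + y) \<partial>lborel)"
proof -
  note [measurable] = periodic_L1_meas[OF f] kernel_meas[OF k] kernel_meas[OF l]
  have sh: "(\<integral>y. l (y - t) * f (x + y) \<partial>lborel) = (\<integral>s. l s * f (x + t + s) \<partial>lborel)"
    for t and l f :: "real \<Rightarrow> real"
    using lborel_integral_real_affine[of 1 "\<lambda>y. l (y - t) * f (x + y)" t] by (simp add: add.assoc)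
  have i: "integrable (lborel \<Otimes>\<^sub>M lborel) (\<lambda>(t, y). k t * l (y - t) * f (x + y))"
  proof (rule lborel_pair.Fubini_integrable)
    have "(\<integral>y. norm (case (t, y) of (t, y) \<Rightarrow> k t * l (y - t) * f (x + y)) \<partial>lborel) = \<bar>k t\<bar> * kernel_op (\<lambda>t. \<bar>l t\<bar>) (\<lambda>x. \<bar>f x\<bar>) (x + t)" for t
      using sh[of "\<lambda>t. \<bar>l t\<bar>" t "\<lambda>x. \<bar>f x\<bar>"] by (simp add: abs_mult mult.assoc kernel_op_def)
    then show "integrable lborel (\<lambda>t. \<integral>y. norm (case (t, y) of (t, y) \<Rightarrow> k t * l (y - t) * f (x + y)) \<partial>lborel)"
      using kernel_op_integrable[OF kernel_abs[OF k] periodic_L1_kernel_op[OF kernel_abs[OF l] periodic_L1_abs[OF f]]] by simp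
    show "AE t in lborel. integrable lborel (\<lambda>y. case (t, y) of (t, y) \<Rightarrow> k t * l (y - t) * f (x + y))"
    proof (rule AE_I2)
      fix t
      have "integrable lborel (\<lambda>s. l s * f ((x + t) + s))" by (rule kernel_op_integrable[OF l f])
      from lborel_integrable_real_affine[OF this, of 1 "- t"]
      show "integrable lborel (\<lambda>y. case (t, y) of (t, y) \<Rightarrow> k t * l (y - t) * f (x + y))"
        by (simp add: mult.assoc integrable_mult_right)
    qed
  qed measurable
  have "kernel_op k (kernel_op l f) x = (\<integral>t. (\<integral>y. k t * l (y - t) * f (x + y) \<partial>lborel) \<partial>lborel)"
    unfolding kernel_op_def sh[symmetric] by (simp add: mult.assoc)
  also have "\<dots> = (\<integral>y. (\<integral>t. k t * l (y - t) * f (x + y) \<partial>lborel) \<partial>lborel)"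
    by (rule lborel_pair.Fubini_integral[OF i, symmetric])
  finally show ?thesis by simp
qed

text \<open>The substitution of y - t for t shows that the convolution of the two kernels is
  symmetric.\<close>

lemma kernel_op_commute:
  assumes k: "kernel k" and l: "kernel l" and f: "periodic_L1 f"
  shows "kernel_op k (kernel_op l f) x = kernel_op l (kernel_op k f) x"
proof -
  have "(\<integral>t. k t * l (y - t) \<partial>lborel) = (\<integral>t. l t * k (y - t) \<partial>lborel)" for y
    using lborel_integral_real_affine[of "-1" "\<lambda>t. k t * l (y - t)" y] by (simp add: mult.commute)
  then show ?thesis unfolding kernel_op_kernel_op[OF k l f] kernel_op_kernel_op[OF l k f] by simp
qed

lemma kernel_op_diff: "kernel k \<Longrightarrow> periodic_L1 f \<Longrightarrow> periodic_L1 g \<Longrightarrow> kernel_op k (\<lambda>x. f x - g x) x = kernel_op k f x - kernel_op k g x"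
  unfolding kernel_op_def by (simp add: right_diff_distrib kernel_op_integrable)

lemma kernel_op_add: "kernel k \<Longrightarrow> periodic_L1 f \<Longrightarrow> periodic_L1 g \<Longrightarrow> kernel_op k (\<lambda>x. f x + g x) x = kernel_op k f x + kernel_op k g x"
  unfolding kernel_op_def by (simp add: distrib_left kernel_op_integrable)

definition box_kernel :: "real \<Rightarrow> real \<Rightarrow> real" where "box_kernel u t = indicator {- u / 2<..u / 2} t / u"

lemma avg_eq_kernel_op: "avg u f = kernel_op (box_kernel u) f"
  by (auto simp: fun_eq_iff avg_eq kernel_op_def box_kernel_def)

lemma kernel_box_kernel: "0 < u \<Longrightarrow> kernel (box_kernel u)"
  unfolding kernel_def box_kernel_def[abs_def] by (intro conjI exI[of _ "1 / u"] exI[of _ u]) auto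

text \<open>Cutting the periodic kernel to one period gives it bounded support, so the facts on
  \<open>kernel_op\<close> apply.\<close>

definition torus_conv :: "(real \<Rightarrow> real) \<Rightarrow> (real \<Rightarrow> real) \<Rightarrow> real \<Rightarrow> real" where
  "torus_conv k = kernel_op (\<lambda>t. indicator {- pi<..pi} t * k t)"

lemma kernel_torus_conv:
  assumes [measurable]: "k \<in> borel_measurable borel" and "\<And>t. \<bar>k t\<bar> \<le> B"
  shows "kernel (\<lambda>t. indicator {- pi<..pi} t * k t)"
  unfolding kernel_def
proof (intro conjI exI allI)
  show "0 < 2 * pi" by simp
  show "\<bar>indicat_real {- pi<..pi} x * k x\<bar> \<le> B * indicat_real {- (2 * pi) / 2<..2 * pi / 2} x" for x
    using assms(2)[of x] by (auto simp: indicator_def)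
qed measurable

lemma torus_conv_eq: "torus_conv k f x = lint (\<lambda>t. k t * f (x + t)) {- pi<..pi}"
  by (simp add: torus_conv_def kernel_op_def set_lebesgue_integral_def mult.assoc)

lemma periodic_L1_mult_bounded:
  assumes f: "periodic_L1 f" and [measurable]: "k \<in> borel_measurable borel" and k: "periodic k" "\<And>t. \<bar>k t\<bar> \<le> B"
  shows "periodic_L1 (\<lambda>t. k t * f t)"
proof -
  have "set_integrable lborel {a<..b} (\<lambda>t. f t * k t)" for a b
    using k by (intro set_integrable_mult_bounded[where B = B] periodic_L1_int f) auto
  then show ?thesis using f k periodic_L1_meas[OF f] by (auto simp: periodic_L1_def periodic_def mult.commute)
qed

text \<open>Since k is even and the integrand periodic, \<open>torus_conv k f (x + s)\<close> is the
  integral of \<open>k (s - t) * f (x + t)\<close> over a period. Averaging over s then acts on k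
  alone.\<close>

lemma torus_conv_avg:
  assumes f: "periodic_L1 f" and [measurable]: "k \<in> borel_measurable borel" and k: "periodic k" "\<And>t. \<bar>k t\<bar> \<le> B" "\<And>t. k (- t) = k t"
    and ev: "\<And>t. avg h k (- t) = avg h k t" and h: "0 < h"
  shows "torus_conv k (avg h f) x = torus_conv (avg h k) f x"
proof -
  note [measurable] = periodic_L1_meas[OF f]
  let ?I = "{- pi<..pi}"
  have K: "kernel (\<lambda>t. indicator ?I t * k t)" using k by (intro kernel_torus_conv[where B = B]) auto
  have sh: "torus_conv k f (x + s) = (\<integral>t. indicator ?I t * (k (s - t) * f (x + t)) \<partial>lborel)" for s
  proof -
    have p: "periodic_L1 (\<lambda>t. k t * f (x + s + t))" using k by (intro periodic_L1_mult_bounded[where B = B] periodic_L1_shift f) auto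
    have "torus_conv k f (x + s) = lint (\<lambda>t. k t * f (x + s + t)) {- pi - s<..- pi - s + 2 * pi}"
      unfolding torus_conv_eq lint_period[OF p] by simp
    also have "\<dots> = (LINT t:?I|lborel. k (- s + t) * f (x + s + (- s + t)))"
      by (subst lint_shift) (simp add: algebra_simps)
    also have "\<dots> = (LINT t:?I|lborel. k (s - t) * f (x + t))"
      using k(3)[of "s - _"] by (simp add: algebra_simps)
    finally show ?thesis by (simp add: set_lebesgue_integral_def)
  qed
  have B0: "0 \<le> B" using k(2)[of 0] by linarith
  have bi: "integrable lborel (box_kernel h)" using integrable_indicator_Ioc[of "-h/2" "h/2"] unfolding box_kernel_def[abs_def] by simp
  have bm [measurable]: "box_kernel h \<in> borel_measurable borel" unfolding box_kernel_def[abs_def] by measurable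
  have fi: "integrable lborel (\<lambda>t. indicator ?I t * \<bar>f (x + t)\<bar>)"
    using periodic_L1_int[OF periodic_L1_abs[OF periodic_L1_shift[OF f]], of "-pi" pi x] by (simp add: set_integrable_def)
  have i: "integrable (lborel \<Otimes>\<^sub>M lborel) (\<lambda>(s, t). box_kernel h s * (indicator ?I t * (k (s - t) * f (x + t))))"
  proof (rule Bochner_Integration.integrable_bound)
    show "integrable (lborel \<Otimes>\<^sub>M lborel) (\<lambda>(s, t). box_kernel h s * (B * (indicator ?I t * \<bar>f (x + t)\<bar>)))"
    proof (rule lborel_pair.Fubini_integrable)
      show "integrable lborel (\<lambda>s. \<integral>t. norm (case (s, t) of (s, t) \<Rightarrow> box_kernel h s * (B * (indicator ?I t * \<bar>f (x + t)\<bar>))) \<partial>lborel)"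
        using bi B0 by (simp add: abs_mult)
      show "AE s in lborel. integrable lborel (\<lambda>t. case (s, t) of (s, t) \<Rightarrow> box_kernel h s * (B * (indicator ?I t * \<bar>f (x + t)\<bar>)))"
        using fi by simp
    qed measurable
    show "AE p in lborel \<Otimes>\<^sub>M lborel. norm (case p of (s, t) \<Rightarrow> box_kernel h s * (indicator ?I t * (k (s - t) * f (x + t))))
       \<le> norm (case p of (s, t) \<Rightarrow> box_kernel h s * (B * (indicator ?I t * \<bar>f (x + t)\<bar>)))"
    proof (rule AE_I2)
      fix p :: "real \<times> real"
      obtain s t where p: "p = (s, t)" by (cases p)
      have "\<bar>box_kernel h s\<bar> * (indicator ?I t * (\<bar>k (s - t)\<bar> * \<bar>f (x + t)\<bar>)) \<le> \<bar>box_kernel h s\<bar> * (indicator ?I t * (B * \<bar>f (x + t)\<bar>))"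
        using k(2)[of "s - t"] by (intro mult_left_mono mult_right_mono) auto
      then show "norm (case p of (s, t) \<Rightarrow> box_kernel h s * (indicator ?I t * (k (s - t) * f (x + t))))
       \<le> norm (case p of (s, t) \<Rightarrow> box_kernel h s * (B * (indicator ?I t * \<bar>f (x + t)\<bar>)))"
        using B0 by (simp add: p abs_mult mult_ac)
    qed
  qed measurable
  have "torus_conv k (avg h f) x = avg h (torus_conv k f) x"
    unfolding avg_eq_kernel_op torus_conv_def by (rule kernel_op_commute[OF K kernel_box_kernel[OF h] f])
  also have "\<dots> = (\<integral>s. (\<integral>t. box_kernel h s * (indicator ?I t * (k (s - t) * f (x + t))) \<partial>lborel) \<partial>lborel)"
    unfolding avg_eq_kernel_op kernel_op_def[of "box_kernel h"] sh by simp
  also have "\<dots> = (\<integral>t. (\<integral>s. box_kernel h s * (indicator ?I t * (k (s - t) * f (x + t))) \<partial>lborel) \<partial>lborel)"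
    by (rule lborel_pair.Fubini_integral[OF i, symmetric])
  also have "\<dots> = (\<integral>t. indicator ?I t * avg h k t * f (x + t) \<partial>lborel)"
  proof (rule Bochner_Integration.integral_cong[OF refl])
    fix t
    have "(\<integral>s. box_kernel h s * (indicator ?I t * (k (s - t) * f (x + t))) \<partial>lborel) = (\<integral>s. (box_kernel h s * k (- t + s)) * (indicator ?I t * f (x + t)) \<partial>lborel)"
      by (simp add: mult_ac)
    also have "\<dots> = avg h k (- t) * (indicator ?I t * f (x + t))" unfolding avg_eq_kernel_op kernel_op_def by simp
    finally show "(\<integral>s. box_kernel h s * (indicator ?I t * (k (s - t) * f (x + t))) \<partial>lborel) = indicator ?I t * avg h k t * f (x + t)"
      by (simp add: ev)
  qed
  finally show ?thesis by (simp add: torus_conv_def kernel_op_def)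
qed

section \<open>The tent kernel and cosine multipliers\<close>

definition tent :: "real \<Rightarrow> real \<Rightarrow> real" where "tent h y = max 0 (h - \<bar>y\<bar>) / h\<^sup>2"

text \<open>The tent is the convolution of the box kernel with itself, computed as the overlap of
  two windows. For \<open>h \<le> pi\<close> its support fits into a single period.\<close>

lemma avg_avg_tent:
  assumes f: "periodic_L1 f" and h: "0 < h" "h \<le> pi"
  shows "avg h (avg h f) x = torus_conv (tent h) f x"
proof -
  have "(\<integral>t. box_kernel h t * box_kernel h (y - t) \<partial>lborel) = indicator {- pi<..pi} y * tent h y" for y
  proof -
    let ?A = "{- h / 2<..h / 2} \<inter> {y - h / 2..<y + h / 2}"
    have "(\<integral>t. box_kernel h t * box_kernel h (y - t) \<partial>lborel) = (\<integral>t. indicator ?A t / h\<^sup>2 \<partial>lborel)"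
    proof (rule Bochner_Integration.integral_cong[OF refl])
      fix t
      have "indicat_real {- h / 2<..h / 2} (y - t) = indicator {y - h / 2..<y + h / 2} t"
        by (auto simp: indicator_def)
      then show "box_kernel h t * box_kernel h (y - t) = indicator ?A t / h\<^sup>2"
        by (simp add: box_kernel_def indicator_inter_arith power2_eq_square)
    qed
    also have "\<dots> = measure lborel ?A / h\<^sup>2" by simp
    also have "measure lborel ?A = max 0 (h - \<bar>y\<bar>)"
    proof -
      have "emeasure lborel ?A = ennreal (min (h / 2) (y + h / 2) - max (- h / 2) (y - h / 2))"
        by (rule emeasure_between) auto
      also have "min (h / 2) (y + h / 2) - max (- h / 2) (y - h / 2) = h - \<bar>y\<bar>"
        by (auto simp: min_def max_def)
      finally show ?thesis
        unfolding measure_def by (cases "0 \<le> h - \<bar>y\<bar>") (simp_all add: ennreal_neg)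
    qed
    finally show ?thesis using h by (auto simp: tent_def indicator_def)
  qed
  then show ?thesis unfolding avg_eq_kernel_op kernel_op_kernel_op[OF kernel_box_kernel[OF h(1)] kernel_box_kernel[OF h(1)] f]
    by (simp add: torus_conv_def kernel_op_def)
qed

lemma lint_cos:
  assumes "a \<le> b" "c \<noteq> 0"
  shows "lint (\<lambda>x. cos (c * x)) {a<..b} = (sin (c * b) - sin (c * a)) / c"
proof -
  have "(\<integral>x. cos (c * x) * indicator {a..b} x \<partial>lborel) = sin (c * b) / c - sin (c * a) / c"
    using assms by (intro integral_FTC_Icc_real) (auto intro!: derivative_eq_intros)
  then have "(LINT x:{a..b}|lborel. cos (c * x)) = (sin (c * b) - sin (c * a)) / c"
    by (simp add: set_lebesgue_integral_def mult.commute diff_divide_distrib)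
  then show ?thesis by (subst (asm) lint_Icc) auto
qed

text \<open>At m = 0 the quotient would evaluate to 0 under division by zero, while constants must
  be preserved.\<close>

definition avg_symbol :: "real \<Rightarrow> nat \<Rightarrow> real" where
  "avg_symbol h m = (if m = 0 then 1 else sin (real m * h / 2) / (real m * h / 2))"

lemma avg_cos: "0 < h \<Longrightarrow> avg h (\<lambda>x. cos (real m * x)) x = avg_symbol h m * cos (real m * x)"
proof (cases "m = 0")
  case True
  assume "0 < h" then show ?thesis using True by (simp add: avg_symbol_def avg_const)
next
  case False
  assume h: "0 < h"
  have "sin (real m * (x + h / 2)) - sin (real m * (x - h / 2)) = 2 * (cos (real m * x) * sin (real m * h / 2))"
    by (simp add: sin_diff sin_add algebra_simps)
  then show ?thesis using False h
    unfolding avg_def by (subst lint_cos) (auto simp: avg_symbol_def)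
qed

lemma periodic_L1_cos: "periodic_L1 (\<lambda>x. cos (real m * x))"
proof (rule periodic_L1_bounded[of _ 1])
  have "cos_series (\<lambda>j. if j = m then 1 else 0) x = (\<Sum>j\<in>{m}. (if j = m then 1 else 0) * cos (real j * x))" for x
    unfolding cos_series_def by (rule suminf_finite) auto
  then have "cos_series (\<lambda>j. if j = m then 1 else 0) = (\<lambda>x. cos (real m * x))" by auto
  then show "periodic (\<lambda>x. cos (real m * x))" using periodic_cos_series by metis
qed auto

lemma cos_orthogonal:
  "lint (\<lambda>t. cos (real j * t) * cos (real m * t)) {- pi<..pi} = (if j = m then if m = 0 then 2 * pi else pi else 0)"
proof -
  have *: "lint (\<lambda>t. cos (of_int c * t)) {- pi<..pi} = (if c = 0 then 2 * pi else 0)" for c :: int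
  proof (cases "c = 0")
    case False
    then have "lint (\<lambda>t. cos (of_int c * t)) {- pi<..pi} = (sin (of_int c * pi) - sin (of_int c * - pi)) / of_int c"
      by (intro lint_cos) auto
    then show ?thesis using False sin_npi_int[of c] by (simp add: mult.commute)
  qed (simp add: set_integral_const)
  have i: "set_integrable lborel {- pi<..pi} (\<lambda>t. cos (of_int c * t))" for c :: int
    using periodic_L1_int[OF periodic_L1_cos[of "nat \<bar>c\<bar>"], of "- pi" pi] by (cases "0 \<le> c") (auto simp: abs_if)
  have "cos (real j * t) * cos (real m * t) = (cos (of_int (int j - int m) * t) + cos (of_int (int j + int m) * t)) / 2" for t
    by (simp add: cos_times_cos left_diff_distrib distrib_right)
  then have "lint (\<lambda>t. cos (real j * t) * cos (real m * t)) {- pi<..pi}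
    = (lint (\<lambda>t. cos (of_int (int j - int m) * t)) {- pi<..pi} + lint (\<lambda>t. cos (of_int (int j + int m) * t)) {- pi<..pi}) / 2"
    by (simp only: set_integral_divide_zero set_integral_add(2)[OF i i])
  also have "\<dots> = (if j = m then if m = 0 then 2 * pi else pi else 0)"
    unfolding * by auto
  finally show ?thesis .
qed

lemma kernel_op_cos_series:
  assumes b: "kernel b" and c: "summable (\<lambda>m. \<bar>c m\<bar>)"
  shows "kernel_op b (cos_series c) x = (\<Sum>m. c m * kernel_op b (\<lambda>x. cos (real m * x)) x)"
proof -
  have i1: "integrable lborel (\<lambda>t. \<bar>b t\<bar>)" using kernel_op_integrable[OF kernel_abs[OF b] periodic_L1_const[of 1]] by simp
  have i2: "integrable lborel (\<lambda>t. b t * (c m * cos (real m * (x + t))))" for m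
    using kernel_op_integrable[OF b periodic_L1_cmult[OF periodic_L1_cos, of "c m" m]] by simp
  have "kernel_op b (cos_series c) x = (\<integral>t. (\<Sum>m. b t * (c m * cos (real m * (x + t)))) \<partial>lborel)"
    unfolding kernel_op_def cos_series_def by (intro Bochner_Integration.integral_cong refl suminf_mult[symmetric] summable_cser' c)
  also have "\<dots> = (\<Sum>m. \<integral>t. b t * (c m * cos (real m * (x + t))) \<partial>lborel)"
  proof (rule integral_suminf[OF i2])
    show "AE t in lborel. summable (\<lambda>m. norm (b t * (c m * cos (real m * (x + t)))))"
      using summable_mult[OF summable_cos_series[OF c]] by (auto simp: abs_mult)
    show "summable (\<lambda>m. \<integral>t. norm (b t * (c m * cos (real m * (x + t)))) \<partial>lborel)"
    proof (rule summable_comparison_test)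
      show "summable (\<lambda>m. (\<integral>t. \<bar>b t\<bar> \<partial>lborel) * \<bar>c m\<bar>)" by (intro summable_mult c)
      have "(\<integral>t. norm (b t * (c m * cos (real m * (x + t)))) \<partial>lborel) \<le> (\<integral>t. \<bar>b t\<bar> * \<bar>c m\<bar> \<partial>lborel)" for m
        by (rule integral_mono[OF integrable_norm[OF i2] integrable_mult_left[OF i1]])
          (auto simp: abs_mult intro!: mult_left_mono mult_left_le)
      then show "\<exists>N. \<forall>m\<ge>N. norm (\<integral>t. norm (b t * (c m * cos (real m * (x + t)))) \<partial>lborel) \<le> (\<integral>t. \<bar>b t\<bar> \<partial>lborel) * \<bar>c m\<bar>"
        by simp
    qed
  qed
  also have "\<dots> = (\<Sum>m. c m * kernel_op b (\<lambda>x. cos (real m * x)) x)"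
    unfolding kernel_op_def by (simp only: mult.left_commute[of "b _"] integral_mult_right_zero)
  finally show ?thesis .
qed

lemma avg_cos_series: "0 < h \<Longrightarrow> summable (\<lambda>m. \<bar>c m\<bar>) \<Longrightarrow> avg h (cos_series c) x = cos_series (\<lambda>m. c m * avg_symbol h m) x"
  using kernel_op_cos_series[OF kernel_box_kernel, of h c x] avg_cos[of h, unfolded avg_eq_kernel_op]
  by (simp add: avg_eq_kernel_op cos_series_def mult.assoc)

lemma cos_series_coeff:
  assumes c: "summable (\<lambda>m. \<bar>c m\<bar>)"
  shows "lint (\<lambda>t. cos_series c t * cos (real m * t)) {- pi<..pi} = (if m = 0 then 2 * pi else pi) * c m"
proof -
  have K: "kernel (\<lambda>t. indicator {- pi<..pi} t * cos (real m * t))"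
    by (rule kernel_torus_conv[where B = 1]) auto
  have "lint (\<lambda>t. cos_series c t * cos (real m * t)) {- pi<..pi} = kernel_op (\<lambda>t. indicator {- pi<..pi} t * cos (real m * t)) (cos_series c) 0"
    by (simp add: kernel_op_def set_lebesgue_integral_def mult_ac)
  also have "\<dots> = (\<Sum>j. c j * kernel_op (\<lambda>t. indicator {- pi<..pi} t * cos (real m * t)) (\<lambda>x. cos (real j * x)) 0)"
    by (rule kernel_op_cos_series[OF K c])
  also have "\<dots> = (\<Sum>j. c j * lint (\<lambda>t. cos (real j * t) * cos (real m * t)) {- pi<..pi})"
    by (simp add: kernel_op_def set_lebesgue_integral_def mult_ac)
  also have "\<dots> = (\<Sum>j\<in>{m}. c j * (if j = m then if m = 0 then 2 * pi else pi else 0))"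
    unfolding cos_orthogonal by (rule suminf_finite) auto
  finally show ?thesis by simp
qed

section \<open>Inverting the difference operator modulo trigonometric polynomials\<close>

lemma set_integrable_continuous:
  fixes g :: "real \<Rightarrow> real"
  assumes "continuous_on UNIV g"
  shows "set_integrable lborel {a<..b} g"
  by (rule set_integrable_subset[OF borel_integrable_atLeastAtMost'[of a b]])
    (auto intro: continuous_on_subset[OF assms])

lemma lint_sum:
  assumes "\<And>i. i \<in> I \<Longrightarrow> set_integrable lborel A (f i)"
  shows "lint (\<lambda>t. \<Sum>i\<in>I. f i t) A = (\<Sum>i\<in>I. lint (f i) A)"
  unfolding set_lebesgue_integral_def scaleR_sum_right
  by (rule Bochner_Integration.integral_sum) (use assms in \<open>auto simp: set_integrable_def\<close>)

text \<open>Each factor cos t is absorbed into cos(m t) by the product formula. In this form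
  orthogonality to the cosines applies to polynomials in cos t, as produced by
  Stone-Weierstrass.\<close>

lemma lint_mult_cos_power_eq_0:
  assumes D: "continuous_on UNIV D" and z: "\<And>m::nat. lint (\<lambda>t. D t * cos (real m * t)) {- pi<..pi} = 0"
  shows "lint (\<lambda>t. D t * (cos t ^ j * cos (real m * t))) {- pi<..pi} = 0"
proof (induction j arbitrary: m)
  case 0
  then show ?case using z by simp
next
  case (Suc j)
  have i: "set_integrable lborel {- pi<..pi} (\<lambda>t. D t * (cos t ^ j * cos (real m * t)))" for m
    by (intro set_integrable_continuous continuous_intros D)
  show ?case
  proof (cases m)
    \<comment> \<open>Separate because the product formula would lead to the index m - 1 = -1; here
      cos t itself becomes the cosine of frequency 1.\<close>
    case 0
    have "(\<lambda>t. D t * (cos t ^ Suc j * cos (real m * t))) = (\<lambda>t. D t * (cos t ^ j * cos (real 1 * t)))"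
      using 0 by (auto simp: mult_ac)
    then show ?thesis using Suc[of 1] by simp
  next
    case (Suc l)
    have "cos t * cos (real m * t) = (cos (real (l + 2) * t) + cos (real l * t)) / 2" for t
      using cos_times_cos[of "real m * t" t] Suc by (simp add: algebra_simps)
    then have "D t * (cos t ^ Suc j * cos (real m * t))
      = (D t * (cos t ^ j * cos (real (l + 2) * t)) + D t * (cos t ^ j * cos (real l * t))) / 2" for t
      by (simp add: mult.assoc distrib_left[symmetric] mult.left_commute[of "cos t"])
    then have "lint (\<lambda>t. D t * (cos t ^ Suc j * cos (real m * t))) {- pi<..pi}
      = (lint (\<lambda>t. D t * (cos t ^ j * cos (real (l + 2) * t))) {- pi<..pi} + lint (\<lambda>t. D t * (cos t ^ j * cos (real l * t))) {- pi<..pi}) / 2"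
      by (simp only: set_integral_divide_zero set_integral_add(2)[OF i i])
    then show ?thesis unfolding Suc.IH by simp
  qed
qed

text \<open>An even function on [-pi, pi] is a continuous function of cos t, hence uniformly
  approximable by polynomials g in cos t. Orthogonality gives that the integral of D^2 equals that
  of D (D - g(cos t)), which is arbitrarily small. This identifies the tent with its cosine series
  without a convergence theorem for Fourier series.\<close>

lemma even_continuous_eq_0:
  fixes D :: "real \<Rightarrow> real"
  assumes D: "continuous_on UNIV D" "\<And>x. D (- x) = D x"
    and z: "\<And>m::nat. lint (\<lambda>t. D t * cos (real m * t)) {- pi<..pi} = 0"
    and x: "x \<in> {- pi..pi}"
  shows "D x = 0"
proof -
  let ?I = "{- pi<..pi}"
  define J where "J = lint (\<lambda>t. \<bar>D t\<bar>) ?I"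
  have J: "0 \<le> J" unfolding J_def by (rule lint_nonneg) simp
  have le: "lint (\<lambda>t. D t * D t) ?I \<le> e * J" if e: "0 < e" for e
  proof -
    have c: "continuous_on {-1..1} (D \<circ> arccos)"
      by (intro continuous_on_compose continuous_on_arccos') (auto intro: continuous_on_subset[OF D(1)])
    obtain g where g: "real_polynomial_function g" "\<And>y. y \<in> {-1..1} \<Longrightarrow> \<bar>(D \<circ> arccos) y - g y\<bar> < e"
      using Stone_Weierstrass_real_polynomial_function[OF compact_Icc c e] by blast
    obtain a N where a: "g = (\<lambda>y. \<Sum>i\<le>N. a i * y ^ i)" using real_polynomial_function_imp_sum[OF g(1)] by auto
    have near: "\<bar>D t - g (cos t)\<bar> \<le> e" if "t \<in> ?I" for t
    proof -
      have "D (arccos (cos \<bar>t\<bar>)) = D t" using that D(2)[of t] by (subst arccos_cos) (auto simp: abs_if)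
      then show ?thesis using g(2)[of "cos t"] by (simp add: abs_if split: if_splits)
    qed
    have gc: "continuous_on UNIV (\<lambda>t. g (cos t))" unfolding a by (intro continuous_intros)
    have gi: "set_integrable lborel ?I (\<lambda>t. D t * g (cos t))"
      by (intro set_integrable_continuous continuous_intros D(1) gc)
    have i1: "set_integrable lborel ?I (\<lambda>t. D t * D t)" "set_integrable lborel ?I (\<lambda>t. e * \<bar>D t\<bar>)"
      by (intro set_integrable_continuous continuous_intros D(1))+
    have "lint (\<lambda>t. D t * g (cos t)) ?I = lint (\<lambda>t. \<Sum>i\<le>N. a i * (D t * (cos t ^ i * cos (real 0 * t)))) ?I"
      unfolding a by (simp add: sum_distrib_left mult_ac)
    also have "\<dots> = (\<Sum>i\<le>N. lint (\<lambda>t. a i * (D t * (cos t ^ i * cos (real 0 * t)))) ?I)"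
      by (intro lint_sum set_integrable_continuous continuous_intros D(1))
    also have "\<dots> = 0" unfolding set_integral_mult_right lint_mult_cos_power_eq_0[OF D(1) z] by simp
    finally have "lint (\<lambda>t. D t * D t) ?I = lint (\<lambda>t. D t * D t - D t * g (cos t)) ?I"
      using set_integral_diff(2)[OF i1(1) gi] by simp
    also have "\<dots> \<le> lint (\<lambda>t. e * \<bar>D t\<bar>) ?I"
    proof (rule set_integral_mono[OF set_integral_diff(1)[OF i1(1) gi] i1(2)])
      fix t assume "t \<in> ?I"
      have "D t * D t - D t * g (cos t) = D t * (D t - g (cos t))" by (simp add: algebra_simps)
      also have "\<dots> \<le> \<bar>D t\<bar> * \<bar>D t - g (cos t)\<bar>" by (simp add: abs_mult[symmetric])
      also have "\<dots> \<le> \<bar>D t\<bar> * e" using near[OF \<open>t \<in> ?I\<close>] by (intro mult_left_mono) auto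
      finally show "D t * D t - D t * g (cos t) \<le> e * \<bar>D t\<bar>" by (simp add: mult.commute)
    qed
    also have "\<dots> = e * J" by (simp add: J_def)
    finally show ?thesis .
  qed
  have "lint (\<lambda>t. D t * D t) ?I \<le> 0"
  proof (rule field_le_epsilon)
    fix e :: real assume e: "0 < e"
    have "lint (\<lambda>t. D t * D t) ?I \<le> (e / (J + 1)) * J" using e J by (intro le) auto
    also have "\<dots> = e * (J / (J + 1))" by simp
    also have "\<dots> \<le> e * 1" using e J by (intro mult_left_mono) auto
    finally show "lint (\<lambda>t. D t * D t) ?I \<le> 0 + e" by simp
  qed
  moreover have "0 \<le> lint (\<lambda>t. D t * D t) ?I" by (rule lint_nonneg) simp
  ultimately have "lint (\<lambda>t. D t * D t) ?I = 0" by simp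
  moreover have "D \<in> borel_measurable borel" using D(1) by (rule borel_measurable_continuous_onI)
  ultimately have "(LINT t:{- pi..pi}|lborel. D t * D t) = 0" by (subst lint_Icc) auto
  moreover have "set_integrable lborel {- pi..pi} (\<lambda>t. D t * D t)"
    by (intro borel_integrable_atLeastAtMost' continuous_intros) (auto intro: continuous_on_subset[OF D(1)])
  ultimately have "integral {- pi..pi} (\<lambda>t. D t * D t) = 0"
    using set_borel_integral_eq_integral(2) by metis
  then have "\<forall>t\<in>{- pi..pi}. D t * D t = 0"
    by (subst (asm) integral_eq_0_iff) (auto intro!: continuous_intros intro: continuous_on_subset[OF D(1)])
  then show ?thesis using x by auto
qed

lemma mult_coeff_symbol:
  assumes n: "1 \<le> n" and m: "n \<le> m"
  shows "mult_coeff n m * (1 - avg_symbol (1 / real n) m) = (avg_symbol (1 / real n) m)\<^sup>2"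
proof -
  define x where "x = real m / real n"
  have x: "1 \<le> x" using n m by (simp add: x_def)
  have s: "avg_symbol (1 / real n) m = 2 * sin (x / 2) / x"
    using n m by (simp add: avg_symbol_def x_def)
  have dn: "mult_den x = x * (x - 2 * sin (x / 2))" by (simp add: mult_den_def power2_eq_square algebra_simps)
  have q: "mult_coeff n m = 4 * (sin (x / 2))\<^sup>2 / (x * (x - 2 * sin (x / 2)))"
  proof -
    have "cos x = 1 - 2 * (sin (x / 2))\<^sup>2" using cos_double_sin[of "x / 2"] by simp
    then have "2 - 2 * cos x = 4 * (sin (x / 2))\<^sup>2" by simp
    moreover have "mult_den x = x * (x - 2 * sin (x / 2))" by (rule dn)
    moreover have "mult_coeff n m = mult_symbol x" using x by (simp add: mult_coeff_def x_def[symmetric] max_def)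
    ultimately show ?thesis by (simp add: mult_symbol_def)
  qed
  have "0 < mult_den x" using mult_den_pos[OF x] .
  then have "x - 2 * sin (x / 2) \<noteq> 0" "x \<noteq> 0" unfolding dn by auto
  then show ?thesis unfolding q s by (simp add: divide_simps) (simp add: power2_eq_square algebra_simps)
qed

lemma avg_symbol_bound: "\<bar>avg_symbol h m\<bar> \<le> 1"
proof (cases "real m * h / 2 = 0")
  case False
  have "\<bar>sin (real m * h / 2)\<bar> \<le> \<bar>real m * h / 2\<bar>" by (rule abs_sin_x_le_abs_x)
  then show ?thesis using False by (simp add: avg_symbol_def abs_divide divide_le_eq)
qed (auto simp: avg_symbol_def)

lemma tent_cos:
  assumes "0 < h" "h \<le> pi"
  shows "lint (\<lambda>t. tent h t * cos (real m * t)) {- pi<..pi} = (avg_symbol h m)\<^sup>2"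
proof -
  have e: "avg h (\<lambda>x. cos (real m * x)) = (\<lambda>x. avg_symbol h m * cos (real m * x))"
    using avg_cos[OF assms(1), of m] by auto
  have "lint (\<lambda>t. tent h t * cos (real m * t)) {- pi<..pi} = torus_conv (tent h) (\<lambda>x. cos (real m * x)) 0"
    by (simp add: torus_conv_eq)
  also have "\<dots> = avg h (avg h (\<lambda>x. cos (real m * x))) 0"
    by (rule avg_avg_tent[OF periodic_L1_cos assms, symmetric])
  also have "\<dots> = (avg_symbol h m)\<^sup>2" unfolding e avg_cmult avg_cos[OF assms(1)] by (simp add: power2_eq_square)
  finally show ?thesis .
qed

text \<open>The identity operator has no kernel function, but it cancels: I - L(I - A) = A^2 - K(I -
  A), and the left-hand side here is the kernel of the latter. By \<open>mult_coeff_symbol\<close>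
  its coefficients vanish from frequency n on. Since both kernels are continuous and even, comparing
  cosine coefficients suffices.\<close>

lemma tent_kernel:
  assumes n: "1 \<le> n"
  defines "h \<equiv> 1 / real n"
  shows "\<exists>p. \<forall>t\<in>{- pi..pi}. tent h t - inv_kernel n t + avg h (inv_kernel n) t = (\<Sum>m<n. p m * cos (real m * t))"
proof -
  have "h \<le> 1" using n by (simp add: h_def)
  then have h: "0 < h" "h \<le> pi" using n pi_gt3 by (simp add: h_def, linarith)
  define a :: "nat \<Rightarrow> real" where "a m = (if m = 0 then 2 * pi else pi)" for m
  have a: "a m \<noteq> 0" for m by (simp add: a_def)
  define c1 where "c1 m = inv_kernel_coeff n m * (1 - avg_symbol h m)" for m
  define c where "c m = (avg_symbol h m)\<^sup>2 / a m" for m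
  define p where "p m = (if m < n then c m - c1 m else 0)" for m
  have ak: "a m * inv_kernel_coeff n m = mult_coeff n m" for m by (simp add: a_def inv_kernel_coeff_def)
  have cc: "c m = c1 m + p m" for m
  proof (cases "m < n")
    case False
    then have "a m * c1 m = (avg_symbol h m)\<^sup>2"
      using mult_coeff_symbol[OF n, of m] unfolding c1_def ak mult.assoc[symmetric] h_def by simp
    then show ?thesis using a[of m] False by (simp add: c_def p_def field_simps)
  qed (simp add: p_def)
  have s1: "summable (\<lambda>m. \<bar>c1 m\<bar>)"
  proof (rule summable_comparison_test)
    show "summable (\<lambda>m. 2 * \<bar>inv_kernel_coeff n m\<bar>)" by (intro summable_mult summable_inv_kernel_coeff n)
    have "\<bar>c1 m\<bar> \<le> 2 * \<bar>inv_kernel_coeff n m\<bar>" for m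
    proof -
      have "\<bar>1 - avg_symbol h m\<bar> \<le> 2" using avg_symbol_bound[of h m] by (simp add: abs_le_iff)
      then show ?thesis unfolding c1_def abs_mult using mult_left_mono[of "\<bar>1 - avg_symbol h m\<bar>" 2 "\<bar>inv_kernel_coeff n m\<bar>"]
        by (simp add: mult.commute)
    qed
    then show "\<exists>N. \<forall>m\<ge>N. norm \<bar>c1 m\<bar> \<le> 2 * \<bar>inv_kernel_coeff n m\<bar>" by auto
  qed
  have sp: "summable (\<lambda>m. \<bar>p m\<bar>)" by (rule summable_finite[of "{..<n}"]) (auto simp: p_def)
  have s: "summable (\<lambda>m. \<bar>c m\<bar>)"
    by (rule summable_comparison_test[OF _ summable_add[OF s1 sp]]) (auto simp: cc abs_triangle_ineq)
  have tc: "continuous_on UNIV (tent h)" unfolding tent_def[abs_def] using h by (auto intro!: continuous_intros)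
  have "tent h t - cos_series c t = 0" if t: "t \<in> {- pi..pi}" for t
  proof (rule even_continuous_eq_0[where D = "\<lambda>t. tent h t - cos_series c t", OF _ _ _ t])
    show "continuous_on UNIV (\<lambda>t. tent h t - cos_series c t)" by (intro continuous_intros tc continuous_cos_series s)
    show "tent h (- x) - cos_series c (- x) = tent h x - cos_series c x" for x by (simp add: tent_def cos_series_even)
    fix m :: nat
    have i: "set_integrable lborel {- pi<..pi} (\<lambda>t. tent h t * cos (real m * t))"
      "set_integrable lborel {- pi<..pi} (\<lambda>t. cos_series c t * cos (real m * t))"
      by (intro set_integrable_continuous continuous_intros tc continuous_cos_series s)+
    have "lint (\<lambda>t. (tent h t - cos_series c t) * cos (real m * t)) {- pi<..pi}
      = lint (\<lambda>t. tent h t * cos (real m * t)) {- pi<..pi} - lint (\<lambda>t. cos_series c t * cos (real m * t)) {- pi<..pi}"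
      using set_integral_diff(2)[OF i] by (simp add: left_diff_distrib)
    also have "\<dots> = 0" unfolding tent_cos[OF h] cos_series_coeff[OF s] a_def[symmetric] using a[of m] by (simp add: c_def)
    finally show "lint (\<lambda>t. (tent h t - cos_series c t) * cos (real m * t)) {- pi<..pi} = 0" .
  qed
  then have t: "tent h t = cos_series c t" if "t \<in> {- pi..pi}" for t using that by auto
  have "tent h t - inv_kernel n t + avg h (inv_kernel n) t = (\<Sum>m<n. p m * cos (real m * t))" if "t \<in> {- pi..pi}" for t
  proof -
    have sk: "summable (\<lambda>m. \<bar>inv_kernel_coeff n m * avg_symbol h m\<bar>)"
      by (rule summable_comparison_test[OF _ summable_inv_kernel_coeff[OF n]]) (auto simp: abs_mult mult_left_le avg_symbol_bound)
    have "cos_series c t = cos_series c1 t + cos_series p t"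
      unfolding cos_series_def cc distrib_right by (intro suminf_add[symmetric] summable_cser' s1 sp)
    moreover have "cos_series c1 t = inv_kernel n t - avg h (inv_kernel n) t"
      unfolding inv_kernel_def avg_cos_series[OF h(1) summable_inv_kernel_coeff[OF n]] unfolding cos_series_def c1_def
      by (subst suminf_diff[OF summable_cser'[OF summable_inv_kernel_coeff[OF n]] summable_cser'[OF sk]]) (simp add: algebra_simps)
    moreover have "cos_series p t = (\<Sum>m<n. p m * cos (real m * t))"
      unfolding cos_series_def by (rule suminf_finite) (auto simp: p_def)
    ultimately show ?thesis using t[OF that] by simp
  qed
  then show ?thesis by blast
qed

section \<open>Approximate inversion of the difference operator\<close>

lemma trig_polys_add:
  assumes "S \<in> trig_polys n" "T \<in> trig_polys n" shows "(\<lambda>x. S x + T x) \<in> trig_polys n"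
proof -
  obtain a b where S: "S = (\<lambda>x. \<Sum>j\<le>n. a j * cos (real j * x) + b j * sin (real j * x))" using assms by (auto simp: trig_polys_def)
  obtain c d where T: "T = (\<lambda>x. \<Sum>j\<le>n. c j * cos (real j * x) + d j * sin (real j * x))" using assms by (auto simp: trig_polys_def)
  show ?thesis unfolding trig_polys_def S T
    by (intro CollectI exI[of _ "\<lambda>j. a j + c j"] exI[of _ "\<lambda>j. b j + d j"]) (simp add: sum.distrib algebra_simps)
qed

lemma periodic_sin: "periodic (\<lambda>x. sin (real m * x))"
proof -
  have "periodic (sin :: real \<Rightarrow> real)" by (simp add: periodic_def)
  then have "sin (real m * (x + 2 * pi)) = sin (real m * x)" for x
    using periodic_of_int[of sin "real m * x" "int m"] by (simp add: algebra_simps)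
  then show ?thesis by (simp add: periodic_def)
qed

lemma periodic_L1_trig_poly:
  assumes "T \<in> trig_polys n" shows "periodic_L1 T"
proof -
  obtain a b where T: "T = (\<lambda>x. \<Sum>j\<le>n. a j * cos (real j * x) + b j * sin (real j * x))" using assms by (auto simp: trig_polys_def)
  have "periodic_L1 (\<lambda>x. sin (real j * x))" for j by (rule periodic_L1_bounded[where B = 1]) (auto intro: periodic_sin)
  then show ?thesis unfolding T by (intro periodic_L1_sum periodic_L1_add periodic_L1_cmult periodic_L1_cos)
qed

definition avg_diff :: "nat \<Rightarrow> (real \<Rightarrow> real) \<Rightarrow> real \<Rightarrow> real" where
  "avg_diff n f x = f x - avg (1 / real n) f x"

text \<open>The operator L of the overview: \<open>avg_diff n\<close> is I - A, and
  \<open>torus_conv (inv_kernel n)\<close> is K.\<close>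

definition avg_diff_inv :: "nat \<Rightarrow> (real \<Rightarrow> real) \<Rightarrow> real \<Rightarrow> real" where
  "avg_diff_inv n f x = f x + avg (1 / real n) f x + torus_conv (inv_kernel n) f x"

lemma inv_kernel_facts:
  assumes n: "1 \<le> n"
  shows "inv_kernel n \<in> borel_measurable borel" "periodic (inv_kernel n)" "\<And>t. inv_kernel n (- t) = inv_kernel n t"
    "\<exists>B. \<forall>t. \<bar>inv_kernel n t\<bar> \<le> B" "\<And>h t. 0 < h \<Longrightarrow> avg h (inv_kernel n) (- t) = avg h (inv_kernel n) t"
proof -
  show "inv_kernel n \<in> borel_measurable borel"
    unfolding inv_kernel_def by (intro borel_measurable_continuous_onI continuous_cos_series summable_inv_kernel_coeff n)
  show "periodic (inv_kernel n)" unfolding inv_kernel_def by (rule periodic_cos_series)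
  show "\<And>t. inv_kernel n (- t) = inv_kernel n t" unfolding inv_kernel_def by (rule cos_series_even)
  show "\<exists>B. \<forall>t. \<bar>inv_kernel n t\<bar> \<le> B" unfolding inv_kernel_def using cos_series_abs_le[OF summable_inv_kernel_coeff[OF n]] by blast
  show "\<And>h t. 0 < h \<Longrightarrow> avg h (inv_kernel n) (- t) = avg h (inv_kernel n) t"
    unfolding inv_kernel_def avg_cos_series[OF _ summable_inv_kernel_coeff[OF n]] by (rule cos_series_even)
qed

lemma kernel_inv_kernel: "1 \<le> n \<Longrightarrow> kernel (\<lambda>t. indicator {- pi<..pi} t * inv_kernel n t)"
  using inv_kernel_facts(1,4) kernel_torus_conv by metis

lemma periodic_L1_avg_diff: "periodic_L1 f \<Longrightarrow> 1 \<le> n \<Longrightarrow> periodic_L1 (avg_diff n f)"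
  unfolding avg_diff_def[abs_def] by (intro periodic_L1_diff periodic_L1_avg) auto

lemma periodic_L1_torus_conv_inv_kernel: "periodic_L1 f \<Longrightarrow> 1 \<le> n \<Longrightarrow> periodic_L1 (torus_conv (inv_kernel n) f)"
  unfolding torus_conv_def by (intro periodic_L1_kernel_op kernel_inv_kernel)

lemma periodic_L1_avg_diff_inv: "periodic_L1 f \<Longrightarrow> 1 \<le> n \<Longrightarrow> periodic_L1 (avg_diff_inv n f)"
  unfolding avg_diff_inv_def[abs_def] by (intro periodic_L1_add periodic_L1_avg periodic_L1_torus_conv_inv_kernel) auto

lemma avg_diff_avg_diff_inv_commute:
  assumes f: "periodic_L1 f" and n: "1 \<le> n"
  shows "avg_diff n (avg_diff_inv n f) = avg_diff_inv n (avg_diff n f)"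
proof
  fix x
  let ?h = "1 / real n"
  have h: "0 < ?h" using n by simp
  note K = kernel_inv_kernel[OF n] and Bx = kernel_box_kernel[OF h]
  have p: "periodic_L1 (avg ?h f)" "periodic_L1 (torus_conv (inv_kernel n) f)" "periodic_L1 (\<lambda>x. f x + avg ?h f x)"
    using f h n by (auto intro!: periodic_L1_avg periodic_L1_torus_conv_inv_kernel periodic_L1_add)
  have "avg ?h (avg_diff_inv n f) x = avg ?h f x + avg ?h (avg ?h f) x + avg ?h (torus_conv (inv_kernel n) f) x"
    unfolding avg_diff_inv_def[abs_def] using kernel_op_add[OF Bx p(3,2)] kernel_op_add[OF Bx f p(1)] by (simp add: avg_eq_kernel_op)
  moreover have "avg ?h (avg_diff n f) x = avg ?h f x - avg ?h (avg ?h f) x"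
    unfolding avg_diff_def[abs_def] using kernel_op_diff[OF Bx f p(1)] by (simp add: avg_eq_kernel_op)
  moreover have "torus_conv (inv_kernel n) (avg_diff n f) x = torus_conv (inv_kernel n) f x - torus_conv (inv_kernel n) (avg ?h f) x"
    unfolding avg_diff_def[abs_def] torus_conv_def using kernel_op_diff[OF K f p(1)] by simp
  moreover have "torus_conv (inv_kernel n) (avg ?h f) x = avg ?h (torus_conv (inv_kernel n) f) x"
    unfolding avg_eq_kernel_op torus_conv_def by (rule kernel_op_commute[OF K Bx f])
  ultimately show "avg_diff n (avg_diff_inv n f) x = avg_diff_inv n (avg_diff n f) x"
    by (simp add: avg_diff_def avg_diff_inv_def)
qed

text \<open>By \<open>tent_kernel\<close> the error f - L(I - A)f arises from a cosine polynomial
  kernel, and such an operator maps f to a trigonometric polynomial whose coefficients are cosine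
  and sine integrals of f.\<close>

lemma avg_diff_inv_avg_diff_approx:
  assumes f: "periodic_L1 f" and n: "1 \<le> n"
  shows "\<exists>T\<in>trig_polys n. avg_diff_inv n (avg_diff n f) = (\<lambda>x. f x - T x)"
proof -
  let ?h = "1 / real n" and ?I = "{- pi<..pi}"
  have "?h \<le> 1" using n by simp
  then have h: "0 < ?h" "?h \<le> pi" using n pi_gt3 by (simp, linarith)
  note K = kernel_inv_kernel[OF n] and Bx = kernel_box_kernel[OF h(1)] and kf = inv_kernel_facts[OF n]
  obtain B where B: "\<And>t. \<bar>inv_kernel n t\<bar> \<le> B" using kf(4) by auto
  obtain p where p: "\<And>t. t \<in> {- pi..pi} \<Longrightarrow> tent ?h t - inv_kernel n t + avg ?h (inv_kernel n) t = (\<Sum>m<n. p m * cos (real m * t))"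
    using tent_kernel[OF n] by auto
  have ps: "periodic_L1 (avg ?h f)" using periodic_L1_avg[OF f h(1)] .
  define U V where "U m = lint (\<lambda>z. cos (real m * z) * f z) ?I" and "V m = lint (\<lambda>z. sin (real m * z) * f z) ?I" for m
  have pc: "periodic_L1 (\<lambda>z. cos (real m * z) * f z)" "periodic_L1 (\<lambda>z. sin (real m * z) * f z)" for m
    by (rule periodic_L1_mult_bounded[OF f _ periodic_L1_periodic[OF periodic_L1_cos], of _ 1], auto) (rule periodic_L1_mult_bounded[OF f _ periodic_sin, of _ 1], auto)
  have Bf: "avg ?h (avg_diff n f) x = avg ?h f x - avg ?h (avg ?h f) x" "torus_conv (inv_kernel n) (avg_diff n f) x = torus_conv (inv_kernel n) f x - torus_conv (inv_kernel n) (avg ?h f) x" for x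
    unfolding avg_diff_def[abs_def] torus_conv_def using kernel_op_diff[OF Bx f ps] kernel_op_diff[OF K f ps] by (simp_all add: avg_eq_kernel_op)
  define T where "T x = (\<Sum>m<n. p m * (cos (real m * x) * U m + sin (real m * x) * V m))" for x
  have "f x - avg_diff_inv n (avg_diff n f) x = T x" for x
  proof -
    have cm: "set_integrable lborel ?I (\<lambda>t. k t * f (x + t))" if "kernel (\<lambda>t. indicator ?I t * k t)" for k
      using kernel_op_integrable[OF that f, of x] by (simp add: set_integrable_def mult.assoc)
    have kt: "kernel (\<lambda>t. indicator ?I t * tent ?h t)"
    proof (rule kernel_torus_conv[where B = "?h / ?h\<^sup>2"])
      show "tent ?h \<in> borel_measurable borel" unfolding tent_def[abs_def] by measurable
      show "\<bar>tent ?h t\<bar> \<le> ?h / ?h\<^sup>2" for t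
        using h(1) divide_right_mono[of "max 0 (?h - \<bar>t\<bar>)" ?h "?h\<^sup>2"] unfolding tent_def abs_divide by simp
    qed
    have ks: "kernel (\<lambda>t. indicator ?I t * avg ?h (inv_kernel n) t)"
      using avg_le_bound[OF periodic_L1_bounded[OF kf(1,2) B] h(1) B] kf(1) by (intro kernel_torus_conv[where B = B]) auto
    have kc: "kernel (\<lambda>t. indicator ?I t * cos (real m * t))" for m by (rule kernel_torus_conv[where B = 1]) auto
    have "f x - avg_diff_inv n (avg_diff n f) x = avg ?h (avg ?h f) x - torus_conv (inv_kernel n) f x + torus_conv (inv_kernel n) (avg ?h f) x"
      unfolding avg_diff_inv_def Bf by (simp add: avg_diff_def)
    also have "avg ?h (avg ?h f) x = torus_conv (tent ?h) f x" by (rule avg_avg_tent[OF f h])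
    also have "torus_conv (inv_kernel n) (avg ?h f) x = torus_conv (avg ?h (inv_kernel n)) f x"
      by (rule torus_conv_avg[OF f kf(1,2) B kf(3) kf(5)[OF h(1)] h(1)])
    also have "torus_conv (tent ?h) f x - torus_conv (inv_kernel n) f x + torus_conv (avg ?h (inv_kernel n)) f x
      = lint (\<lambda>t. tent ?h t * f (x + t) - inv_kernel n t * f (x + t) + avg ?h (inv_kernel n) t * f (x + t)) ?I"
      unfolding torus_conv_eq using cm[OF kt] cm[OF K] cm[OF ks] by simp
    also have "\<dots> = lint (\<lambda>t. \<Sum>m<n. p m * (cos (real m * t) * f (x + t))) ?I"
    proof (rule set_lebesgue_integral_cong)
      show "\<forall>t. t \<in> ?I \<longrightarrow> tent ?h t * f (x + t) - inv_kernel n t * f (x + t) + avg ?h (inv_kernel n) t * f (x + t)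
        = (\<Sum>m<n. p m * (cos (real m * t) * f (x + t)))"
      proof (intro allI impI)
        fix t assume t: "t \<in> ?I"
        have "tent ?h t * f (x + t) - inv_kernel n t * f (x + t) + avg ?h (inv_kernel n) t * f (x + t)
          = (tent ?h t - inv_kernel n t + avg ?h (inv_kernel n) t) * f (x + t)" by (simp add: algebra_simps)
        also have "\<dots> = (\<Sum>m<n. p m * (cos (real m * t) * f (x + t)))"
          using t by (subst p) (auto simp: sum_distrib_right mult.assoc)
        finally show "tent ?h t * f (x + t) - inv_kernel n t * f (x + t) + avg ?h (inv_kernel n) t * f (x + t)
          = (\<Sum>m<n. p m * (cos (real m * t) * f (x + t)))" .
      qed
    qed simp
    also have "\<dots> = (\<Sum>m<n. lint (\<lambda>t. p m * (cos (real m * t) * f (x + t))) ?I)"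
      by (intro lint_sum set_integrable_mult_right cm kc)
    also have "\<dots> = T x"
      unfolding T_def
    proof (intro sum.cong refl)
      fix m
      \<comment> \<open>Writing t as (x + t) - x separates the variables; the factors depending on x
        + t then integrate over a full period to \<open>U m\<close> and \<open>V m\<close>.\<close>
      have e: "cos (real m * t) = cos (real m * x) * cos (real m * (x + t)) + sin (real m * x) * sin (real m * (x + t))" for t
        using cos_diff[of "real m * (x + t)" "real m * x"] by (simp add: algebra_simps)
      have shift: "(LINT t:?I|lborel. G (x + t)) = lint G ?I" if G: "periodic_L1 G" for G
        using lint_shift[of "- pi" pi G x] lint_period[OF G, of "x - pi"] by (simp add: add_ac)
      have "lint (\<lambda>t. cos (real m * t) * f (x + t)) ?I
        = lint (\<lambda>t. cos (real m * x) * (cos (real m * (x + t)) * f (x + t)) + sin (real m * x) * (sin (real m * (x + t)) * f (x + t))) ?I"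
        by (subst e) (simp add: distrib_right mult.assoc)
      also have "\<dots> = cos (real m * x) * U m + sin (real m * x) * V m"
        unfolding U_def V_def
        using periodic_L1_int[OF periodic_L1_shift[OF pc(1)]] periodic_L1_int[OF periodic_L1_shift[OF pc(2)]] shift[OF pc(1)] shift[OF pc(2)]
        by (subst set_integral_add(2)) auto
      finally show "lint (\<lambda>t. p m * (cos (real m * t) * f (x + t))) ?I = p m * (cos (real m * x) * U m + sin (real m * x) * V m)"
        by simp
    qed
    finally show ?thesis .
  qed
  then have "avg_diff_inv n (avg_diff n f) = (\<lambda>x. f x - T x)" by (auto simp: fun_eq_iff algebra_simps)
  moreover have "T \<in> trig_polys n"
  proof -
    have "(\<Sum>m<n. p m * (cos (real m * x) * U m + sin (real m * x) * V m))
      = (\<Sum>m\<le>n. (if m < n then p m * U m else 0) * cos (real m * x) + (if m < n then p m * V m else 0) * sin (real m * x))" for x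
      by (intro sum.mono_neutral_cong_left) (auto simp: algebra_simps)
    then show ?thesis unfolding trig_polys_def T_def[abs_def] by auto
  qed
  ultimately show ?thesis by blast
qed

lemma periodic_L1_avg_diff_pow: "periodic_L1 f \<Longrightarrow> 1 \<le> n \<Longrightarrow> periodic_L1 ((avg_diff n ^^ r) f)"
  by (induction r) (auto intro: periodic_L1_avg_diff)

lemma periodic_L1_avg_diff_inv_pow: "periodic_L1 f \<Longrightarrow> 1 \<le> n \<Longrightarrow> periodic_L1 ((avg_diff_inv n ^^ r) f)"
  by (induction r) (auto intro: periodic_L1_avg_diff_inv)

lemma avg_diff_avg_diff_inv_pow: "periodic_L1 f \<Longrightarrow> 1 \<le> n \<Longrightarrow> avg_diff n ((avg_diff_inv n ^^ r) f) = (avg_diff_inv n ^^ r) (avg_diff n f)"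
  by (induction r) (auto simp: avg_diff_avg_diff_inv_commute periodic_L1_avg_diff_inv_pow)

text \<open>As L commutes with I - A, the newly added pair L(I - A) can be moved outermost. It is
  then applied to f - T and contributes one more polynomial of the same degree bound.\<close>

lemma avg_diff_inv_pow_avg_diff_pow_approx:
  assumes f: "periodic_L1 f" and n: "1 \<le> n"
  shows "\<exists>T\<in>trig_polys n. (avg_diff_inv n ^^ r) ((avg_diff n ^^ r) f) = (\<lambda>x. f x - T x)"
proof (induction r)
  case 0
  have "(\<lambda>x. 0) \<in> trig_polys n" unfolding trig_polys_def by (auto intro!: exI[of _ "\<lambda>j. 0"])
  then show ?case by (intro bexI[of _ "\<lambda>x. 0"]) auto
next
  case (Suc r)
  then obtain T where T: "T \<in> trig_polys n" "(avg_diff_inv n ^^ r) ((avg_diff n ^^ r) f) = (\<lambda>x. f x - T x)" by blast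
  have pT: "periodic_L1 (\<lambda>x. f x - T x)" by (intro periodic_L1_diff f periodic_L1_trig_poly[OF T(1)])
  obtain S where S: "S \<in> trig_polys n" "avg_diff_inv n (avg_diff n (\<lambda>x. f x - T x)) = (\<lambda>x. f x - T x - S x)"
    using avg_diff_inv_avg_diff_approx[OF pT n] by blast
  have "(avg_diff_inv n ^^ Suc r) ((avg_diff n ^^ Suc r) f) = avg_diff_inv n ((avg_diff_inv n ^^ r) (avg_diff n ((avg_diff n ^^ r) f)))" by simp
  also have "\<dots> = avg_diff_inv n (avg_diff n ((avg_diff_inv n ^^ r) ((avg_diff n ^^ r) f)))"
    using avg_diff_avg_diff_inv_pow[OF periodic_L1_avg_diff_pow[OF f n] n] by simp
  also have "\<dots> = (\<lambda>x. f x - (T x + S x))" unfolding T(2) S(2) by (simp add: algebra_simps)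
  finally show ?case using trig_polys_add[OF T(1) S(1)] by (intro bexI[of _ "\<lambda>x. T x + S x"])
qed

section \<open>Norm bounds for the approximate inverse\<close>

context weighted_orlicz
begin

text \<open>The kernel is dominated by a sum of boxes \<open>d i\<close> on windows of width
  \<open>u i\<close>, so the operator is dominated by Steklov means of |f| with weights
  \<open>d i * u i\<close>. These weights decay geometrically and have a sum independent of n, as
  \<open>N_avg_abs\<close> is uniform in the step.\<close>

lemma N_torus_conv_inv_kernel:
  "\<exists>c>0. \<forall>n\<ge>1. \<forall>f. periodic_L1 f \<longrightarrow> N (torus_conv (inv_kernel n) f) \<le> ennreal c * N f"
proof -
  obtain c where c: "c > 0" "\<And>n x. 1 \<le> n \<Longrightarrow> \<bar>inv_kernel n x\<bar> \<le> c * real n"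
    "\<And>n x. 1 \<le> n \<Longrightarrow> \<bar>x\<bar> \<le> pi \<Longrightarrow> x\<^sup>2 * \<bar>inv_kernel n x\<bar> \<le> c / real n"
    using inv_kernel_bound by blast
  have "N (torus_conv (inv_kernel n) f) \<le> ennreal (16 * c * norm_const) * N f" if n: "1 \<le> n" and f: "periodic_L1 f" for n f
  proof -
    note [measurable] = periodic_L1_meas[OF f] inv_kernel_facts(1)[OF n]
    have rn: "0 < real n" using n by simp
    \<comment> \<open>The i-th window is |t| < 2^i/n up to endpoints. If i > 0 is the least index
      whose window contains t, then |t| \<ge> 2^(i-1)/n, and the decay bound c/(n t^2) is at most 4
      c n/4^i = \<open>d i\<close>; for i = 0 the trivial bound c n suffices.\<close>
    define u where "u i = 2 * 2 ^ i / real n" for i :: nat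
    have u: "0 < u i" for i using rn by (simp add: u_def)
    define d where "d i = 4 * c * real n / 4 ^ i" for i :: nat
    have d: "0 \<le> d i" for i using c(1) by (simp add: d_def)
    define F where "F i x = 8 * c / 2 ^ i * avg (u i) (\<lambda>x. \<bar>f x\<bar>) x" for i x
    have du: "d i * u i = 8 * c / 2 ^ i" for i
    proof -
      have "(4::real) ^ i = 2 ^ i * 2 ^ i" by (simp add: power_mult_distrib[symmetric])
      then show ?thesis using rn by (simp add: d_def u_def)
    qed
    have kb: "\<exists>i. t \<in> {- u i / 2<..u i / 2} \<and> \<bar>inv_kernel n t\<bar> \<le> d i" if t: "t \<in> {- pi<..pi}" for t
    proof -
      have ex: "\<exists>i. \<bar>t\<bar> * real n < 2 ^ i"
        by (rule real_arch_pow) simp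
      define i where "i = (LEAST i. \<bar>t\<bar> * real n < 2 ^ i)"
      have i: "\<bar>t\<bar> * real n < 2 ^ i" unfolding i_def using LeastI_ex[OF ex] .
      then have "\<bar>t\<bar> < 2 ^ i / real n" using rn by (simp add: pos_less_divide_eq)
      then have mem: "t \<in> {- u i / 2<..u i / 2}" by (auto simp: u_def)
      have "\<bar>inv_kernel n t\<bar> \<le> d i"
      proof (cases i)
        case 0
        have "c * real n \<le> d i" using 0 c(1) rn by (simp add: d_def)
        then show ?thesis using c(2)[OF n, of t] by linarith
      next
        case (Suc l)
        have "\<not> \<bar>t\<bar> * real n < 2 ^ l" using not_less_Least[of l "\<lambda>i. \<bar>t\<bar> * real n < 2 ^ i"] Suc unfolding i_def by simp
        then have "(2 ^ l)\<^sup>2 \<le> (\<bar>t\<bar> * real n)\<^sup>2" by (intro power_mono) auto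
        then have lo: "4 ^ l \<le> t\<^sup>2 * (real n)\<^sup>2"
        proof -
          have "((2::real) ^ l)\<^sup>2 = 4 ^ l" by (simp add: power2_eq_square power_mult_distrib[symmetric])
          then show ?thesis using \<open>(2 ^ l)\<^sup>2 \<le> (\<bar>t\<bar> * real n)\<^sup>2\<close> by (simp add: power_mult_distrib)
        qed
        have "4 ^ l * \<bar>inv_kernel n t\<bar> \<le> (real n)\<^sup>2 * (t\<^sup>2 * \<bar>inv_kernel n t\<bar>)"
          using mult_right_mono[OF lo, of "\<bar>inv_kernel n t\<bar>"] by (simp add: mult_ac)
        also have "\<dots> \<le> (real n)\<^sup>2 * (c / real n)"
          using c(3)[OF n, of t] t by (intro mult_left_mono) auto
        also have "\<dots> = c * real n" using rn by (simp add: power2_eq_square)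
        finally show ?thesis using Suc by (simp add: d_def field_simps)
      qed
      then show ?thesis using mem by blast
    qed
    have le: "ennreal \<bar>torus_conv (inv_kernel n) f x\<bar> \<le> (\<Sum>i. ennreal \<bar>F i x\<bar>)" for x
    proof -
      have "\<bar>torus_conv (inv_kernel n) f x\<bar> \<le> (\<integral>t. \<bar>(indicator {- pi<..pi} t * inv_kernel n t) * f (x + t)\<bar> \<partial>lborel)"
        unfolding torus_conv_def kernel_op_def by (rule integral_abs_bound)
      then have "ennreal \<bar>torus_conv (inv_kernel n) f x\<bar> \<le> ennreal (\<integral>t. \<bar>(indicator {- pi<..pi} t * inv_kernel n t) * f (x + t)\<bar> \<partial>lborel)"
        by (rule ennreal_leI)
      also have "\<dots> = (\<integral>\<^sup>+t. ennreal \<bar>(indicator {- pi<..pi} t * inv_kernel n t) * f (x + t)\<bar> \<partial>lborel)"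
        by (intro nn_integral_eq_integral[symmetric] integrable_abs kernel_op_integrable[OF kernel_inv_kernel[OF n] f]) auto
      also have "\<dots> \<le> (\<integral>\<^sup>+t. (\<Sum>i. ennreal (d i) * (ennreal \<bar>f (x + t)\<bar> * indicator {- u i / 2<..u i / 2} t)) \<partial>lborel)"
      proof (rule nn_integral_mono)
        fix t
        show "ennreal \<bar>(indicator {- pi<..pi} t * inv_kernel n t) * f (x + t)\<bar> \<le> (\<Sum>i. ennreal (d i) * (ennreal \<bar>f (x + t)\<bar> * indicator {- u i / 2<..u i / 2} t))"
        proof (cases "t \<in> {- pi<..pi}")
          case True
          from kb[OF this] obtain i where i: "t \<in> {- u i / 2<..u i / 2}" "\<bar>inv_kernel n t\<bar> \<le> d i" by blast
          have "ennreal \<bar>(indicator {- pi<..pi} t * inv_kernel n t) * f (x + t)\<bar> = ennreal (\<bar>inv_kernel n t\<bar> * \<bar>f (x + t)\<bar>)"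
            using True by (simp add: abs_mult)
          also have "\<dots> \<le> ennreal (d i * \<bar>f (x + t)\<bar>)" using i by (intro ennreal_leI mult_right_mono) auto
          also have "\<dots> = (\<Sum>j\<in>{i}. ennreal (d j) * (ennreal \<bar>f (x + t)\<bar> * indicator {- u j / 2<..u j / 2} t))"
            using i d[of i] by (simp add: ennreal_mult)
          also have "\<dots> \<le> (\<Sum>j. ennreal (d j) * (ennreal \<bar>f (x + t)\<bar> * indicator {- u j / 2<..u j / 2} t))"
            by (rule sum_le_suminf) auto
          finally show ?thesis .
        qed simp
      qed
      also have "\<dots> = (\<Sum>i. \<integral>\<^sup>+t. ennreal (d i) * (ennreal \<bar>f (x + t)\<bar> * indicator {- u i / 2<..u i / 2} t) \<partial>lborel)"
        by (rule nn_integral_suminf) measurable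
      also have "\<dots> = (\<Sum>i. ennreal \<bar>F i x\<bar>)"
      proof (rule suminf_cong)
        fix i
        have "(\<integral>\<^sup>+t. ennreal (d i) * (ennreal \<bar>f (x + t)\<bar> * indicator {- u i / 2<..u i / 2} t) \<partial>lborel)
          = ennreal (d i) * (\<integral>\<^sup>+t\<in>{- u i / 2<..u i / 2}. ennreal \<bar>f (t + x)\<bar> \<partial>lborel)"
          by (subst nn_integral_cmult) (auto simp: add.commute)
        also have "(\<integral>\<^sup>+t\<in>{- u i / 2<..u i / 2}. ennreal \<bar>f (t + x)\<bar> \<partial>lborel) = (\<integral>\<^sup>+t\<in>{x - u i / 2<..x + u i / 2}. ennreal \<bar>f t\<bar> \<partial>lborel)"
          using nn_integral_Ioc_shift[of "\<lambda>t. ennreal \<bar>f t\<bar>" "- u i / 2" x "u i / 2"] by (simp add: add.commute)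
        also have "\<dots> = ennreal (u i * avg (u i) (\<lambda>x. \<bar>f x\<bar>) x)"
          using ennreal_avg[OF periodic_L1_abs[OF f] _ u[of i], of x] by simp
        also have "ennreal (d i) * \<dots> = ennreal \<bar>F i x\<bar>"
          using avg_nonneg[OF u[of i], of "\<lambda>x. \<bar>f x\<bar>" x] u[of i] d[of i] c(1)
          by (simp add: ennreal_mult[symmetric] F_def du[symmetric] mult.assoc)
        finally show "(\<integral>\<^sup>+t. ennreal (d i) * (ennreal \<bar>f (x + t)\<bar> * indicator {- u i / 2<..u i / 2} t) \<partial>lborel) = ennreal \<bar>F i x\<bar>" .
      qed
      finally show ?thesis .
    qed
    have Fm: "F i \<in> borel_measurable borel" for i unfolding F_def[abs_def] by measurable
    have "N (torus_conv (inv_kernel n) f) \<le> (\<Sum>i. N (F i))" by (rule N_suminf[OF Fm le])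
    also have "\<dots> \<le> (\<Sum>i. ennreal (8 * c * (1 / 2) ^ i) * (ennreal norm_const * N f))"
    proof (intro suminf_le)
      fix i
      have "N (F i) = ennreal (8 * c * (1 / 2) ^ i) * N (avg (u i) (\<lambda>x. \<bar>f x\<bar>))"
        unfolding F_def[abs_def] using c(1) by (subst N_cmult) (auto simp: power_divide)
      also have "\<dots> \<le> ennreal (8 * c * (1 / 2) ^ i) * (ennreal norm_const * N f)"
        by (intro mult_left_mono N_avg_abs[OF f u]) auto
      finally show "N (F i) \<le> ennreal (8 * c * (1 / 2) ^ i) * (ennreal norm_const * N f)" .
    qed auto
    also have "\<dots> = (\<Sum>i. ennreal (8 * c * (1 / 2) ^ i)) * (ennreal norm_const * N f)" by simp
    also have "(\<Sum>i. ennreal (8 * c * (1 / 2) ^ i)) = ennreal (8 * c * (1 / (1 - 1 / 2)))"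
      by (intro suminf_ennreal_eq sums_mult geometric_sums) (use c(1) in auto)
    also have "ennreal (8 * c * (1 / (1 - 1 / 2))) * (ennreal norm_const * N f) = ennreal (16 * c * norm_const) * N f"
      using c(1) norm_const by (simp add: ennreal_mult mult.assoc)
    finally show ?thesis .
  qed
  moreover have "0 < 16 * c * norm_const" using c(1) norm_const by simp
  ultimately show ?thesis by blast
qed

lemma N_avg_diff_inv: "\<exists>c>0. \<forall>n\<ge>1. \<forall>f. periodic_L1 f \<longrightarrow> N (avg_diff_inv n f) \<le> ennreal c * N f"
proof -
  obtain c where c: "c > 0" "\<And>n f. 1 \<le> n \<Longrightarrow> periodic_L1 f \<Longrightarrow> N (torus_conv (inv_kernel n) f) \<le> ennreal c * N f"
    using N_torus_conv_inv_kernel by blast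
  have "N (avg_diff_inv n f) \<le> ennreal (1 + norm_const + c) * N f" if n: "1 \<le> n" and f: "periodic_L1 f" for n f
  proof -
    have h: "0 < 1 / real n" using n by simp
    note m = periodic_L1_meas[OF f] periodic_L1_meas[OF periodic_L1_avg[OF f h]] periodic_L1_meas[OF periodic_L1_torus_conv_inv_kernel[OF f n]]
    have "N (avg_diff_inv n f) \<le> N (\<lambda>x. f x + avg (1 / real n) f x) + N (torus_conv (inv_kernel n) f)"
      unfolding avg_diff_inv_def[abs_def] using m by (intro N_add borel_measurable_add)
    also have "\<dots> \<le> (N f + N (avg (1 / real n) f)) + N (torus_conv (inv_kernel n) f)"
      using m by (intro add_mono N_add) auto
    also have "\<dots> \<le> (N f + ennreal norm_const * N f) + ennreal c * N f"
      using N_avg_pow[OF f h, of 1] c(2)[OF n f] by (intro add_mono) auto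
    also have "\<dots> = ennreal (1 + norm_const + c) * N f"
      using norm_const c(1) by (simp add: distrib_right ennreal_plus)
    finally show ?thesis .
  qed
  then show ?thesis using c(1) norm_const by (intro exI[of _ "1 + norm_const + c"]) auto
qed

theorem best_approx_le_avg_diff_pow:
  "\<exists>c>0. \<forall>n\<ge>1. \<forall>f. periodic_L1 f \<longrightarrow> best_approx \<phi> W n f \<le> ennreal c * N ((avg_diff n ^^ r) f)"
proof -
  obtain c where c: "c > 0" "\<And>n f. 1 \<le> n \<Longrightarrow> periodic_L1 f \<Longrightarrow> N (avg_diff_inv n f) \<le> ennreal c * N f"
    using N_avg_diff_inv by blast
  have pw: "N ((avg_diff_inv n ^^ j) g) \<le> ennreal (c ^ j) * N g" if n: "1 \<le> n" and g: "periodic_L1 g" for n g j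
  proof (induction j)
    case (Suc j)
    have "N (avg_diff_inv n ((avg_diff_inv n ^^ j) g)) \<le> ennreal c * N ((avg_diff_inv n ^^ j) g)" by (intro c n periodic_L1_avg_diff_inv_pow g)
    also have "\<dots> \<le> ennreal c * (ennreal (c ^ j) * N g)" using Suc by (intro mult_left_mono) auto
    finally show ?case using c(1) by (simp add: ennreal_mult mult.assoc)
  qed simp
  have "best_approx \<phi> W n f \<le> ennreal (c ^ r) * N ((avg_diff n ^^ r) f)" if n: "1 \<le> n" and f: "periodic_L1 f" for n f
  proof -
    obtain T where T: "T \<in> trig_polys n" "(avg_diff_inv n ^^ r) ((avg_diff n ^^ r) f) = (\<lambda>x. f x - T x)"
      using avg_diff_inv_pow_avg_diff_pow_approx[OF f n] by blast
    have "best_approx \<phi> W n f \<le> N (\<lambda>x. f x - T x)" unfolding best_approx_def by (rule INF_lower[OF T(1)])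
    also have "\<dots> \<le> ennreal (c ^ r) * N ((avg_diff n ^^ r) f)"
      unfolding T(2)[symmetric] by (rule pw[OF n periodic_L1_avg_diff_pow[OF f n]])
    finally show ?thesis .
  qed
  then show ?thesis using c(1) by (intro exI[of _ "c ^ r"]) auto
qed

end

section \<open>Fractional differences\<close>

text \<open>In Pascal's rule for k gchoose (j + 1), the two summands have opposite signs once j
  \<ge> k, and the second is the smaller in absolute value. Absolute values therefore subtract, and
  their sums telescope.\<close>

lemma abs_gbinomial_telescope:
  fixes k :: real
  assumes "0 \<le> k" "k \<le> real j"
  shows "\<bar>k gchoose Suc j\<bar> = \<bar>(k - 1) gchoose j\<bar> - \<bar>(k - 1) gchoose Suc j\<bar>"
proof -
  have s: "(k - 1) gchoose Suc j = ((k - 1) gchoose j) * ((k - 1 - real j) / real (Suc j))"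
  proof -
    have "real (Suc j) * ((k - 1) gchoose Suc j) = (k - 1 - real j) * ((k - 1) gchoose j)"
      using gbinomial_mult_1[of "k - 1" j] by (simp add: left_diff_distrib)
    then show ?thesis by (simp add: field_simps del: of_nat_Suc)
  qed
  have t: "k gchoose Suc j = ((k - 1) gchoose j) * (k / real (Suc j))"
    using gbinomial_rec[of "k - 1" j] by simp
  have "\<bar>(k - 1) gchoose Suc j\<bar> = \<bar>(k - 1) gchoose j\<bar> * ((real j + 1 - k) / real (Suc j))"
    unfolding s abs_mult using assms by (simp add: abs_divide)
  also have "(real j + 1 - k) / real (Suc j) = 1 - k / real (Suc j)" by (simp add: field_simps)
  finally have "\<bar>(k - 1) gchoose Suc j\<bar> = \<bar>(k - 1) gchoose j\<bar> - \<bar>(k - 1) gchoose j\<bar> * (k / real (Suc j))"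
    by (simp add: right_diff_distrib)
  moreover have "\<bar>k gchoose Suc j\<bar> = \<bar>(k - 1) gchoose j\<bar> * (k / real (Suc j))"
    unfolding t abs_mult using assms by simp
  ultimately show ?thesis by simp
qed

lemma summable_abs_gbinomial:
  fixes k :: real
  assumes k: "0 \<le> k"
  shows "summable (\<lambda>j. \<bar>k gchoose j\<bar>)"
proof -
  define J where "J = nat \<lceil>k\<rceil>"
  have J: "k \<le> real J" by (simp add: J_def real_nat_ceiling_ge)
  have "summable (\<lambda>j. \<bar>k gchoose (j + Suc J)\<bar>)"
  proof (rule bounded_imp_summable)
    fix M
    have "(\<Sum>j\<le>M. \<bar>k gchoose (j + Suc J)\<bar>) = (\<Sum>j<Suc M. \<bar>(k - 1) gchoose (j + J)\<bar> - \<bar>(k - 1) gchoose (Suc j + J)\<bar>)"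
      unfolding lessThan_Suc_atMost using k J by (intro sum.cong) (auto simp: abs_gbinomial_telescope)
    also have "\<dots> = \<bar>(k - 1) gchoose (0 + J)\<bar> - \<bar>(k - 1) gchoose (Suc M + J)\<bar>"
      by (rule sum_lessThan_telescope')
    finally show "(\<Sum>j\<le>M. \<bar>k gchoose (j + Suc J)\<bar>) \<le> \<bar>(k - 1) gchoose J\<bar>" by simp
  qed simp
  then show ?thesis by (subst (asm) summable_iff_shift)
qed

definition frac_coeff :: "real \<Rightarrow> nat \<Rightarrow> real" where "frac_coeff k j = (- 1) ^ j * (k gchoose j)"

lemma summable_frac_coeff: "0 \<le> k \<Longrightarrow> summable (\<lambda>j. \<bar>frac_coeff k j\<bar>)"
  using summable_abs_gbinomial by (simp add: frac_coeff_def abs_mult power_abs)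

lemma frac_coeff_convolution: "(\<Sum>j\<le>i. frac_coeff s j * frac_coeff k (i - j)) = frac_coeff (s + k) i"
proof -
  have "(\<Sum>j\<le>i. frac_coeff s j * frac_coeff k (i - j)) = (\<Sum>j\<le>i. (- 1) ^ i * ((s gchoose j) * (k gchoose (i - j))))"
  proof (rule sum.cong)
    fix j assume "j \<in> {..i}"
    then have "(- 1) ^ i = (- 1) ^ j * (- 1 :: real) ^ (i - j)" by (simp add: power_add[symmetric])
    then show "frac_coeff s j * frac_coeff k (i - j) = (- 1) ^ i * ((s gchoose j) * (k gchoose (i - j)))"
      by (simp add: frac_coeff_def mult_ac)
  qed simp
  also have "\<dots> = frac_coeff (s + k) i"
    using gbinomial_Vandermonde[of s k i] by (simp add: frac_coeff_def sum_distrib_left[symmetric] atLeast0AtMost)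
  finally show ?thesis .
qed

lemma square_minus_triangle:
  fixes f :: "nat \<Rightarrow> nat \<Rightarrow> real"
  shows "(\<Sum>j<M. \<Sum>l<M. f j l) = (\<Sum>i<M. \<Sum>j\<le>i. f j (i - j)) + (\<Sum>(j, l)\<in>{..<M} \<times> {..<M} - {(j, l). j + l < M}. f j l)"
proof -
  have sub: "{(j, l). j + l < M} \<subseteq> {..<M} \<times> {..<M}" by auto
  have "(\<Sum>(j, l)\<in>{..<M} \<times> {..<M}. f j l) = (\<Sum>(j, l)\<in>{..<M} \<times> {..<M} - {(j, l). j + l < M}. f j l) + (\<Sum>(j, l)\<in>{(j, l). j + l < M}. f j l)"
    using sub by (intro sum.subset_diff) auto
  then show ?thesis by (simp add: sum.cartesian_product sum.triangle_reindex)
qed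

text \<open>The absolute error made when the M-th partial sum of a Cauchy product is replaced by the
  product of the M-th partial sums.\<close>

definition off_triangle_sum :: "(nat \<Rightarrow> real) \<Rightarrow> (nat \<Rightarrow> real) \<Rightarrow> nat \<Rightarrow> real" where
  "off_triangle_sum b a M = (\<Sum>(j, l)\<in>{..<M} \<times> {..<M} - {(j, l). j + l < M}. \<bar>b j\<bar> * \<bar>a l\<bar>)"

lemma off_triangle_sum_tendsto_0:
  assumes a: "summable (\<lambda>j. \<bar>a j\<bar>)" and b: "summable (\<lambda>j. \<bar>b j\<bar>)"
  shows "off_triangle_sum b a \<longlonglongrightarrow> 0"
proof -
  have eq: "off_triangle_sum b a = (\<lambda>M. (\<Sum>j<M. \<bar>b j\<bar>) * (\<Sum>l<M. \<bar>a l\<bar>) - (\<Sum>i<M. \<Sum>j\<le>i. \<bar>b j\<bar> * \<bar>a (i - j)\<bar>))"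
    using square_minus_triangle[of "\<lambda>j l. \<bar>b j\<bar> * \<bar>a l\<bar>"] by (simp add: fun_eq_iff off_triangle_sum_def sum_product)
  have "(\<lambda>M. (\<Sum>j<M. \<bar>b j\<bar>) * (\<Sum>l<M. \<bar>a l\<bar>) - (\<Sum>i<M. \<Sum>j\<le>i. \<bar>b j\<bar> * \<bar>a (i - j)\<bar>))
    \<longlonglongrightarrow> (\<Sum>j. \<bar>b j\<bar>) * (\<Sum>l. \<bar>a l\<bar>) - (\<Sum>j. \<bar>b j\<bar>) * (\<Sum>l. \<bar>a l\<bar>)"
    using Cauchy_product_sums[of "\<lambda>j. \<bar>b j\<bar>" "\<lambda>j. \<bar>a j\<bar>"] a b
    by (intro tendsto_diff tendsto_mult summable_LIMSEQ) (auto simp: sums_def)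
  then show ?thesis unfolding eq by simp
qed

lemma avg_sum:
  assumes "\<And>i. i \<in> I \<Longrightarrow> periodic_L1 (g i)"
  shows "avg u (\<lambda>x. \<Sum>i\<in>I. c i * g i x) x = (\<Sum>i\<in>I. c i * avg u (g i) x)"
  unfolding avg_def using assms
  by (subst lint_sum) (auto intro: periodic_L1_int simp: sum_divide_distrib)

lemma avg_pow_sum:
  assumes "\<And>i. i \<in> I \<Longrightarrow> periodic_L1 (g i)" and u: "0 < u"
  shows "(avg u ^^ j) (\<lambda>x. \<Sum>i\<in>I. c i * g i x) x = (\<Sum>i\<in>I. c i * (avg u ^^ j) (g i) x)"
proof (induction j arbitrary: x)
  case (Suc j)
  have "(avg u ^^ Suc j) (\<lambda>x. \<Sum>i\<in>I. c i * g i x) x = avg u (\<lambda>x. \<Sum>i\<in>I. c i * (avg u ^^ j) (g i) x) x"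
    by (simp add: Suc[abs_def] fun_eq_iff[symmetric])
  also have "\<dots> = (\<Sum>i\<in>I. c i * avg u ((avg u ^^ j) (g i)) x)"
    using assms by (intro avg_sum periodic_L1_avg_pow) auto
  finally show ?case by simp
qed simp

definition frac_sum :: "real \<Rightarrow> real \<Rightarrow> nat \<Rightarrow> (real \<Rightarrow> real) \<Rightarrow> real \<Rightarrow> real" where
  "frac_sum k h M f x = (\<Sum>j<M. frac_coeff k j * (avg h ^^ j) f x)"

lemma periodic_L1_frac_sum: "periodic_L1 f \<Longrightarrow> 0 < h \<Longrightarrow> periodic_L1 (frac_sum k h M f)"
  unfolding frac_sum_def[abs_def] by (intro periodic_L1_sum periodic_L1_cmult periodic_L1_avg_pow)

lemma frac_coeff_nat_eq_0: "r < i \<Longrightarrow> frac_coeff (real r) i = 0"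
  using binomial_gbinomial[of r i, where ?'a = real] binomial_eq_0[of r i] by (simp add: frac_coeff_def)

lemma avg_diff_pow_eq:
  assumes f: "periodic_L1 f" and n: "1 \<le> n"
  shows "(avg_diff n ^^ r) f x = (\<Sum>i\<le>r. frac_coeff (real r) i * (avg (1 / real n) ^^ i) f x)"
proof (induction r arbitrary: x)
  case 0
  then show ?case by (simp add: frac_coeff_def)
next
  case (Suc r)
  let ?h = "1 / real n"
  define y where "y i = (avg ?h ^^ i) f" for i
  have h: "0 < ?h" using n by simp
  have py: "periodic_L1 (y i)" for i unfolding y_def using f h by (rule periodic_L1_avg_pow)
  have Bf: "(avg_diff n ^^ r) f = (\<lambda>x. \<Sum>i\<le>r. frac_coeff (real r) i * y i x)" using Suc by (auto simp: y_def)
  have "(avg_diff n ^^ Suc r) f x = (\<Sum>i\<le>r. frac_coeff (real r) i * y i x) - avg ?h (\<lambda>x. \<Sum>i\<le>r. frac_coeff (real r) i * y i x) x"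
    using Bf by (simp add: avg_diff_def)
  also have "avg ?h (\<lambda>x. \<Sum>i\<le>r. frac_coeff (real r) i * y i x) x = (\<Sum>i\<le>r. frac_coeff (real r) i * avg ?h (y i) x)"
    by (rule avg_sum[OF py])
  also have "\<dots> = (\<Sum>i\<le>r. frac_coeff (real r) i * y (Suc i) x)" by (simp add: y_def)
  also have "(\<Sum>i\<le>r. frac_coeff (real r) i * y i x) = (\<Sum>i\<le>Suc r. frac_coeff (real r) i * y i x)"
    by (simp add: frac_coeff_nat_eq_0)
  also have "\<dots> = frac_coeff (real r) 0 * y 0 x + (\<Sum>i\<le>r. frac_coeff (real r) (Suc i) * y (Suc i) x)"
    by (rule sum.atMost_Suc_shift)
  also have "frac_coeff (real r) 0 * y 0 x + (\<Sum>i\<le>r. frac_coeff (real r) (Suc i) * y (Suc i) x) - (\<Sum>i\<le>r. frac_coeff (real r) i * y (Suc i) x)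
    = frac_coeff (real (Suc r)) 0 * y 0 x + (\<Sum>i\<le>r. frac_coeff (real (Suc r)) (Suc i) * y (Suc i) x)"
  proof -
    have "frac_coeff (real (Suc r)) (Suc i) = frac_coeff (real r) (Suc i) - frac_coeff (real r) i" for i
      using gbinomial_Suc_Suc[of "real r" i] by (simp add: frac_coeff_def algebra_simps)
    then show ?thesis by (simp add: frac_coeff_def sum_subtractf left_diff_distrib)
  qed
  also have "\<dots> = (\<Sum>i\<le>Suc r. frac_coeff (real (Suc r)) i * y i x)" by (rule sum.atMost_Suc_shift[symmetric])
  finally show ?case by (simp add: y_def)
qed

lemma frac_sum_frac_sum:
  assumes f: "periodic_L1 f" and h: "0 < h"
  shows "frac_sum s h M (frac_sum k h M f) x = (\<Sum>j<M. \<Sum>l<M. frac_coeff s j * frac_coeff k l * (avg h ^^ (j + l)) f x)"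
proof -
  have "(avg h ^^ j) (frac_sum k h M f) x = (\<Sum>l<M. frac_coeff k l * (avg h ^^ (j + l)) f x)" for j
    unfolding frac_sum_def[abs_def] using f h by (subst avg_pow_sum) (auto intro: periodic_L1_avg_pow simp: funpow_add)
  then show ?thesis unfolding frac_sum_def[of s] by (simp add: sum_distrib_left mult.assoc)
qed

text \<open>One averaging makes an integrable periodic function bounded, and further means keep the
  bound. The power 0 is excluded because f itself may be unbounded.\<close>

lemma avg_pow_bounded:
  assumes f: "periodic_L1 f" and h: "0 < h"
  shows "\<exists>B\<ge>0. \<forall>j\<ge>1. \<forall>x. \<bar>(avg h ^^ j) f x\<bar> \<le> B"
proof -
  obtain B where B: "\<And>x. \<bar>avg h f x\<bar> \<le> B" using avg_bounded[OF f h] by blast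
  have "\<bar>(avg h ^^ Suc j) f x\<bar> \<le> B" for j x
  proof (induction j arbitrary: x)
    case (Suc j)
    have "\<bar>avg h ((avg h ^^ Suc j) f) x\<bar> \<le> B" by (rule avg_le_bound[OF periodic_L1_avg_pow[OF f h] h Suc])
    then show ?case by simp
  qed (use B in simp)
  then have "\<bar>(avg h ^^ j) f x\<bar> \<le> B" if "1 \<le> j" for j x using that by (cases j) auto
  moreover have "0 \<le> B" using B[of 0] by linarith
  ultimately show ?thesis by blast
qed

text \<open>On the triangle j + l < M, the Vandermonde identity reproduces the binomial coefficients
  of (I - A)^r exactly; none is lost since r < M. Off the triangle j + l \<ge> M \<ge> 1, so f
  itself does not occur and every term is bounded by B.\<close>

lemma frac_sum_frac_sum_approx:
  assumes f: "periodic_L1 f" and n: "1 \<le> n" and sk: "s + k = real r" and M: "r < M"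
    and B: "0 \<le> B" "\<And>j x. 1 \<le> j \<Longrightarrow> \<bar>(avg (1 / real n) ^^ j) f x\<bar> \<le> B"
  shows "\<bar>(avg_diff n ^^ r) f x - frac_sum s (1 / real n) M (frac_sum k (1 / real n) M f) x\<bar> \<le> off_triangle_sum (frac_coeff s) (frac_coeff k) M * B"
proof -
  let ?h = "1 / real n"
  let ?S = "{..<M} \<times> {..<M} - {(j, l). j + l < M}"
  have h: "0 < ?h" using n by simp
  have "frac_sum s ?h M (frac_sum k ?h M f) x = (\<Sum>i<M. \<Sum>j\<le>i. frac_coeff s j * frac_coeff k (i - j) * (avg ?h ^^ (j + (i - j))) f x)
    + (\<Sum>(j, l)\<in>?S. frac_coeff s j * frac_coeff k l * (avg ?h ^^ (j + l)) f x)"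
    unfolding frac_sum_frac_sum[OF f h] by (rule square_minus_triangle)
  also have "(\<Sum>i<M. \<Sum>j\<le>i. frac_coeff s j * frac_coeff k (i - j) * (avg ?h ^^ (j + (i - j))) f x) = (\<Sum>i<M. frac_coeff (real r) i * (avg ?h ^^ i) f x)"
    by (intro sum.cong refl) (simp add: sum_distrib_right[symmetric] frac_coeff_convolution sk)
  also have "\<dots> = (\<Sum>i\<le>r. frac_coeff (real r) i * (avg ?h ^^ i) f x)"
    using M by (intro sum.mono_neutral_right) (auto simp: frac_coeff_nat_eq_0)
  also have "\<dots> = (avg_diff n ^^ r) f x" by (rule avg_diff_pow_eq[OF f n, symmetric])
  finally have "\<bar>(avg_diff n ^^ r) f x - frac_sum s ?h M (frac_sum k ?h M f) x\<bar> = \<bar>\<Sum>(j, l)\<in>?S. frac_coeff s j * frac_coeff k l * (avg ?h ^^ (j + l)) f x\<bar>"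
    by simp
  also have "\<dots> \<le> (\<Sum>p\<in>?S. \<bar>case p of (j, l) \<Rightarrow> frac_coeff s j * frac_coeff k l * (avg ?h ^^ (j + l)) f x\<bar>)" by (rule sum_abs)
  also have "\<dots> \<le> (\<Sum>p\<in>?S. (case p of (j, l) \<Rightarrow> \<bar>frac_coeff s j\<bar> * \<bar>frac_coeff k l\<bar>) * B)"
  proof (rule sum_mono)
    fix p assume p: "p \<in> ?S"
    obtain j l where jl: "p = (j, l)" by (cases p)
    have "1 \<le> j + l" using p M by (auto simp: jl)
    then show "\<bar>case p of (j, l) \<Rightarrow> frac_coeff s j * frac_coeff k l * (avg ?h ^^ (j + l)) f x\<bar> \<le> (case p of (j, l) \<Rightarrow> \<bar>frac_coeff s j\<bar> * \<bar>frac_coeff k l\<bar>) * B"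
      using B(2)[of "j + l" x] by (auto simp: jl abs_mult intro!: mult_left_mono)
  qed
  also have "\<dots> = off_triangle_sum (frac_coeff s) (frac_coeff k) M * B" by (simp add: off_triangle_sum_def sum_distrib_right)
  finally show ?thesis .
qed

section \<open>Norm convergence of the fractional differences\<close>

context weighted_orlicz
begin

lemma W_nn_integral_finite: "(\<integral>\<^sup>+x\<in>{0..2 * pi}. ennreal (W x) \<partial>lborel) < \<infinity>"
proof -
  have "(\<integral>\<^sup>+x\<in>{0..2 * pi}. ennreal (W x) \<partial>lborel) = (\<integral>\<^sup>+x. ennreal (indicator {0<..2 * pi} x * W x) \<partial>lborel)"
    unfolding nn_integral_Icc_Ioc by (intro nn_integral_cong) (auto simp: indicator_def)
  also have "\<dots> < \<infinity>"
    using W_int[of 0 "2 * pi"] W_pos[THEN less_imp_le] unfolding set_integrable_def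
    by (subst nn_integral_eq_integral) auto
  finally show ?thesis .
qed

lemma modular_const_finite: "modular (\<lambda>x. c) < \<infinity>"
proof -
  have "modular (\<lambda>x. c) = ennreal (\<phi> c) * (\<integral>\<^sup>+x\<in>{0..2 * pi}. ennreal (W x) \<partial>lborel)"
    using young_fun_nonneg[OF \<phi>] W_pos[THEN less_imp_le]
    by (subst nn_integral_cmult[symmetric]) (auto simp: ennreal_mult mult.assoc)
  also have "\<dots> < \<infinity>" using W_nn_integral_finite by (simp add: ennreal_mult_less_top)
  finally show ?thesis .
qed

text \<open>Finiteness of the norm of constants converts uniform convergence into convergence in
  \<open>N\<close>.\<close>

lemma N_one_finite: "N (\<lambda>x. 1) < \<infinity>"
proof -
  obtain m where m: "modular (\<lambda>x. 1) = ennreal m" "0 \<le> m"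
    using modular_const_finite[of 1] by (cases "modular (\<lambda>x. 1)") auto
  define M where "M = max 1 m"
  have M: "1 \<le> M" "modular (\<lambda>x. 1) \<le> ennreal M" using m by (auto simp: M_def intro: ennreal_leI)
  have "modular (\<lambda>x. 1 / (C\<^sub>0 * M)) \<le> 1" by (rule modular_scale_down[OF M(1) _ _ M(2)]) auto
  moreover have "\<bar>1 / (C\<^sub>0 * M)\<bar> = 1 / (C\<^sub>0 * M)" using M C0 by simp
  ultimately have "N (\<lambda>x. 1 / (C\<^sub>0 * M)) \<le> 2" by (intro N_le_2_of_modular) auto
  then have fin: "N (\<lambda>x. 1 / (C\<^sub>0 * M)) < \<infinity>" by (rule le_less_trans) simp
  have "N (\<lambda>x. 1) = N (\<lambda>x. (C\<^sub>0 * M) * (1 / (C\<^sub>0 * M)))" using M C0 by simp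
  also have "\<dots> = ennreal \<bar>C\<^sub>0 * M\<bar> * N (\<lambda>x. 1 / (C\<^sub>0 * M))" by (rule N_cmult) simp
  also have "\<dots> < \<infinity>" using fin by (simp add: ennreal_mult_less_top)
  finally show ?thesis .
qed

lemma N_const: "N (\<lambda>x. c) = ennreal \<bar>c\<bar> * N (\<lambda>x. 1)"
  using N_cmult[of "\<lambda>x. 1" c] by simp

lemma N_const_tendsto_0:
  assumes "e \<longlonglongrightarrow> 0"
  shows "(\<lambda>M. N (\<lambda>x. e M)) \<longlonglongrightarrow> 0"
proof -
  have "(\<lambda>M. N (\<lambda>x. 1) * ennreal \<bar>e M\<bar>) \<longlonglongrightarrow> N (\<lambda>x. 1) * ennreal \<bar>0\<bar>"
    using assms N_one_finite by (intro ennreal_tendsto_cmult tendsto_ennrealI tendsto_rabs) auto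
  then show ?thesis by (subst N_const) (simp add: mult.commute)
qed

lemma N_frac_sum:
  assumes f: "periodic_L1 f" and h: "0 < h" and s: "0 \<le> s"
  shows "N (frac_sum s h M f) \<le> ennreal ((\<Sum>j. \<bar>frac_coeff s j\<bar>) * norm_const) * N f"
proof -
  have "N (frac_sum s h M f) \<le> (\<Sum>j<M. N (\<lambda>x. frac_coeff s j * (avg h ^^ j) f x))"
    unfolding frac_sum_def[abs_def] by (intro N_sum periodic_L1_meas periodic_L1_cmult periodic_L1_avg_pow f h)
  also have "\<dots> \<le> (\<Sum>j<M. ennreal \<bar>frac_coeff s j\<bar> * (ennreal norm_const * N f))"
    by (intro sum_mono, subst N_cmult) (auto intro!: mult_left_mono N_avg_pow f h periodic_L1_meas periodic_L1_avg_pow)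
  also have "\<dots> = ennreal (\<Sum>j<M. \<bar>frac_coeff s j\<bar>) * (ennreal norm_const * N f)"
    by (simp add: sum_distrib_right[symmetric])
  also have "\<dots> \<le> ennreal (\<Sum>j. \<bar>frac_coeff s j\<bar>) * (ennreal norm_const * N f)"
    by (intro mult_right_mono ennreal_leI sum_le_suminf summable_frac_coeff s) auto
  also have "\<dots> = ennreal ((\<Sum>j. \<bar>frac_coeff s j\<bar>) * norm_const) * N f"
    using norm_const by (simp add: ennreal_mult suminf_nonneg summable_frac_coeff s mult.assoc)
  finally show ?thesis .
qed

text \<open>Stated for an arbitrary norm limit F, because \<open>frac_diff\<close> is only some
  limit picked by choice. With s = r - k, the truncated series for (I - A)^s is applied to that for
  (I - A)^k. It is bounded uniformly in M, so the limit M to infinity replaces the inner partial sum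
  by F.\<close>

theorem N_avg_diff_pow_le:
  assumes k: "0 \<le> k" "k \<le> real r"
  shows "\<exists>c>0. \<forall>n\<ge>1. \<forall>f F. periodic_L1 f \<longrightarrow> F \<in> borel_measurable borel \<longrightarrow>
    (\<lambda>M. N (\<lambda>x. frac_sum k (1 / real n) M f x - F x)) \<longlonglongrightarrow> 0 \<longrightarrow> N ((avg_diff n ^^ r) f) \<le> ennreal c * N F"
proof -
  define s where "s = real r - k"
  have s: "0 \<le> s" "s + k = real r" using k by (auto simp: s_def)
  define c where "c = (\<Sum>j. \<bar>frac_coeff s j\<bar>) * norm_const"
  have "\<bar>frac_coeff s 0\<bar> \<le> (\<Sum>j. \<bar>frac_coeff s j\<bar>)" using sum_le_suminf[OF summable_frac_coeff[OF s(1)], of "{0}"] by simp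
  then have "1 \<le> (\<Sum>j. \<bar>frac_coeff s j\<bar>)" by (simp add: frac_coeff_def)
  then have c: "0 < c" using norm_const by (simp add: c_def)
  have "N ((avg_diff n ^^ r) f) \<le> ennreal c * N F"
    if n: "1 \<le> n" and f: "periodic_L1 f" and [measurable]: "F \<in> borel_measurable borel"
      and lim: "(\<lambda>M. N (\<lambda>x. frac_sum k (1 / real n) M f x - F x)) \<longlonglongrightarrow> 0" for n f F
  proof -
    let ?h = "1 / real n"
    have h: "0 < ?h" using n by simp
    obtain B where B: "0 \<le> B" "\<And>j x. 1 \<le> j \<Longrightarrow> \<bar>(avg ?h ^^ j) f x\<bar> \<le> B" using avg_pow_bounded[OF f h] by blast
    define e where "e M = off_triangle_sum (frac_coeff s) (frac_coeff k) M * B" for M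
    have e: "e \<longlonglongrightarrow> 0"
      unfolding e_def using tendsto_mult[OF off_triangle_sum_tendsto_0[OF summable_frac_coeff[OF k(1)] summable_frac_coeff[OF s(1)]] tendsto_const[of B]] by simp
    note [measurable] = periodic_L1_meas[OF periodic_L1_frac_sum[OF f h]] periodic_L1_meas[OF periodic_L1_frac_sum[OF periodic_L1_frac_sum[OF f h] h]]
      periodic_L1_meas[OF periodic_L1_avg_diff_pow[OF f n]]
    have le: "N ((avg_diff n ^^ r) f) \<le> ennreal c * (N (\<lambda>x. frac_sum k ?h M f x - F x) + N F) + N (\<lambda>x. e M)" if M: "r < M" for M
    proof -
      have "N ((avg_diff n ^^ r) f) = N (\<lambda>x. frac_sum s ?h M (frac_sum k ?h M f) x + ((avg_diff n ^^ r) f x - frac_sum s ?h M (frac_sum k ?h M f) x))"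
        by simp
      also have "\<dots> \<le> N (frac_sum s ?h M (frac_sum k ?h M f)) + N (\<lambda>x. (avg_diff n ^^ r) f x - frac_sum s ?h M (frac_sum k ?h M f) x)"
        by (rule N_add) measurable
      also have "N (\<lambda>x. (avg_diff n ^^ r) f x - frac_sum s ?h M (frac_sum k ?h M f) x) \<le> N (\<lambda>x. e M)"
        using frac_sum_frac_sum_approx[OF f n s(2) M B] by (intro N_mono) (auto simp: e_def intro: order_trans[OF _ abs_ge_self])
      also have "N (frac_sum s ?h M (frac_sum k ?h M f)) \<le> ennreal c * N (frac_sum k ?h M f)"
        unfolding c_def by (rule N_frac_sum[OF periodic_L1_frac_sum[OF f h] h s(1)])
      also have "N (frac_sum k ?h M f) \<le> N (\<lambda>x. frac_sum k ?h M f x - F x) + N F"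
        using N_add[of "\<lambda>x. frac_sum k ?h M f x - F x" F] by simp
      finally show ?thesis by (simp add: mult_left_mono add_mono add_right_mono)
    qed
    have "(\<lambda>M. ennreal c * (N (\<lambda>x. frac_sum k ?h M f x - F x) + N F) + N (\<lambda>x. e M)) \<longlonglongrightarrow> ennreal c * (0 + N F) + 0"
      by (intro tendsto_add ennreal_tendsto_cmult lim tendsto_const N_const_tendsto_0 e) auto
    then have "N ((avg_diff n ^^ r) f) \<le> ennreal c * (0 + N F) + 0"
      by (rule LIMSEQ_le_const) (use le in \<open>auto intro!: exI[of _ "Suc r"]\<close>)
    then show ?thesis by simp
  qed
  then show ?thesis using c by blast
qed

text \<open>Without a limit in the Orlicz space the choice in \<open>frac_diff\<close> would be
  void. All terms after the first are uniformly bounded with summable coefficients, so the series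
  converges everywhere, and its tails are uniformly small.\<close>

lemma frac_diff_exists:
  assumes f: "periodic_L1 f" and fO: "0 < C" "modular (\<lambda>x. C * \<bar>f x\<bar>) < \<infinity>" and h: "0 < h" and k: "0 \<le> k"
  shows "\<exists>F. F \<in> borel_measurable borel \<and> periodic F \<and> (\<exists>C>0. modular (\<lambda>x. C * \<bar>F x\<bar>) < \<infinity>) \<and>
    (\<lambda>M. N (\<lambda>x. frac_sum k h M f x - F x)) \<longlonglongrightarrow> 0"
proof -
  note [measurable] = periodic_L1_meas[OF f] periodic_L1_meas[OF periodic_L1_avg_pow[OF f h]]
  obtain B where B: "0 \<le> B" "\<And>j x. 1 \<le> j \<Longrightarrow> \<bar>(avg h ^^ j) f x\<bar> \<le> B" using avg_pow_bounded[OF f h] by blast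
  define y where "y x j = frac_coeff k j * (avg h ^^ j) f x" for x j
  define F where "F x = (\<Sum>j. y x j)" for x
  have sa: "summable (\<lambda>j. \<bar>frac_coeff k j\<bar> * B)" by (intro summable_mult2 summable_frac_coeff k)
  have yb: "\<bar>y x j\<bar> \<le> \<bar>frac_coeff k j\<bar> * B" if "1 \<le> j" for x j
    unfolding y_def abs_mult using B(2)[OF that, of x] by (intro mult_left_mono) auto
  have avg_symbol: "summable (\<lambda>j. \<bar>y x j\<bar>)" for x
    by (rule summable_comparison_test[OF _ sa]) (use yb in \<open>auto intro!: exI[of _ 1]\<close>)
  have tail: "\<bar>frac_sum k h M f x - F x\<bar> \<le> (\<Sum>j. \<bar>frac_coeff k (j + M)\<bar> * B)" if M: "1 \<le> M" for M x
  proof -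
    have "F x = (\<Sum>j. y x (j + M)) + frac_sum k h M f x"
      unfolding F_def frac_sum_def y_def[symmetric] by (rule suminf_split_initial_segment[OF summable_rabs_cancel[OF avg_symbol]])
    then have "\<bar>frac_sum k h M f x - F x\<bar> = \<bar>\<Sum>j. y x (j + M)\<bar>" by simp
    also have "\<dots> \<le> (\<Sum>j. \<bar>y x (j + M)\<bar>)" by (rule summable_rabs[OF summable_ignore_initial_segment[OF avg_symbol]])
    also have "\<dots> \<le> (\<Sum>j. \<bar>frac_coeff k (j + M)\<bar> * B)"
      using M by (intro suminf_le yb summable_ignore_initial_segment[OF avg_symbol] summable_ignore_initial_segment[OF sa]) auto
    finally show ?thesis .
  qed
  have Fm: "F \<in> borel_measurable borel" unfolding F_def[abs_def] y_def by measurable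
  have perF: "periodic F"
    unfolding periodic_def F_def y_def using periodic_L1_periodic[OF periodic_L1_avg_pow[OF f h]] by (simp add: periodic_def)
  define A where "A = (\<Sum>j. \<bar>frac_coeff k (j + 1)\<bar> * B)"
  have A: "0 \<le> A" unfolding A_def using B(1) by (intro suminf_nonneg summable_ignore_initial_segment[OF sa]) auto
  \<comment> \<open>The partial sum for M = 1 is f itself, the only term that may be
    unbounded.\<close>
  have Fle: "\<bar>F x\<bar> \<le> \<bar>f x\<bar> + A" for x
    using tail[of 1 x] by (simp add: frac_sum_def frac_coeff_def A_def)
  have "modular (\<lambda>x. C / 2 * \<bar>F x\<bar>) \<le> modular (\<lambda>x. C * \<bar>f x\<bar>) + modular (\<lambda>x. C * A)"
  proof -
    have "modular (\<lambda>x. C / 2 * \<bar>F x\<bar>) \<le> (\<integral>\<^sup>+x. ennreal (\<phi> (C * \<bar>f x\<bar>) * W x) * indicator {0..2 * pi} x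
        + ennreal (\<phi> (C * A) * W x) * indicator {0..2 * pi} x \<partial>lborel)"
    proof (rule nn_integral_mono)
      fix x
      \<comment> \<open>Monotonicity alone suffices: half the sum of two numbers is at most their
        maximum, and \<phi> of the maximum is one of the two terms on the right. This is the reason
        for C / 2.\<close>
      have "\<phi> (C / 2 * \<bar>F x\<bar>) \<le> \<phi> (C * \<bar>f x\<bar>) + \<phi> (C * A)"
      proof (cases "\<bar>f x\<bar> \<le> A")
        case True
        have "C / 2 * \<bar>F x\<bar> \<le> C / 2 * (A + A)" using Fle[of x] True fO(1) by (intro mult_left_mono) auto
        then have "\<phi> (C / 2 * \<bar>F x\<bar>) \<le> \<phi> (C * A)" using fO(1) by (intro young_fun_mono[OF \<phi>]) auto
        then show ?thesis using young_fun_nonneg[OF \<phi>, of "C * \<bar>f x\<bar>"] by linarith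
      next
        case False
        have "C / 2 * \<bar>F x\<bar> \<le> C / 2 * (\<bar>f x\<bar> + \<bar>f x\<bar>)" using Fle[of x] False fO(1) by (intro mult_left_mono) auto
        then have "\<phi> (C / 2 * \<bar>F x\<bar>) \<le> \<phi> (C * \<bar>f x\<bar>)" using fO(1) by (intro young_fun_mono[OF \<phi>]) auto
        then show ?thesis using young_fun_nonneg[OF \<phi>, of "C * A"] by linarith
      qed
      then have "ennreal (\<phi> (C / 2 * \<bar>F x\<bar>) * W x) \<le> ennreal (\<phi> (C * \<bar>f x\<bar>) * W x + \<phi> (C * A) * W x)"
        using W_pos[of x] by (intro ennreal_leI) (simp add: distrib_right[symmetric])
      also have "\<dots> = ennreal (\<phi> (C * \<bar>f x\<bar>) * W x) + ennreal (\<phi> (C * A) * W x)"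
        using W_pos[of x] young_fun_nonneg[OF \<phi>] by (intro ennreal_plus) auto
      finally show "ennreal (\<phi> (C / 2 * \<bar>F x\<bar>) * W x) * indicator {0..2 * pi} x
        \<le> ennreal (\<phi> (C * \<bar>f x\<bar>) * W x) * indicator {0..2 * pi} x + ennreal (\<phi> (C * A) * W x) * indicator {0..2 * pi} x"
        by (cases "x \<in> {0..2 * pi}") auto
    qed
    also have "\<dots> = modular (\<lambda>x. C * \<bar>f x\<bar>) + modular (\<lambda>x. C * A)"
      by (intro nn_integral_add) measurable
    finally show ?thesis .
  qed
  also have "\<dots> < \<infinity>" using fO(2) modular_const_finite by simp
  finally have Fmod: "modular (\<lambda>x. C / 2 * \<bar>F x\<bar>) < \<infinity>" .
  have "(\<lambda>M. N (\<lambda>x. frac_sum k h M f x - F x)) \<longlonglongrightarrow> 0"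
  proof (rule tendsto_sandwich[OF _ _ tendsto_const])
    have "(\<lambda>M. \<Sum>j. \<bar>frac_coeff k (j + M)\<bar> * B) \<longlonglongrightarrow> 0"
      by (rule suminf_exist_split2[OF sa])
    then show "(\<lambda>M. N (\<lambda>x. \<Sum>j. \<bar>frac_coeff k (j + M)\<bar> * B)) \<longlonglongrightarrow> 0" by (rule N_const_tendsto_0)
    show "\<forall>\<^sub>F M in sequentially. N (\<lambda>x. frac_sum k h M f x - F x) \<le> N (\<lambda>x. \<Sum>j. \<bar>frac_coeff k (j + M)\<bar> * B)"
      unfolding eventually_sequentially
      using tail by (intro exI[of _ 1] allI impI N_mono) (auto intro: order_trans[OF _ abs_ge_self])
  qed simp
  then show ?thesis using Fm perF Fmod fO(1) by (intro exI[of _ F] conjI exI[of _ "C / 2"]) auto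
qed

text \<open>\<open>\<Phi>\<close> grows at least linearly, and \<open>\<phi>\<^bsup>1/q\<^esup>(C|f|)\<close> is integrable by Hoelder's inequality.\<close>

lemma periodic_L1_of_modular:
  assumes [measurable]: "f \<in> borel_measurable borel" and perf: "periodic f" and C: "0 < C" and fin: "modular (\<lambda>x. C * \<bar>f x\<bar>) < \<infinity>"
  shows "periodic_L1 f"
  unfolding periodic_L1_def
proof (intro conjI allI perf)
  fix a b :: real
  let ?J = "{a<..b}"
  have "(\<integral>\<^sup>+y\<in>{a..b}. ennreal (\<phi> (C * \<bar>f y\<bar>) * W y) \<partial>lborel) < \<infinity>"
    by (rule nn_integral_periodic_finite[OF _ _ fin]) (use perf perW in \<open>auto simp: periodic_def\<close>)
  from Hoelder_weight(2)[OF _ this[unfolded nn_integral_Icc_Ioc]]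
  have H: "integrable lborel (\<lambda>y. indicator ?J y * \<phi> (C * \<bar>f y\<bar>) powr (1/q))"
    by (simp add: set_integrable_def)
  have "filterlim \<Phi> at_top at_top" using \<Phi>(1) by (simp add: young_fun_def)
  then have "\<forall>\<^sub>F x in at_top. 1 \<le> \<Phi> x" by (simp add: filterlim_at_top)
  then obtain z where "\<And>x. z \<le> x \<Longrightarrow> 1 \<le> \<Phi> x" unfolding eventually_at_top_linorder by blast
  then obtain x0 where x0: "0 < x0" "1 \<le> \<Phi> x0" by (metis le_max_iff_disj less_max_iff_disj max.cobounded1 zero_less_one)
  have lin: "y \<le> x0 + x0 * \<Phi> y" if y: "0 \<le> y" for y
  proof (cases "y \<le> x0")
    case True
    then show ?thesis using x0 young_fun_nonneg[OF \<Phi>(1), of y] by (simp add: add_increasing2)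
  next
    case False
    have "1 \<le> \<Phi> ((x0 / y) * y)" using x0 False by simp
    also have "\<dots> \<le> (x0 / y) * \<Phi> y" using x0 False by (intro \<Phi>_scale) auto
    finally have "y \<le> x0 * \<Phi> y" using x0 False by (simp add: field_simps)
    then show ?thesis using x0 by linarith
  qed
  show "set_integrable lborel ?J f"
    unfolding set_integrable_def
  proof (rule Bochner_Integration.integrable_bound)
    show "integrable lborel (\<lambda>y. 1 / C * (x0 * indicator ?J y + x0 * (indicator ?J y * \<phi> (C * \<bar>f y\<bar>) powr (1/q))))"
      by (intro integrable_mult_right Bochner_Integration.integrable_add H integrable_indicator_Ioc)
    show "AE y in lborel. norm (indicat_real ?J y *\<^sub>R f y)
      \<le> norm (1 / C * (x0 * indicator ?J y + x0 * (indicator ?J y * \<phi> (C * \<bar>f y\<bar>) powr (1/q))))"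
    proof (rule AE_I2)
      fix y
      show "norm (indicat_real ?J y *\<^sub>R f y)
        \<le> norm (1 / C * (x0 * indicator ?J y + x0 * (indicator ?J y * \<phi> (C * \<bar>f y\<bar>) powr (1/q))))"
      proof (cases "y \<in> ?J")
        case True
        have "C * \<bar>f y\<bar> \<le> x0 + x0 * \<Phi> (C * \<bar>f y\<bar>)" using C by (intro lin) simp
        also have "\<dots> \<le> x0 + x0 * \<phi> (C * \<bar>f y\<bar>) powr (1/q)"
          using x0 C by (intro add_left_mono mult_left_mono lower) auto
        finally have "\<bar>f y\<bar> \<le> 1 / C * (x0 + x0 * \<phi> (C * \<bar>f y\<bar>) powr (1/q))" using C by (simp add: field_simps)
        from order_trans[OF this abs_ge_self] show ?thesis using True by simp
      qed simp
    qed
  qed measurable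
qed measurable

end

section \<open>Borel representatives and the main theorem\<close>

lemma AE_lborel_shift:
  assumes "AE x in lborel. P (x :: real)"
  shows "AE x in lborel. P (t + x)"
proof -
  obtain N where N: "N \<in> null_sets lborel" "{x. \<not> P x} \<subseteq> N"
    using assms unfolding eventually_ae_filter by auto
  then have "AE x in lborel. x \<notin> N" by (intro AE_not_in)
  moreover have [measurable]: "N \<in> sets borel" using N(1) by (auto simp: null_sets_def)
  ultimately have "AE x in lborel. t + 1 * x \<notin> N" by (intro AE_borel_affine) auto
  then show ?thesis by eventually_elim (use N(2) in auto)
qed

text \<open>A Borel representative need not be periodic, so it is composed with the reduction modulo
  2 pi. Agreement almost everywhere survives because a countable union of translates of a null set
  is null.\<close>

lemma periodic_borel_version:
  fixes f :: "real \<Rightarrow> real"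
  assumes f: "f \<in> borel_measurable lebesgue" and perf: "periodic f"
  shows "\<exists>g. g \<in> borel_measurable borel \<and> periodic g \<and> (AE x in lborel. f x = g x)"
proof -
  obtain g0 where [measurable]: "g0 \<in> borel_measurable borel" and AE0: "AE x in lborel. f x = g0 x"
    using completion_ex_borel_measurable_real[OF f] by auto
  define red where "red x = x - of_int \<lfloor>x / (2 * pi)\<rfloor> * (2 * pi)" for x :: real
  have [measurable]: "red \<in> borel_measurable borel" unfolding red_def[abs_def] by measurable
  define g where "g x = g0 (red x)" for x
  have gm: "g \<in> borel_measurable borel" unfolding g_def[abs_def] by measurable
  have "red (x + 2 * pi) = red x" for x
  proof -
    have "(x + 2 * pi) / (2 * pi) = x / (2 * pi) + 1" by (simp add: add_divide_distrib)
    then have "\<lfloor>(x + 2 * pi) / (2 * pi)\<rfloor> = \<lfloor>x / (2 * pi)\<rfloor> + 1" by simp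
    then show ?thesis unfolding red_def by (simp add: algebra_simps)
  qed
  then have pg: "periodic g" by (simp add: periodic_def g_def)
  have "AE x in lborel. \<forall>k::int. f (of_int k * (2 * pi) + x) = g0 (of_int k * (2 * pi) + x)"
    unfolding AE_all_countable using AE_lborel_shift[OF AE0] by blast
  then have "AE x in lborel. f x = g x"
  proof eventually_elim
    case (elim x)
    define k where "k = - \<lfloor>x / (2 * pi)\<rfloor>"
    have r: "of_int k * (2 * pi) + x = red x" by (simp add: red_def k_def)
    have "f x = f (red x)" using periodic_of_int[OF perf, of x k] by (simp add: r[symmetric] add.commute)
    also have "\<dots> = g x" using elim[rule_format, of k] by (simp add: g_def r)
    finally show ?case .
  qed
  then show ?thesis using gm pg by blast
qed

lemma integral_lebesgue_eq_lborel:
  fixes F G :: "real \<Rightarrow> real"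
  assumes "AE x in lborel. F x = G x" and G: "G \<in> borel_measurable borel"
  shows "integral\<^sup>L lebesgue F = integral\<^sup>L lborel G" "integrable lebesgue F \<longleftrightarrow> integrable lborel G"
proof -
  have AE: "AE x in lebesgue. G x = F x" using assms(1) by (intro AE_completion) auto
  have Gl: "G \<in> borel_measurable lebesgue" using G by (intro measurable_completion) simp
  then have Fl: "F \<in> borel_measurable lebesgue" using AE by (rule borel_measurable_AE)
  have "integral\<^sup>L lebesgue F = integral\<^sup>L lebesgue G" using AE Fl Gl by (intro integral_cong_AE) auto
  then show "integral\<^sup>L lebesgue F = integral\<^sup>L lborel G" using G by (simp add: integral_completion)
  have "integrable lebesgue F \<longleftrightarrow> integrable lebesgue G" using AE Fl Gl by (intro integrable_cong_AE) auto
  then show "integrable lebesgue F \<longleftrightarrow> integrable lborel G" using G by (simp add: integrable_completion)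
qed

lemma Icc_lebesgue_eq_Ioc_lborel:
  fixes F G :: "real \<Rightarrow> real"
  assumes AE: "AE x in lborel. F x = G x" and [measurable]: "G \<in> borel_measurable borel"
  shows "(LINT x:{a..b}|lebesgue. F x) = lint G {a<..b}" "set_integrable lebesgue {a..b} F \<longleftrightarrow> set_integrable lborel {a<..b} G"
proof -
  have "AE x in lborel. x \<noteq> a" by (rule AE_lborel_singleton)
  with AE have "AE x in lborel. indicat_real {a..b} x *\<^sub>R F x = indicat_real {a<..b} x *\<^sub>R G x"
    by eventually_elim (auto simp: indicator_def)
  note * = integral_lebesgue_eq_lborel[OF this]
  show "(LINT x:{a..b}|lebesgue. F x) = lint G {a<..b}" "set_integrable lebesgue {a..b} F \<longleftrightarrow> set_integrable lborel {a<..b} G"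
    unfolding set_lebesgue_integral_def set_integrable_def by (intro *; measurable)+
qed

lemma steklov_eq_avg:
  assumes AE: "AE x in lborel. f x = g x" and [measurable]: "g \<in> borel_measurable borel"
  shows "steklov h f = avg h g"
proof
  fix x
  have "(LINT t:{- h / 2..h / 2}|lebesgue. f (x + t)) = (LINT t:{- h / 2<..h / 2}|lborel. g (x + t))"
    by (rule Icc_lebesgue_eq_Ioc_lborel[OF AE_lborel_shift[OF AE]]) measurable
  then show "steklov h f x = avg h g x"
    by (simp add: steklov_def avg_def lint_shift)
qed

text \<open>From the first mean on, equality holds at every point; only the power 0 is restricted to
  almost every point, hence \<open>Suc j\<close>.\<close>

lemma steklov_pow_eq_avg_pow:
  assumes AE: "AE x in lborel. f x = g x" and g: "periodic_L1 g" and h: "0 < h"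
  shows "(steklov h ^^ Suc j) f = (avg h ^^ Suc j) g"
proof (induction j)
  case 0
  then show ?case using steklov_eq_avg[OF AE periodic_L1_meas[OF g]] by simp
next
  case (Suc j)
  have "(steklov h ^^ Suc (Suc j)) f = steklov h ((avg h ^^ Suc j) g)" using Suc by simp
  also have "\<dots> = avg h ((avg h ^^ Suc j) g)" by (intro steklov_eq_avg periodic_L1_meas periodic_L1_avg_pow g h) auto
  finally show ?case by simp
qed

lemma frac_diff_partial_AE:
  assumes AE: "AE x in lborel. f x = g x" and g: "periodic_L1 g" and h: "0 < h"
  shows "AE x in lborel. frac_diff_partial k h f M x = frac_sum k h M g x"
  using AE
proof eventually_elim
  case (elim x)
  have "(steklov h ^^ j) f x = (avg h ^^ j) g x" for j
    using elim steklov_pow_eq_avg_pow[OF AE g h] by (cases j) (simp_all del: funpow.simps(2))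
  then show ?case by (simp add: frac_diff_partial_def frac_sum_def frac_coeff_def)
qed

lemma orlicz_norm_cong_AE:
  assumes W: "AE x in lborel. W x = W' x" and f: "AE x in lborel. f x = f' x"
  shows "orlicz_norm \<phi> W f = orlicz_norm \<phi> W' f'"
proof -
  have "dual_ball \<phi> W = dual_ball \<phi> W'"
  proof -
    have "(\<integral>\<^sup>+x\<in>{0..2 * pi}. compl_fun \<phi> \<bar>g x\<bar> * ennreal (W x) \<partial>lborel)
       = (\<integral>\<^sup>+x\<in>{0..2 * pi}. compl_fun \<phi> \<bar>g x\<bar> * ennreal (W' x) \<partial>lborel)" for g
      using W by (intro nn_integral_cong_AE) (auto elim!: eventually_mono)
    then show ?thesis by (simp add: dual_ball_def)
  qed
  moreover have "pairing W f g = pairing W' f' g" for g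
    unfolding pairing_def using W f
    by (intro nn_integral_cong_AE) (auto elim: eventually_elim2)
  ultimately show ?thesis unfolding orlicz_norm_eq_SUP_dual_ball by simp
qed

lemma orlicz_space_modular_cong_AE:
  assumes W: "AE x in lborel. W x = W' x" and f: "AE x in lborel. f x = f' x"
  shows "(\<integral>\<^sup>+x. ennreal (\<phi> (C * \<bar>f x\<bar>) * W x) \<partial>torus) = (\<integral>\<^sup>+x\<in>{0..2 * pi}. ennreal (\<phi> (C * \<bar>f' x\<bar>) * W' x) \<partial>lborel)"
  unfolding nn_integral_torus using W f by (intro nn_integral_cong_AE) (auto elim: eventually_elim2)

lemma Muckenhoupt_imp_Ap_weight:
  assumes W: "W \<in> Muckenhoupt P"
  shows "\<exists>W'. Ap_weight P W' \<and> periodic W' \<and> (AE x in lborel. W x = W' x)"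
proof -
  have Wm: "W \<in> borel_measurable lebesgue" and Wpos: "AE x in lebesgue. 0 < W x" and Wper: "periodic W"
    and P: "1 < P" and int: "\<And>a b. a < b \<Longrightarrow> set_integrable lebesgue {a..b} W"
      "\<And>a b. a < b \<Longrightarrow> set_integrable lebesgue {a..b} (\<lambda>x. W x powr (1 / (1 - P)))"
    using W by (auto simp: Muckenhoupt_def weight_def periodic_def)
  obtain C where C: "\<And>a b. a < b \<Longrightarrow> (1 / (b - a) * (LINT x:{a..b}|lebesgue. W x)) *
        (1 / (b - a) * (LINT x:{a..b}|lebesgue. W x powr (1 / (1 - P)))) powr (P - 1) \<le> C"
    using W unfolding Muckenhoupt_def bdd_above_def by blast
  obtain g where g [measurable]: "g \<in> borel_measurable borel" and pg: "periodic g" and AEg: "AE x in lborel. W x = g x"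
    using periodic_borel_version[OF Wm Wper] by blast
  define W' where "W' x = (if 0 < g x then g x else 1)" for x
  have W'm [measurable]: "W' \<in> borel_measurable borel" unfolding W'_def[abs_def] by measurable
  have W'pos: "0 < W' x" for x by (simp add: W'_def)
  have perW': "periodic W'" using pg by (simp add: periodic_def W'_def)
  have "AE x in lborel. 0 < W x" using Wpos by (simp add: AE_completion_iff)
  with AEg have AE: "AE x in lborel. W x = W' x"
    by eventually_elim (auto simp: W'_def)
  then have AEp: "AE x in lborel. W x powr (1 / (1 - P)) = W' x powr (1 / (1 - P))"
    by eventually_elim simp
  have pm: "(\<lambda>x. W' x powr (1 / (1 - P))) \<in> borel_measurable borel" by measurable
  note e1 = Icc_lebesgue_eq_Ioc_lborel[OF AE W'm] and e2 = Icc_lebesgue_eq_Ioc_lborel[OF AEp pm]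
  have i: "set_integrable lborel {a<..b} W'" "set_integrable lborel {a<..b} (\<lambda>x. W' x powr (1 / (1 - P)))" for a b
    using int[of a b] e1(2)[of a b] e2(2)[of a b] by (cases "a < b"; simp add: set_integrable_def)+
  have "Ap_weight P W'"
    unfolding Ap_weight_def using W'm W'pos P i C unfolding e1(1) e2(1) by auto
  then show ?thesis using perW' AE by blast
qed

text \<open>Openness leaves room between the infimum in \<open>young_index\<close> and
  \<open>1 / q0\<close>; an exponent p of the defining set lies there, and q = 1/p stays in the
  range where W is an A_q weight.\<close>

lemma quasiconvex_exponent:
  assumes \<phi>: "\<phi> \<in> Q_class" and W: "Ap_weight (young_index \<phi>) W"
  shows "\<exists>q. Ap_weight q W \<and> quasiconvex (\<lambda>x. \<phi> x powr (1 / q))"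
proof -
  let ?S = "{p. 0 < p \<and> quasiconvex (\<lambda>x. \<phi> x powr p)}"
  have ne: "?S \<noteq> {}" and bdd: "bdd_below ?S"
    using \<phi> by (auto simp: Q_class_def intro!: bdd_belowI[of _ 0])
  obtain q0 where q0: "1 < q0" "q0 < young_index \<phi>" "\<And>q. q0 \<le> q \<Longrightarrow> q \<le> young_index \<phi> \<Longrightarrow> Ap_weight q W"
    using Ap_weight_open[OF W] by blast
  \<comment> \<open>Positivity of the infimum is read off from the index: were the infimum 0,
    division by zero would make the index 0.\<close>
  have "0 < young_index \<phi>" using q0 by linarith
  then have pos: "0 < Inf ?S" by (simp add: young_index_def)
  have "Inf ?S < 1 / q0" using q0 pos by (simp add: young_index_def field_simps)
  then obtain p where p: "0 < p" "quasiconvex (\<lambda>x. \<phi> x powr p)" "p < 1 / q0"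
    using cInf_lessD[OF ne] by blast
  have "Inf ?S \<le> p" using p bdd by (intro cInf_lower) auto
  then have "1 / p \<le> young_index \<phi>" using pos p by (simp add: young_index_def frac_le)
  moreover have "q0 \<le> 1 / p" using p q0 by (simp add: field_simps)
  ultimately show ?thesis using q0(3) p(2) by (intro exI[of _ "1 / p"]) auto
qed

theorem theorem5p2:
  fixes \<phi> W :: "real \<Rightarrow> real" and k :: real
  assumes "\<phi> \<in> Q_class"
    and "W \<in> Muckenhoupt (young_index \<phi>)"
    and "0 < k"
  shows "\<exists>C::real. 0 < C \<and>
    (\<forall>f\<in>orlicz_space \<phi> W. \<forall>n::nat. 1 \<le> n \<longrightarrow>
       best_approx \<phi> W n f \<le> ennreal C * mod_smooth \<phi> W k f (1 / real n))"
proof -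
  obtain W' where W': "Ap_weight (young_index \<phi>) W'" "periodic W'" and AEW: "AE x in lborel. W x = W' x"
    using Muckenhoupt_imp_Ap_weight[OF assms(2)] by blast
  obtain q where q: "Ap_weight q W'" "quasiconvex (\<lambda>x. \<phi> x powr (1 / q))"
    using quasiconvex_exponent[OF assms(1) W'(1)] by blast
  obtain \<Phi> C\<^sub>0 where \<Phi>: "young_fun \<Phi>" "convex_on UNIV \<Phi>" "1 \<le> C\<^sub>0"
    "\<And>x. 0 \<le> x \<Longrightarrow> \<Phi> x \<le> \<phi> x powr (1 / q)" "\<And>x. 0 \<le> x \<Longrightarrow> \<phi> x powr (1 / q) \<le> \<Phi> (C\<^sub>0 * x)"
    using q(2) unfolding quasiconvex_def by blast
  interpret weighted_orlicz \<phi> W' \<Phi> q C\<^sub>0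
    using assms(1) \<Phi> q W'(2) by unfold_locales (auto simp: Q_class_def)
  \<comment> \<open>The integer r is at least k, so the remaining exponent r - k is nonnegative and
    its binomial coefficients are absolutely summable.\<close>
  define r where "r = nat \<lceil>k\<rceil>"
  have r: "0 \<le> k" "k \<le> real r" using assms(3) by (auto simp: r_def real_nat_ceiling_ge)
  obtain c1 where c1: "c1 > 0" "\<And>n f. 1 \<le> n \<Longrightarrow> periodic_L1 f \<Longrightarrow> best_approx \<phi> W' n f \<le> ennreal c1 * N ((avg_diff n ^^ r) f)"
    using best_approx_le_avg_diff_pow[of r] by blast
  obtain c2 where c2: "c2 > 0" "\<And>n f F. 1 \<le> n \<Longrightarrow> periodic_L1 f \<Longrightarrow> F \<in> borel_measurable borel \<Longrightarrow>
      (\<lambda>M. N (\<lambda>x. frac_sum k (1 / real n) M f x - F x)) \<longlonglongrightarrow> 0 \<Longrightarrow> N ((avg_diff n ^^ r) f) \<le> ennreal c2 * N F"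
    using N_avg_diff_pow_le[OF r] by blast
  have "best_approx \<phi> W n f \<le> ennreal (c1 * c2) * mod_smooth \<phi> W k f (1 / real n)"
    if f: "f \<in> orlicz_space \<phi> W" and n: "1 \<le> n" for f n
  proof -
    let ?h = "1 / real n"
    have h: "0 < ?h" using n by simp
    have fm: "f \<in> borel_measurable lebesgue" "periodic f" using f by (auto simp: orlicz_space_def periodic_def)
    obtain C where C: "0 < C" "(\<integral>\<^sup>+x. ennreal (\<phi> (C * \<bar>f x\<bar>) * W x) \<partial>torus) < \<infinity>"
      using f by (auto simp: orlicz_space_def)
    obtain g where gm: "g \<in> borel_measurable borel" and perg: "periodic g" and AEf: "AE x in lborel. f x = g x"
      using periodic_borel_version[OF fm] by blast
    have gmod: "modular (\<lambda>x. C * \<bar>g x\<bar>) < \<infinity>"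
      using C(2) orlicz_space_modular_cong_AE[OF AEW AEf, of \<phi> C] by simp
    have g: "periodic_L1 g" by (rule periodic_L1_of_modular[OF gm perg C(1) gmod])
    have norm_eq: "orlicz_norm \<phi> W (\<lambda>x. frac_diff_partial k ?h f M x - F x) = N (\<lambda>x. frac_sum k ?h M g x - F x)" for M F
      using frac_diff_partial_AE[OF AEf g h, of k M]
      by (intro orlicz_norm_cong_AE AEW) (auto elim!: eventually_mono)
    \<comment> \<open>The property defining the choice in \<open>frac_diff\<close>, isolated so that
      \<open>F0\<close> can witness it and \<open>someI\<close> can transfer it to the chosen
      function.\<close>
    define is_diff where "is_diff F \<longleftrightarrow> F \<in> orlicz_space \<phi> W \<and>
        (\<lambda>M. orlicz_norm \<phi> W (\<lambda>x. frac_diff_partial k ?h f M x - F x)) \<longlonglongrightarrow> 0" for F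
    obtain F0 where F0: "F0 \<in> borel_measurable borel" "periodic F0" "\<exists>C>0. modular (\<lambda>x. C * \<bar>F0 x\<bar>) < \<infinity>"
        "(\<lambda>M. N (\<lambda>x. frac_sum k ?h M g x - F0 x)) \<longlonglongrightarrow> 0"
      using frac_diff_exists[OF g C(1) gmod h r(1)] by blast
    have "F0 \<in> orlicz_space \<phi> W"
      using F0(1-3) orlicz_space_modular_cong_AE[OF AEW, of F0 F0 \<phi>]
      by (auto simp: orlicz_space_def periodic_def intro: measurable_completion)
    then have "is_diff F0" using F0(4) by (simp add: is_diff_def norm_eq)
    then have D: "is_diff (frac_diff \<phi> W k ?h f)"
      unfolding frac_diff_def is_diff_def[symmetric] by (rule someI[of is_diff])
    define D0 where "D0 = frac_diff \<phi> W k ?h f"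
    have D0: "D0 \<in> borel_measurable lebesgue" "periodic D0" "(\<lambda>M. N (\<lambda>x. frac_sum k ?h M g x - D0 x)) \<longlonglongrightarrow> 0"
      using D by (auto simp: is_diff_def norm_eq D0_def[symmetric] orlicz_space_def periodic_def)
    \<comment> \<open>The chosen difference is only Lebesgue measurable; its Borel version has the
      same norm and is the same norm limit.\<close>
    obtain F where F: "F \<in> borel_measurable borel" "AE x in lborel. D0 x = F x"
      using periodic_borel_version[OF D0(1,2)] by blast
    have "N (\<lambda>x. frac_sum k ?h M g x - D0 x) = N (\<lambda>x. frac_sum k ?h M g x - F x)" for M
      using F(2) by (intro orlicz_norm_cong_AE) (auto elim!: eventually_mono)
    then have limF: "(\<lambda>M. N (\<lambda>x. frac_sum k ?h M g x - F x)) \<longlonglongrightarrow> 0" using D0(3) by simp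
    have "best_approx \<phi> W n f = best_approx \<phi> W' n g"
      unfolding best_approx_def using AEf
      by (intro INF_cong refl orlicz_norm_cong_AE AEW) (auto elim!: eventually_mono)
    also have "\<dots> \<le> ennreal c1 * N ((avg_diff n ^^ r) g)" by (rule c1(2)[OF n g])
    also have "\<dots> \<le> ennreal c1 * (ennreal c2 * N F)"
      by (intro mult_left_mono c2(2)[OF n g F(1) limF]) auto
    also have "N F = orlicz_norm \<phi> W D0"
      by (rule orlicz_norm_cong_AE[OF AEW F(2), symmetric])
    \<comment> \<open>The step 1/n is itself one of those over which the modulus of smoothness takes
      the supremum.\<close>
    also have "orlicz_norm \<phi> W D0 \<le> mod_smooth \<phi> W k f ?h"
      unfolding mod_smooth_def D0_def using h by (intro SUP_upper) auto
    finally show ?thesis using c1(1) c2(1) by (simp add: ennreal_mult mult.assoc mult_left_mono)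
  qed
  then show ?thesis using c1(1) c2(1) by (intro exI[of _ "c1 * c2"]) auto
qed

end
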